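(* Let $\theta\in(\underline\theta,\bar\theta)$ and start the process $\underline\omega(\cdot)$ from the stationary product distribution $\underline\mu_\theta$. For any $V\in\mathbb R$ and $t>0$, $$\mathbf{Var}(J^{(V)}(t))=\sum_{n=-\infty}^{\infty}\bigl|[Vt]-n\bigr|\cdot\mathbf{Cov}(\omega_n(t),\omega_0(0)).$$ Moreover, $$\sum_{n=-\infty}^{\infty}n\cdot\mathbf{Cov}(\omega_n(t),\omega_0(0))=t\cdot\mathbf{Cov}\bigl(p(\omega_0,\omega_1)-q(\omega_0,\omega_1),\ \omega_0+\omega_1\bigr),$$ where the covariance on the right-hand side is taken with respect to $\underline\mu_\theta$.
   Context: **Model.** Let $-\infty\le\omega^{\min}\le 0$ and $1\le\omega^{\max}\le\infty$ be (possibly infinite valued) integers, $I=\{z\in\mathbb Z:\omega^{\min}-1<z<\omega^{\max}+1\}$, $\Omega=I^{\mathbb Z}$, with elements $\underline\omega=(\omega_i)_{i\in\mathbb Z}$. Integer heights $h_i$ ($i\in\mathbb Z$) satisfy $\omega_i=h_{i-1}-h_i$. The dynamics: for each $i\in\mathbb Z$, at rate $p(\omega_i,\omega_{i+1})$ a brick is added, $(\omega_i,\omega_{i+1})\to(\omega_i-1,\omega_{i+1}+1)$, $h_i\to h_i+1$; at rate $q(\omega_i,\omega_{i+1})$ a brick is removed, $(\omega_i,\omega_{i+1})\to(\omega_i+1,\omega_{i+1}-1)$, $h_i\to h_i-1$. Conditionally on $\underline\omega(t)$ these moves are independent. The process is Markov with formal generator, on cylinder functions $\varphi$ (functions of finitely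 many coordinates), $$(L\varphi)(\underline\omega)=\sum_{i}p(\omega_i,\omega_{i+1})[\varphi(\dots,\omega_i-1,\omega_{i+1}+1,\dots)-\varphi(\underline\omega)]+\sum_i q(\omega_i,\omega_{i+1})[\varphi(\dots,\omega_i+1,\omega_{i+1}-1,\dots)-\varphi(\underline\omega)].$$ **Standing assumptions on $p,q:I\times I\to[0,\infty)$.** (1) $p(\omega^{\min},\cdot)\equiv p(\cdot,\omega^{\max})\equiv q(\omega^{\max},\cdot)\equiv q(\cdot,\omega^{\min})\equiv0$ whenever the corresponding $\omega^{\min}$ or $\omega^{\max}$ is finite. Either $p$ and $q$ are both non-zero in all other cases, or one of them is identically zero (and the other is non-zero in all other cases). (2) (Attractivity) $p(z+1,y)\ge p(z,y)$, $p(y,z+1)\le p(y,z)$, $q(z+1,y)\le q(z,y)$, $q(y,z+1)\ge q(y,z)$ for $y,z,z+1\in I$. (3) For all $x,y,z\in I$: $p(x,y)+p(y,z)+p(z,x)+q(x,y)+q(y,z)+q(z,x)=p(x,z)+p(z,y)+p(y,x)+q(x,z)+q(z,y)+q(y,x)$. (4) There are symmetric functions $s_p,s_q$ and a function $f$, with $f(\omega^{\min})=0$ if $\omega^{\min}$ is finite, such that $p(y,z)=s_p(y,z+1)f(y)$ and $q(y,z)=s_q(y+1,z)f(z)$ for $y,z\in I$. ($f$ is then non-decreasing on $I$.) (5) All moments of the rates $p(\omega_0,\omega_1),q(\omega_0,\omega_1)$ are finite under the distributions $\underline\mu_\theta$ below. (6) The dynamics exists on a set $\widetilde\Omega\subset\Omega$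 of tempered configurations (configurations obeying some growth restrictions) of full $\underline\mu_\theta$-measure, with the usual properties of the semigroup and the generator acting on nice functions. **Stationary measures.** For $z\in I$: $f(z)!=\prod_{y=1}^zf(y)$ if $z>0$, $f(0)!=1$, $f(z)!=1/\prod_{y=z+1}^0f(y)$ if $z<0$. Let $\bar\theta=\lim_{z\to\infty}\log f(z)$ if $\omega^{\max}=\infty$, $\bar\theta=\infty$ otherwise; $\underline\theta=\lim_{z\to\infty}\log f(-z)$ if $\omega^{\min}=-\infty$, $\underline\theta=-\infty$ otherwise. Assume $\underline\theta<\bar\theta$. For $\theta\in(\underline\theta,\bar\theta)$ let $Z(\theta)=\sum_{z\in I}e^{\theta z}/f(z)!<\infty$, $\mu_\theta(z)=\frac1{Z(\theta)}\frac{e^{\theta z}}{f(z)!}$ for $z\in I$ and $\mu_\theta(z)=0$ for $z\notin I$. $\underline\mu_\theta$ is the product distribution on $\Omega$ with all marginals $\mu_\theta$; it is stationary for the process. **Notation.** $[x]=\lfloor x\rfloor$ for $x\ge0$, $[x]=\lceil x\rceil$ for $x<0$. $J^{(V)}(t)=h_{[Vt]}(t)-h_0(0)$. *)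

theory Defs
  imports "HOL-Probability.Probability" "HOL-Library.Extended"
begin

definition spins :: "int extended \<Rightarrow> int extended \<Rightarrow> int set" where
  "spins \<omega>min \<omega>max = {z. \<omega>min - 1 < Fin z \<and> Fin z < \<omega>max + 1}"

definition ffact :: "(int \<Rightarrow> real) \<Rightarrow> int \<Rightarrow> real" where
  "ffact f z = (if z > 0 then \<Prod>y\<in>{1..z}. f y
                else if z = 0 then 1
                else 1 / (\<Prod>y\<in>{z+1..0}. f y))"

definition theta_upper :: "int extended \<Rightarrow> (int \<Rightarrow> real) \<Rightarrow> ereal" where
  "theta_upper \<omega>max f =
     (if \<omega>max = Pinf then lim (\<lambda>n. ereal (ln (f (int n)))) else PInfty)"

definition theta_lower :: "int extended \<Rightarrow> (int \<Rightarrow> real) \<Rightarrow> ereal" where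
  "theta_lower \<omega>min f =
     (if \<omega>min = Minf then lim (\<lambda>n. ereal (ln (f (- int n)))) else MInfty)"

definition theta_range :: "int extended \<Rightarrow> int extended \<Rightarrow> (int \<Rightarrow> real) \<Rightarrow> real set" where
  "theta_range \<omega>min \<omega>max f =
     {\<theta>. theta_lower \<omega>min f < ereal \<theta> \<and> ereal \<theta> < theta_upper \<omega>max f}"

definition Zpart :: "int extended \<Rightarrow> int extended \<Rightarrow> (int \<Rightarrow> real) \<Rightarrow> real \<Rightarrow> real" where
  "Zpart \<omega>min \<omega>max f \<theta> = (\<Sum>\<^sub>\<infinity>z\<in>spins \<omega>min \<omega>max. exp (\<theta> * real_of_int z) / ffact f z)"

definition mu :: "int extended \<Rightarrow> int extended \<Rightarrow> (int \<Rightarrow> real) \<Rightarrow> real \<Rightarrow> int measure" where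
  "mu \<omega>min \<omega>max f \<theta> = density (count_space UNIV)
     (\<lambda>z. if z \<in> spins \<omega>min \<omega>max
           then ennreal (1 / Zpart \<omega>min \<omega>max f \<theta> * (exp (\<theta> * real_of_int z) / ffact f z))
           else 0)"

definition Mu :: "int extended \<Rightarrow> int extended \<Rightarrow> (int \<Rightarrow> real) \<Rightarrow> real \<Rightarrow> (int \<Rightarrow> int) measure" where
  "Mu \<omega>min \<omega>max f \<theta> = PiM UNIV (\<lambda>_. mu \<omega>min \<omega>max f \<theta>)"

text \<open>Both spin configurations and height configurations live in \<open>int \<Rightarrow> int\<close> with the
  product (cylinder) sigma-algebra.\<close>

definition conf :: "(int \<Rightarrow> int) measure" where
  "conf = PiM UNIV (\<lambda>_. count_space UNIV)"

definition slope :: "(int \<Rightarrow> int) \<Rightarrow> int \<Rightarrow> int" where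
  "slope h i = h (i - 1) - h i"

definition heights :: "(int \<Rightarrow> int) set \<Rightarrow> (int \<Rightarrow> int) measure" where
  "heights W = restrict_space conf {h. slope h \<in> W}"

definition cylinder :: "((int \<Rightarrow> int) \<Rightarrow> real) \<Rightarrow> bool" where
  "cylinder \<phi> \<longleftrightarrow> (\<exists>D. finite D \<and> (\<forall>g h. (\<forall>i\<in>D. g i = h i) \<longrightarrow> \<phi> g = \<phi> h))"

text \<open>The generator, written for the height process. Raising \<open>h i\<close> by one changes the slopes
  by \<open>(\<omega> i, \<omega> (i+1)) \<mapsto> (\<omega> i - 1, \<omega> (i+1) + 1)\<close>, so for \<open>\<phi> = \<psi> \<circ> slope\<close> this is the generator
  of the spin process acting on \<open>\<psi>\<close>. For cylinder \<open>\<phi>\<close> the sum has finitely many nonzero terms.\<close>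

definition gen :: "(int \<Rightarrow> int \<Rightarrow> real) \<Rightarrow> (int \<Rightarrow> int \<Rightarrow> real) \<Rightarrow>
    ((int \<Rightarrow> int) \<Rightarrow> real) \<Rightarrow> (int \<Rightarrow> int) \<Rightarrow> real" where
  "gen p q \<phi> h =
     (\<Sum>\<^sub>\<infinity>i\<in>UNIV. p (slope h i) (slope h (i + 1)) * (\<phi> (h(i := h i + 1)) - \<phi> h)) +
     (\<Sum>\<^sub>\<infinity>i\<in>UNIV. q (slope h i) (slope h (i + 1)) * (\<phi> (h(i := h i - 1)) - \<phi> h))"

locale deposition_rates =
  fixes \<omega>min \<omega>max :: "int extended"
    and p q :: "int \<Rightarrow> int \<Rightarrow> real"
    and f :: "int \<Rightarrow> real"
  assumes \<omega>min_le: "\<omega>min \<le> 0" and \<omega>max_ge: "1 \<le> \<omega>max"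
    and rates_nonneg:
      "\<And>y z. y \<in> spins \<omega>min \<omega>max \<Longrightarrow> z \<in> spins \<omega>min \<omega>max \<Longrightarrow> 0 \<le> p y z \<and> 0 \<le> q y z"
    and rates_min:
      "\<And>m y. \<omega>min = Fin m \<Longrightarrow> y \<in> spins \<omega>min \<omega>max \<Longrightarrow> p m y = 0 \<and> q y m = 0"
    and rates_max:
      "\<And>m y. \<omega>max = Fin m \<Longrightarrow> y \<in> spins \<omega>min \<omega>max \<Longrightarrow> p y m = 0 \<and> q m y = 0"
    and rates_nonzero:
      "let I = spins \<omega>min \<omega>max;
           pnz = (\<forall>y\<in>I. \<forall>z\<in>I. Fin y \<noteq> \<omega>min \<longrightarrow> Fin z \<noteq> \<omega>max \<longrightarrow> p y z \<noteq> 0);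
           qnz = (\<forall>y\<in>I. \<forall>z\<in>I. Fin y \<noteq> \<omega>max \<longrightarrow> Fin z \<noteq> \<omega>min \<longrightarrow> q y z \<noteq> 0);
           pz = (\<forall>y\<in>I. \<forall>z\<in>I. p y z = 0);
           qz = (\<forall>y\<in>I. \<forall>z\<in>I. q y z = 0)
       in (pnz \<and> qnz) \<or> (pz \<and> qnz) \<or> (pnz \<and> qz)"
    and rates_attractive:
      "\<And>y z. \<lbrakk>y \<in> spins \<omega>min \<omega>max; z \<in> spins \<omega>min \<omega>max; z + 1 \<in> spins \<omega>min \<omega>max\<rbrakk> \<Longrightarrow>
         p (z + 1) y \<ge> p z y \<and> p y (z + 1) \<le> p y z \<and>
         q (z + 1) y \<le> q z y \<and> q y (z + 1) \<ge> q y z"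
    and rates_cyclic:
      "\<And>x y z. \<lbrakk>x \<in> spins \<omega>min \<omega>max; y \<in> spins \<omega>min \<omega>max; z \<in> spins \<omega>min \<omega>max\<rbrakk> \<Longrightarrow>
         p x y + p y z + p z x + q x y + q y z + q z x =
         p x z + p z y + p y x + q x z + q z y + q y x"
    and f_nonneg: "\<And>z. z \<in> spins \<omega>min \<omega>max \<Longrightarrow> 0 \<le> f z"
    and f_min: "\<And>m. \<omega>min = Fin m \<Longrightarrow> f m = 0"
    and rates_product:
      "\<exists>s\<^sub>p s\<^sub>q :: int \<Rightarrow> int \<Rightarrow> real.
         (\<forall>y z. s\<^sub>p y z = s\<^sub>p z y) \<and> (\<forall>y z. s\<^sub>q y z = s\<^sub>q z y) \<and>
         (\<forall>y\<in>spins \<omega>min \<omega>max. \<forall>z\<in>spins \<omega>min \<omega>max.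
            p y z = s\<^sub>p y (z + 1) * f y \<and> q y z = s\<^sub>q (y + 1) z * f z)"
    and rates_moments:
      "\<And>\<theta> k :: nat. \<theta> \<in> theta_range \<omega>min \<omega>max f \<Longrightarrow>
         integrable (Mu \<omega>min \<omega>max f \<theta>) (\<lambda>\<omega>. p (\<omega> 0) (\<omega> 1) ^ k) \<and>
         integrable (Mu \<omega>min \<omega>max f \<theta>) (\<lambda>\<omega>. q (\<omega> 0) (\<omega> 1) ^ k)"

text \<open>Existence of the dynamics: \<open>W\<close> is the set of tempered spin configurations and \<open>S t h\<close> the
  law at time \<open>t\<close> of the height process started from \<open>h\<close>. The generator is only required to act
  on bounded cylinder functions of the heights (\<open>gen_integrable\<close>, \<open>dynkin\<close>). Since the generator is
  formal, \<open>S\<close> need not be determined by it; hence the invariance of the dynamics under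
  translations of space and height, the preservation of the coordinatewise order (attractivity),
  and the stationarity of the product measures are listed as properties of \<open>S\<close>.\<close>

locale deposition_dynamics = deposition_rates \<omega>min \<omega>max p q f
  for \<omega>min \<omega>max p q f +
  fixes W :: "(int \<Rightarrow> int) set"
    and S :: "real \<Rightarrow> (int \<Rightarrow> int) \<Rightarrow> (int \<Rightarrow> int) measure"
  assumes tempered_subset: "W \<subseteq> {\<omega>. \<forall>i. \<omega> i \<in> spins \<omega>min \<omega>max}"
    and tempered_sets: "W \<in> sets conf"
    and tempered_full:
      "\<And>\<theta>. \<theta> \<in> theta_range \<omega>min \<omega>max f \<Longrightarrow> AE \<omega> in Mu \<omega>min \<omega>max f \<theta>. \<omega> \<in> W"
    and tempered_shift: "\<And>\<omega> k. \<omega> \<in> W \<Longrightarrow> (\<lambda>i. \<omega> (i + k)) \<in> W"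
    and kernel: "\<And>t. 0 \<le> t \<Longrightarrow> S t \<in> heights W \<rightarrow>\<^sub>M prob_algebra (heights W)"
    and kernel_0: "\<And>h. slope h \<in> W \<Longrightarrow> S 0 h = return (heights W) h"
    and chapman_kolmogorov:
      "\<And>s t h. \<lbrakk>0 \<le> s; 0 \<le> t; slope h \<in> W\<rbrakk> \<Longrightarrow> S (s + t) h = S s h \<bind> S t"
    and gen_integrable:
      "\<And>\<phi> t h. \<lbrakk>cylinder \<phi>; bounded (range \<phi>); 0 \<le> t; slope h \<in> W\<rbrakk> \<Longrightarrow>
         (\<forall>s\<in>{0..t}. integrable (S s h) (gen p q \<phi>)) \<and>
         set_integrable lborel {0..t} (\<lambda>s. \<integral>g. gen p q \<phi> g \<partial>S s h)"
    and dynkin: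
      "\<And>\<phi> t h. \<lbrakk>cylinder \<phi>; bounded (range \<phi>); 0 \<le> t; slope h \<in> W\<rbrakk> \<Longrightarrow>
         (\<integral>g. \<phi> g \<partial>S t h) = \<phi> h + (LINT s:{0..t}|lborel. \<integral>g. gen p q \<phi> g \<partial>S s h)"
    and space_translation:
      "\<And>t h k. \<lbrakk>0 \<le> t; slope h \<in> W\<rbrakk> \<Longrightarrow>
         S t (\<lambda>i. h (i + k)) = distr (S t h) (heights W) (\<lambda>g i. g (i + k))"
    and height_translation:
      "\<And>t h c. \<lbrakk>0 \<le> t; slope h \<in> W\<rbrakk> \<Longrightarrow>
         S t (\<lambda>i. h i + c) = distr (S t h) (heights W) (\<lambda>g i. g i + c)"
    and order_preserving:
      "\<And>t h h' \<psi> :: (int \<Rightarrow> int) \<Rightarrow> real.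
         \<lbrakk>0 \<le> t; slope h \<in> W; slope h' \<in> W; slope h \<le> slope h';
          \<psi> \<in> borel_measurable conf; bounded (range \<psi>); mono \<psi>\<rbrakk> \<Longrightarrow>
         (\<integral>g. \<psi> (slope g) \<partial>S t h) \<le> (\<integral>g. \<psi> (slope g) \<partial>S t h')"
    and stationary:
      "\<And>\<theta> t \<nu>. \<lbrakk>\<theta> \<in> theta_range \<omega>min \<omega>max f; 0 \<le> t; \<nu> \<in> space (prob_algebra (heights W));
          distr \<nu> conf slope = Mu \<omega>min \<omega>max f \<theta>\<rbrakk> \<Longrightarrow>
         distr (\<nu> \<bind> S t) conf slope = Mu \<omega>min \<omega>max f \<theta>"

definition history :: "'a measure \<Rightarrow> 'b measure \<Rightarrow> (real \<Rightarrow> 'a \<Rightarrow> 'b) \<Rightarrow> real \<Rightarrow> 'a measure" where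
  "history M E X s =
     sigma (space M) {X u -` B \<inter> space M | u B. 0 \<le> u \<and> u \<le> s \<and> B \<in> sets E}"

definition markov_process ::
    "'a measure \<Rightarrow> 'b measure \<Rightarrow> (real \<Rightarrow> 'b \<Rightarrow> 'b measure) \<Rightarrow> (real \<Rightarrow> 'a \<Rightarrow> 'b) \<Rightarrow> bool" where
  "markov_process M E S X \<longleftrightarrow>
     prob_space M \<and> (\<forall>t\<ge>0. X t \<in> M \<rightarrow>\<^sub>M E) \<and>
     (\<forall>s\<ge>0. \<forall>t\<ge>0. \<forall>B\<in>sets E.
        AE w in M. real_cond_exp M (history M E X s) (indicator (X (s + t) -` B \<inter> space M)) w
                   = measure (S t (X s w)) B)"

definition cov :: "'a measure \<Rightarrow> ('a \<Rightarrow> real) \<Rightarrow> ('a \<Rightarrow> real) \<Rightarrow> real" where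
  "cov M X Y = (\<integral>w. (X w - (\<integral>v. X v \<partial>M)) * (Y w - (\<integral>v. Y v \<partial>M)) \<partial>M)"

definition to_zero :: "real \<Rightarrow> int" where
  "to_zero x = (if x \<ge> 0 then \<lfloor>x\<rfloor> else \<lceil>x\<rceil>)"

definition spin :: "(real \<Rightarrow> 'a \<Rightarrow> int \<Rightarrow> int) \<Rightarrow> int \<Rightarrow> real \<Rightarrow> 'a \<Rightarrow> real" where
  "spin h n t w = real_of_int (slope (h t w) n)"

definition current :: "(real \<Rightarrow> 'a \<Rightarrow> int \<Rightarrow> int) \<Rightarrow> real \<Rightarrow> real \<Rightarrow> 'a \<Rightarrow> real" where
  "current h V t w = real_of_int (h t w (to_zero (V * t)) - h 0 w 0)"

end

(* Write r = p - q, D_i(t) = h_i(t) - h_i(0), A_k = h_(x+k)(t) - h_k(0) and C(n) = Cov(w_n(t), w_0(0)).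
   The difference A_0 - A_N is a sum of N spins at time t minus a sum of N spins at time 0. By
   stationarity, half its variance is Var(A_0) - Cov(A_0, A_N) on the one hand and
   N Var(w_0) - sum_(i,j=1..N) C(x + i - j) on the other. Attractivity gives C >= 0, so once
   Cov(A_0, A_N) -> 0 is known, monotonicity in N yields the convergence and the value of
   sum_n |x - n| C(n).

   For the decorrelation, D_0 and D_N never jump together, so the Dynkin formula reads
   Cov(D_0(t), D_N(t)) = integral over s in [0, t] of Cov(D_0, r_N)(s) + Cov(r_0, D_N)(s). At each
   time s the r_N are identically distributed and uncorrelated at distance at least 2, hence tend
   weakly to 0 in L2 by Bessel's inequality; the second term is reflected to the first by
   translation invariance.

   The first moment sum_n n C(n) is the limit of (Var(A_0 for x = -y) - Var(A_0 for x = y)) / 2 as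
   y tends to infinity. Up to decorrelating terms this is Cov(D_0(t), X) with
   X = sum_(-y < i <= y) w_i(0), and the Dynkin formula writes it as the integral of Cov(r_0(s), X).
   Trading w_i(0) for w_i(s) again costs only decorrelating terms, and Cov(r_0, w_0 + w_1) is left. *)

theory Submission
  imports Defs
begin

section \<open>Sums over the integers\<close>

text \<open>The Dynkin formula is granted only for bounded cylinder functions and a fixed start,
  whereas the argument needs products of height increments, also with functions of the initial
  state, under the stationary law. Hence the truncation by \<open>clip\<close>, a second-moment
  bound uniform in the truncation and in time, and dominated convergence both over the sample space
  and over time. Interchanging expectation and time integral needs \<open>S\<close> to be jointly
  measurable in time and start; this is extracted from the Dynkin formula itself, which makes
  expectations of cylinder functions continuous in time. Only the initial slopes have a prescribed
  law, so a covariance is shifted in space after it has been written through initial slopes and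
  height increments. Bessel's inequality yields decorrelation without any rate, so no summability is
  known in advance: nonnegativity of the covariances has to supply both convergence and the
  vanishing of boundary terms. Finally, the moment assumption concerns the rates; square
  integrability of the spins comes from \<open>\<theta>\<close> lying strictly inside its
  range.\<close>

lemma filterlim_symmetric_intervals:
  "filterlim (\<lambda>N. {-int N..int N}) (finite_subsets_at_top UNIV) sequentially"
  unfolding filterlim_finite_subsets_at_top
proof (intro allI impI)
  fix X :: "int set" assume X: "finite X \<and> X \<subseteq> UNIV"
  have "finite ((nat \<circ> abs) ` X)" using X by auto
  then obtain N where N: "\<And>x. x \<in> X \<Longrightarrow> nat \<bar>x\<bar> \<le> N"
    unfolding finite_nat_set_iff_bounded_le by auto
  show "\<forall>\<^sub>F y in sequentially. finite {-int y..int y} \<and> X \<subseteq> {-int y..int y} \<and> {-int y..int y} \<subseteq> UNIV"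
    using eventually_ge_at_top[of N]
  proof eventually_elim
    case (elim y)
    have "x \<in> {-int y..int y}" if "x \<in> X" for x using N[OF that] elim by auto
    thus ?case by blast
  qed
qed

lemma has_sum_int_symmetric_limit:
  fixes g :: "int \<Rightarrow> real"
  assumes "(g has_sum l) UNIV"
  shows "(\<lambda>N. \<Sum>n=-int N..int N. g n) \<longlonglongrightarrow> l"
  using assms filterlim_symmetric_intervals unfolding has_sum_def by (rule filterlim_compose)

text \<open>For nonnegative terms one exhausting sequence decides: each finite set lies in some
  symmetric interval, so the limit bounds all finite sums and unconditional summability
  follows.\<close>

lemma has_sum_int_nonneg:
  fixes g :: "int \<Rightarrow> real"
  assumes nn: "\<And>n. 0 \<le> g n" and lim: "(\<lambda>N. \<Sum>n=-int N..int N. g n) \<longlonglongrightarrow> l"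
  shows "(g has_sum l) UNIV"
proof -
  have inc: "incseq (\<lambda>N. \<Sum>n=-int N..int N. g n)"
    by (intro monoI sum_mono2) (auto simp: nn)
  have bnd: "sum g F \<le> l" if "finite F" for F
  proof -
    have "\<forall>\<^sub>F N in sequentially. finite {-int N..int N} \<and> F \<subseteq> {-int N..int N} \<and> {-int N..int N} \<subseteq> UNIV"
      using filterlim_symmetric_intervals that
      unfolding filterlim_finite_subsets_at_top by blast
    then obtain N where "F \<subseteq> {-int N..int N}" unfolding eventually_sequentially by blast
    hence "sum g F \<le> (\<Sum>n=-int N..int N. g n)" by (intro sum_mono2) (auto simp: nn)
    also have "\<dots> \<le> l" by (rule incseq_le[OF inc lim])
    finally show ?thesis .
  qed
  have "g summable_on UNIV"
    by (rule nonneg_bdd_above_summable_on) (auto intro!: bdd_aboveI[of _ l] bnd simp: nn)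
  hence hs: "(g has_sum infsum g UNIV) UNIV" by simp
  have "l = infsum g UNIV"
    using lim has_sum_int_symmetric_limit[OF hs] by (rule LIMSEQ_unique)
  with hs show ?thesis by simp
qed

text \<open>Enlarging the square by one row and one column adds a border on which every difference
  from \<open>-N\<close> to \<open>N\<close> occurs exactly once: 0 at the corner, the positive ones
  for \<open>i = N + 1\<close>, the negative ones for \<open>j = N + 1\<close>.\<close>

lemma sum_differences:
  fixes c :: "int \<Rightarrow> real"
  shows "(\<Sum>i=1..int (Suc N). \<Sum>j=1..int (Suc N). c (i - j)) =
    (\<Sum>i=1..int N. \<Sum>j=1..int N. c (i - j)) + (\<Sum>n=-int N..int N. c n)"
proof -
  have ins: "{1..int (Suc N)} = insert (int N + 1) {1..int N}" by auto
  have a: "(\<Sum>j=1..int N. c (int N + 1 - j)) = (\<Sum>n=1..int N. c n)"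
    by (rule sum.reindex_bij_witness[of _ "\<lambda>n. int N + 1 - n" "\<lambda>n. int N + 1 - n"]) auto
  have b: "(\<Sum>i=1..int N. c (i - (int N + 1))) = (\<Sum>n=-int N..-1. c n)"
    by (rule sum.reindex_bij_witness[of _ "\<lambda>n. n + (int N + 1)" "\<lambda>n. n - (int N + 1)"]) auto
  have "{-int N..int N} = insert 0 ({-int N..-1} \<union> {1..int N})" by auto
  hence "(\<Sum>n=-int N..int N. c n) = c 0 + (\<Sum>n=-int N..-1. c n) + (\<Sum>n=1..int N. c n)"
    by (simp only:, subst sum.insert, simp, simp, subst sum.union_disjoint) auto
  thus ?thesis
    unfolding ins by (simp add: sum.distrib a b)
qed

lemma sum_symmetric_Suc:
  fixes c :: "int \<Rightarrow> real"
  shows "(\<Sum>n=-int (Suc N)..int (Suc N). c n) = (\<Sum>n=-int N..int N. c n) + c (int N + 1) + c (- (int N + 1))"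
proof -
  have "{-int (Suc N)..int (Suc N)} = insert (int N + 1) (insert (-(int N + 1)) {-int N..int N})" by auto
  thus ?thesis by (simp del: of_nat_Suc)
qed

text \<open>The quantity converging to \<open>l\<close> has increments \<open>v - (\<Sum>n=-N..N. c n)\<close>, which decrease and
  hence tend to \<open>0\<close>; it is \<open>N\<close> times such an increment plus the partial sum of the first moment.\<close>

lemma has_sum_first_moment:
  fixes c :: "int \<Rightarrow> real"
  assumes nn: "\<And>n. 0 \<le> c n"
    and lim: "(\<lambda>N. real N * v - (\<Sum>i=1..int N. \<Sum>j=1..int N. c (i - j))) \<longlonglongrightarrow> l"
  shows "((\<lambda>n. real_of_int \<bar>n\<bar> * c n) has_sum l) UNIV"
proof -
  define b where "b N = real N * v - (\<Sum>i=1..int N. \<Sum>j=1..int N. c (i - j))" for N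
  define s where "s N = (\<Sum>n=-int N..int N. c n)" for N
  define m where "m N = (\<Sum>n=-int N..int N. real_of_int \<bar>n\<bar> * c n)" for N
  have b_Suc: "b (Suc N) = b N + (v - s N)" for N
    unfolding b_def s_def sum_differences by (simp add: algebra_simps)
  have bm: "b (Suc N) = real (Suc N) * (v - s N) + m N" for N
  proof (induction N)
    case 0 show ?case by (simp add: b_def s_def m_def)
  next
    case (Suc N)
    have "b (Suc (Suc N)) = real (Suc N) * (v - s N) + m N + (v - s (Suc N))"
      by (subst b_Suc) (simp add: Suc)
    moreover have "s (Suc N) = s N + c (int N + 1) + c (- (int N + 1))"
      unfolding s_def by (rule sum_symmetric_Suc)
    moreover have "m (Suc N) = m N + (real N + 1) * c (int N + 1) + (real N + 1) * c (- (int N + 1))"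
      unfolding m_def by (subst sum_symmetric_Suc) simp
    ultimately show ?case by (simp add: algebra_simps)
  qed
  have blim: "b \<longlonglongrightarrow> l" using lim by (simp add: b_def[abs_def])
  have "(\<lambda>N. b (Suc N) - b N) \<longlonglongrightarrow> l - l"
    by (intro tendsto_diff LIMSEQ_Suc blim)
  hence elim: "(\<lambda>N. v - s N) \<longlonglongrightarrow> 0" by (simp add: b_Suc)
  have sinc: "incseq s" unfolding s_def by (intro monoI sum_mono2) (auto simp: nn)
  have slim: "s \<longlonglongrightarrow> v"
    using tendsto_diff[OF tendsto_const[of v] elim] by simp
  have sle: "s N \<le> v" for N using incseq_le[OF sinc slim] .
  have csum: "(c has_sum v) UNIV"
    by (rule has_sum_int_nonneg[OF nn]) (use slim in \<open>simp add: s_def[abs_def]\<close>)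
  have binc: "incseq b" by (rule incseq_SucI) (simp add: b_Suc sle)
  have ble: "b N \<le> l" for N using incseq_le[OF binc blim] .
  \<comment> \<open>The boundary term in \<open>bm\<close> is nonnegative since \<open>s\<close>
    increases to \<open>v\<close>, so the truncated moments inherit the bound of
    \<open>b\<close>.\<close>
  have mle: "m N \<le> l" for N
  proof -
    have "m N \<le> b (Suc N)" unfolding bm using sle[of N] by simp
    also have "\<dots> \<le> l" by (rule ble)
    finally show ?thesis .
  qed
  have minc: "incseq m" unfolding m_def by (intro monoI sum_mono2) (auto simp: nn)
  obtain l' where l': "m \<longlonglongrightarrow> l'"
    using incseq_convergent[OF minc] mle by blast
  have msum: "((\<lambda>n. real_of_int \<bar>n\<bar> * c n) has_sum l') UNIV"
    by (rule has_sum_int_nonneg) (use l' nn in \<open>auto simp: m_def[abs_def]\<close>)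
  \<comment> \<open>Beyond \<open>N\<close> the factor \<open>\<bar>n\<bar>\<close> is at least
    \<open>N + 1\<close>, so the boundary term is dominated by a tail of the convergent first moment
    and vanishes in the limit.\<close>
  have tail: "real (Suc N) * (v - s N) \<le> l' - m N" for N
  proof (rule has_sum_mono)
    have "(c has_sum s N) {-int N..int N}" unfolding s_def by (intro has_sum_finite) auto
    from has_sum_Diff[OF csum this]
    have "(c has_sum (v - s N)) (UNIV - {-int N..int N})" by simp
    thus "((\<lambda>n. real (Suc N) * c n) has_sum real (Suc N) * (v - s N)) (UNIV - {-int N..int N})"
      by (rule has_sum_cmult_right)
    have "((\<lambda>n. real_of_int \<bar>n\<bar> * c n) has_sum m N) {-int N..int N}"
      unfolding m_def by (intro has_sum_finite) auto
    from has_sum_Diff[OF msum this]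
    show "((\<lambda>n. real_of_int \<bar>n\<bar> * c n) has_sum (l' - m N)) (UNIV - {-int N..int N})" by simp
    fix n assume "n \<in> UNIV - {-int N..int N}"
    hence "real (Suc N) \<le> real_of_int \<bar>n\<bar>" by auto
    thus "real (Suc N) * c n \<le> real_of_int \<bar>n\<bar> * c n" by (intro mult_right_mono nn)
  qed
  have z: "(\<lambda>N. real (Suc N) * (v - s N)) \<longlonglongrightarrow> 0"
  proof (rule tendsto_sandwich[where f = "\<lambda>_. 0" and h = "\<lambda>N. l' - m N"])
    show "(\<lambda>N. l' - m N) \<longlonglongrightarrow> 0" using tendsto_diff[OF tendsto_const[of l'] l'] by simp
    show "\<forall>\<^sub>F N in sequentially. 0 \<le> real (Suc N) * (v - s N)"
    proof (rule always_eventually, rule allI)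
      fix N
      have "0 \<le> v - s N" using sle[of N] by simp
      thus "0 \<le> real (Suc N) * (v - s N)" by (rule mult_nonneg_nonneg[OF of_nat_0_le_iff])
    qed
    show "\<forall>\<^sub>F N in sequentially. real (Suc N) * (v - s N) \<le> l' - m N" using tail by (intro always_eventually) auto
  qed simp
  have "(\<lambda>N. b (Suc N)) \<longlonglongrightarrow> 0 + l'" unfolding bm by (intro tendsto_add z l')
  moreover have "(\<lambda>N. b (Suc N)) \<longlonglongrightarrow> l" using blim by (rule LIMSEQ_Suc)
  ultimately have "l = l'" using LIMSEQ_unique by fastforce
  with msum show ?thesis by simp
qed

text \<open>The coefficient of \<open>c n\<close> is \<open>n\<close> clamped to
  \<open>[-y, y]\<close>. It agrees with \<open>n\<close> inside this interval and differs from it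
  by at most \<open>\<bar>n\<bar>\<close> outside, so \<open>d y\<close> misses the full first
  moment by at most a tail of the absolute one.\<close>

lemma truncated_first_moment_limit:
  fixes c :: "int \<Rightarrow> real"
  assumes nn: "\<And>n. 0 \<le> c n" and sm: "(\<lambda>n. real_of_int \<bar>n\<bar> * c n) summable_on UNIV"
    and hs: "\<And>y. ((\<lambda>n. (real_of_int \<bar>n + int y\<bar> - real_of_int \<bar>n - int y\<bar>) / 2 * c n) has_sum d y) UNIV"
    and lim: "d \<longlonglongrightarrow> l"
  shows "((\<lambda>n. real_of_int n * c n) has_sum l) UNIV"
proof -
  have "(\<lambda>n. real_of_int n * c n) summable_on UNIV"
    by (rule abs_summable_summable) (use sm in \<open>simp add: abs_mult nn\<close>)
  then obtain l' where l': "((\<lambda>n. real_of_int n * c n) has_sum l') UNIV"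
    by (auto simp: summable_on_def)
  obtain k where k: "((\<lambda>n. real_of_int \<bar>n\<bar> * c n) has_sum k) UNIV"
    using sm by (auto simp: summable_on_def)
  have bd: "\<bar>l' - d y\<bar> \<le> k - (\<Sum>n=-int y..int y. real_of_int \<bar>n\<bar> * c n)" for y
  proof -
    let ?g = "\<lambda>n. real_of_int n * c n - (real_of_int \<bar>n + int y\<bar> - real_of_int \<bar>n - int y\<bar>) / 2 * c n"
    have "(?g has_sum (l' - d y)) UNIV"
      using has_sum_add[OF l' has_sum_uminusI[OF hs[of y]]] by simp
    moreover have "(?g has_sum 0) {-int y..int y}"
      by (intro has_sum_0) (simp add: abs_if)
    ultimately have "(?g has_sum (l' - d y - 0)) (UNIV - {-int y..int y})"
      by (rule has_sum_Diff) simp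
    hence g: "(?g has_sum (l' - d y)) (UNIV - {-int y..int y})" by (simp only: diff_zero)
    have "((\<lambda>n. real_of_int \<bar>n\<bar> * c n) has_sum (\<Sum>n=-int y..int y. real_of_int \<bar>n\<bar> * c n)) {-int y..int y}"
      by (intro has_sum_finite) auto
    from has_sum_Diff[OF k this]
    have K: "((\<lambda>n. real_of_int \<bar>n\<bar> * c n) has_sum (k - (\<Sum>n=-int y..int y. real_of_int \<bar>n\<bar> * c n))) (UNIV - {-int y..int y})"
      by simp
    have le: "\<bar>?g n\<bar> \<le> real_of_int \<bar>n\<bar> * c n" for n
    proof -
      have "?g n = (real_of_int n - (real_of_int \<bar>n + int y\<bar> - real_of_int \<bar>n - int y\<bar>) / 2) * c n"
        by (simp add: algebra_simps)
      moreover have "\<bar>real_of_int n - (real_of_int \<bar>n + int y\<bar> - real_of_int \<bar>n - int y\<bar>) / 2\<bar> \<le> real_of_int \<bar>n\<bar>"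
        by (auto simp: abs_if)
      ultimately show ?thesis by (simp add: abs_mult nn mult_right_mono)
    qed
    have "l' - d y \<le> k - (\<Sum>n=-int y..int y. real_of_int \<bar>n\<bar> * c n)"
      by (rule has_sum_mono[OF g K], rule abs_le_D1[OF le])
    moreover have "- (l' - d y) \<le> k - (\<Sum>n=-int y..int y. real_of_int \<bar>n\<bar> * c n)"
      by (rule has_sum_mono[OF has_sum_uminusI[OF g] K], rule abs_le_D2[OF le])
    ultimately show ?thesis by linarith
  qed
  have "(\<lambda>y. k - (\<Sum>n=-int y..int y. real_of_int \<bar>n\<bar> * c n)) \<longlonglongrightarrow> k - k"
    by (intro tendsto_diff tendsto_const has_sum_int_symmetric_limit k)
  hence z: "(\<lambda>y. k - (\<Sum>n=-int y..int y. real_of_int \<bar>n\<bar> * c n)) \<longlonglongrightarrow> 0" by simp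
  have "(\<lambda>y. l' - d y) \<longlonglongrightarrow> 0"
    by (rule Lim_null_comparison[where g = "\<lambda>y. k - (\<Sum>n=-int y..int y. real_of_int \<bar>n\<bar> * c n)"])
       (use z bd in auto)
  hence "d \<longlonglongrightarrow> l'" using tendsto_diff[OF tendsto_const[of l'], of "\<lambda>y. l' - d y" 0] by simp
  with lim have "l = l'" using LIMSEQ_unique by blast
  with l' show ?thesis by simp
qed

section \<open>Covariances of square-integrable functions\<close>

definition square_integrable :: "'a measure \<Rightarrow> ('a \<Rightarrow> real) \<Rightarrow> bool" where
  "square_integrable M X \<longleftrightarrow> X \<in> borel_measurable M \<and> integrable M (\<lambda>w. (X w)\<^sup>2)"

lemma square_integrable_abs: "square_integrable M X \<Longrightarrow> square_integrable M (\<lambda>w. \<bar>X w\<bar>)"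
  unfolding square_integrable_def by auto

context prob_space
begin

lemma square_integrable_measurable: "square_integrable M X \<Longrightarrow> X \<in> borel_measurable M"
  by (simp add: square_integrable_def)

lemma square_integrable_mult_integrable:
  assumes "square_integrable M X" "square_integrable M Y"
  shows "integrable M (\<lambda>w. X w * Y w)"
proof (rule Bochner_Integration.integrable_bound)
  show "integrable M (\<lambda>w. (X w)\<^sup>2 + (Y w)\<^sup>2)"
    using assms by (auto simp: square_integrable_def)
  show "(\<lambda>w. X w * Y w) \<in> borel_measurable M"
    using assms by (auto simp: square_integrable_def)
  show "AE w in M. norm (X w * Y w) \<le> norm ((X w)\<^sup>2 + (Y w)\<^sup>2)"
  proof (rule AE_I2)
    fix w
    have "0 \<le> (\<bar>X w\<bar> - \<bar>Y w\<bar>)\<^sup>2" by simp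
    hence "2 * (\<bar>X w\<bar> * \<bar>Y w\<bar>) \<le> (X w)\<^sup>2 + (Y w)\<^sup>2" by (simp add: power2_diff)
    moreover have "0 \<le> \<bar>X w\<bar> * \<bar>Y w\<bar>" by simp
    ultimately show "norm (X w * Y w) \<le> norm ((X w)\<^sup>2 + (Y w)\<^sup>2)"
      unfolding real_norm_def abs_mult by linarith
  qed
qed

lemma square_integrable_const [simp]: "square_integrable M (\<lambda>w. c)"
  by (simp add: square_integrable_def)

lemma square_integrable_integrable: "square_integrable M X \<Longrightarrow> integrable M X"
  using square_integrable_mult_integrable[of X "\<lambda>_. 1"] by simp

lemma square_integrable_add [intro]:
  assumes "square_integrable M X" "square_integrable M Y"
  shows "square_integrable M (\<lambda>w. X w + Y w)"
  using assms square_integrable_mult_integrable[OF assms]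
  by (auto simp: square_integrable_def power2_sum mult.assoc)

lemma square_integrable_scale [intro]:
  "square_integrable M X \<Longrightarrow> square_integrable M (\<lambda>w. c * X w)"
  by (auto simp: square_integrable_def power_mult_distrib)

lemma square_integrable_minus [intro]:
  "square_integrable M X \<Longrightarrow> square_integrable M (\<lambda>w. - X w)"
  by (auto simp: square_integrable_def)

lemma square_integrable_diff [intro]:
  "square_integrable M X \<Longrightarrow> square_integrable M Y \<Longrightarrow> square_integrable M (\<lambda>w. X w - Y w)"
  using square_integrable_add[of X "\<lambda>w. - Y w"] by auto

lemma square_integrable_sum [intro]:
  "(\<And>i. i \<in> A \<Longrightarrow> square_integrable M (X i)) \<Longrightarrow> square_integrable M (\<lambda>w. \<Sum>i\<in>A. X i w)"
  by (induction A rule: infinite_finite_induct) auto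

lemma square_integrable_bound:
  assumes "square_integrable M Y" "X \<in> borel_measurable M" "AE w in M. \<bar>X w\<bar> \<le> \<bar>Y w\<bar>"
  shows "square_integrable M X"
  unfolding square_integrable_def
proof
  show "integrable M (\<lambda>w. (X w)\<^sup>2)"
  proof (rule Bochner_Integration.integrable_bound)
    show "integrable M (\<lambda>w. (Y w)\<^sup>2)" using assms by (simp add: square_integrable_def)
    show "AE w in M. norm ((X w)\<^sup>2) \<le> norm ((Y w)\<^sup>2)"
      using assms(3) by eventually_elim (simp add: abs_le_square_iff)
  qed (use assms in simp)
qed fact

lemma cov_eq:
  assumes "square_integrable M X" "square_integrable M Y"
  shows "cov M X Y = expectation (\<lambda>w. X w * Y w) - expectation X * expectation Y"
proof -
  have [simp]: "integrable M X" "integrable M Y" "integrable M (\<lambda>w. X w * Y w)"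
    using assms by (auto intro: square_integrable_integrable square_integrable_mult_integrable)
  have "cov M X Y = expectation (\<lambda>w. X w * Y w - expectation Y * X w - expectation X * Y w + expectation X * expectation Y)"
    unfolding cov_def by (intro Bochner_Integration.integral_cong refl) (simp add: algebra_simps)
  also have "\<dots> = expectation (\<lambda>w. X w * Y w) - expectation X * expectation Y"
    by (simp add: prob_space)
  finally show ?thesis .
qed

lemma cov_commute: "cov M X Y = cov M Y X"
  by (simp add: cov_def mult.commute)

lemma cov_self: "cov M X X = variance X"
  by (simp add: cov_def power2_eq_square)

lemma cov_self_nonneg: "0 \<le> cov M X X"
  by (simp add: cov_def)

lemma cov_add_left:
  assumes "square_integrable M X" "square_integrable M Y" "square_integrable M Z"
  shows "cov M (\<lambda>w. X w + Y w) Z = cov M X Z + cov M Y Z"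
  using assms square_integrable_mult_integrable[OF assms(1,3)] square_integrable_mult_integrable[OF assms(2,3)]
  by (simp add: cov_eq square_integrable_add square_integrable_integrable distrib_right)

lemma cov_scale_left:
  assumes "square_integrable M X" "square_integrable M Z"
  shows "cov M (\<lambda>w. c * X w) Z = c * cov M X Z"
  using assms by (simp add: cov_eq square_integrable_scale right_diff_distrib mult.assoc)

lemma cov_minus_left:
  assumes "square_integrable M X" "square_integrable M Z"
  shows "cov M (\<lambda>w. - X w) Z = - cov M X Z"
  using cov_scale_left[OF assms, of "-1"] by simp

lemma cov_diff_left:
  assumes "square_integrable M X" "square_integrable M Y" "square_integrable M Z"
  shows "cov M (\<lambda>w. X w - Y w) Z = cov M X Z - cov M Y Z"
  using cov_add_left[OF assms(1) square_integrable_minus[OF assms(2)] assms(3)]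
  by (simp add: cov_minus_left assms)

lemma cov_const_left: "square_integrable M Z \<Longrightarrow> cov M (\<lambda>w. c) Z = 0"
  by (simp add: cov_def prob_space)

lemma cov_sum_left:
  assumes "\<And>i. i \<in> A \<Longrightarrow> square_integrable M (X i)" "square_integrable M Z"
  shows "cov M (\<lambda>w. \<Sum>i\<in>A. X i w) Z = (\<Sum>i\<in>A. cov M (X i) Z)"
  using assms(1)
proof (induction A rule: infinite_finite_induct)
  case (insert i A)
  thus ?case by (simp add: cov_add_left square_integrable_sum assms(2))
qed (auto simp: cov_const_left assms(2))

lemma cov_add_right:
  assumes "square_integrable M X" "square_integrable M Y" "square_integrable M Z"
  shows "cov M Z (\<lambda>w. X w + Y w) = cov M Z X + cov M Z Y"
  using cov_add_left[OF assms] by (simp add: cov_commute)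

lemma cov_diff_right:
  assumes "square_integrable M X" "square_integrable M Y" "square_integrable M Z"
  shows "cov M Z (\<lambda>w. X w - Y w) = cov M Z X - cov M Z Y"
  using cov_diff_left[OF assms] by (simp add: cov_commute)

lemma cov_scale_right:
  assumes "square_integrable M X" "square_integrable M Z"
  shows "cov M Z (\<lambda>w. c * X w) = c * cov M Z X"
  using cov_scale_left[OF assms] by (simp add: cov_commute)

lemma cov_sum_right:
  assumes "\<And>i. i \<in> A \<Longrightarrow> square_integrable M (X i)" "square_integrable M Z"
  shows "cov M Z (\<lambda>w. \<Sum>i\<in>A. X i w) = (\<Sum>i\<in>A. cov M Z (X i))"
  using cov_sum_left[of A X Z] assms by (simp add: cov_commute)

lemma cov_Cauchy_Schwarz:
  assumes X: "square_integrable M X" and Y: "square_integrable M Y"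
  shows "(cov M X Y)\<^sup>2 \<le> cov M X X * cov M Y Y"
proof -
  have q: "0 \<le> a\<^sup>2 * cov M X X - 2 * a * b * cov M X Y + b\<^sup>2 * cov M Y Y" for a b
  proof -
    have "0 \<le> cov M (\<lambda>w. a * X w - b * Y w) (\<lambda>w. a * X w - b * Y w)" by (rule cov_self_nonneg)
    also have "\<dots> = a\<^sup>2 * cov M X X - 2 * a * b * cov M X Y + b\<^sup>2 * cov M Y Y"
      using cov_commute[of Y X]
      by (simp add: cov_diff_left cov_diff_right cov_scale_left cov_scale_right X Y
          square_integrable_diff square_integrable_scale algebra_simps power2_eq_square)
    finally show ?thesis .
  qed
  show ?thesis
  proof (cases "cov M Y Y = 0")
    case True
    have "cov M X Y = 0"
    proof (rule ccontr)
      assume n: "cov M X Y \<noteq> 0"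
      \<comment> \<open>As \<open>cov M Y Y\<close> vanishes, the form is affine in
        \<open>b\<close>; for \<open>a = 1\<close> this \<open>b\<close> gives it the value
        -1.\<close>
      from q[of 1 "(cov M X X + 1) / (2 * cov M X Y)"] True n show False by simp
    qed
    thus ?thesis using True by simp
  next
    case False
    hence p: "0 < cov M Y Y" using cov_self_nonneg[of Y] by simp
    \<comment> \<open>Up to scaling this is \<open>X\<close> minus its projection on
      \<open>Y\<close>, where the form is smallest; its value is \<open>cov M Y Y\<close> times the
      gap in the inequality.\<close>
    from q[of "cov M Y Y" "cov M X Y"]
    have "0 \<le> cov M Y Y * (cov M X X * cov M Y Y - (cov M X Y)\<^sup>2)"
      by (simp add: algebra_simps power2_eq_square)
    with p show ?thesis by (simp add: zero_le_mult_iff)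
  qed
qed

lemma cov_abs_le:
  assumes "square_integrable M X" "square_integrable M Y"
  shows "\<bar>cov M X Y\<bar> \<le> (cov M X X + cov M Y Y) / 2"
proof -
  have "0 \<le> ((cov M X X - cov M Y Y) / 2)\<^sup>2" by simp
  hence "cov M X X * cov M Y Y \<le> ((cov M X X + cov M Y Y) / 2)\<^sup>2"
    by (simp add: power2_eq_square algebra_simps)
  with cov_Cauchy_Schwarz[OF assms] have "(cov M X Y)\<^sup>2 \<le> ((cov M X X + cov M Y Y) / 2)\<^sup>2" by linarith
  thus ?thesis using cov_self_nonneg[of X] cov_self_nonneg[of Y]
    by (simp add: abs_le_square_iff[symmetric])
qed

text \<open>The covariance matrix is a band matrix. Splitting each product of two coefficients into
  half the sum of their squares leaves row sums, each with at most \<open>2 * L + 1\<close> nonzero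
  entries of size at most \<open>C\<close>. The resulting constant does not depend on
  \<open>F\<close>, which is what the Bessel argument requires.\<close>

lemma variance_sum_finite_range:
  fixes X :: "int \<Rightarrow> 'a \<Rightarrow> real" and L :: int and C :: real and a :: "int \<Rightarrow> real"
  assumes F: "finite F" and X: "\<And>n. square_integrable M (X n)"
    and range: "\<And>m n. \<bar>m - n\<bar> \<ge> L \<Longrightarrow> cov M (X m) (X n) = 0"
    and C: "\<And>n. cov M (X n) (X n) \<le> C" and L: "0 \<le> L"
  shows "cov M (\<lambda>w. \<Sum>n\<in>F. a n * X n w) (\<lambda>w. \<Sum>n\<in>F. a n * X n w) \<le> (2 * L + 1) * C * (\<Sum>n\<in>F. (a n)\<^sup>2)"
proof -
  have C0: "0 \<le> C" by (rule order_trans[OF cov_self_nonneg C[of 0]])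
  have le: "a m * a n * cov M (X m) (X n) \<le> (if \<bar>m - n\<bar> < L then C * ((a m)\<^sup>2 + (a n)\<^sup>2) / 2 else 0)" for m n
  proof (cases "\<bar>m - n\<bar> < L")
    case True
    have c: "\<bar>cov M (X m) (X n)\<bar> \<le> C"
    proof -
      have "\<bar>cov M (X m) (X n)\<bar> \<le> (cov M (X m) (X m) + cov M (X n) (X n)) / 2"
        by (rule cov_abs_le[OF X X])
      also have "\<dots> \<le> (C + C) / 2"
        by (rule divide_right_mono[OF add_mono[OF C C]]) simp
      finally show ?thesis by (simp only: field_sum_of_halves add_divide_distrib)
    qed
    have "0 \<le> (\<bar>a m\<bar> - \<bar>a n\<bar>)\<^sup>2" by simp
    hence "2 * (\<bar>a m\<bar> * \<bar>a n\<bar>) \<le> (a m)\<^sup>2 + (a n)\<^sup>2"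
      unfolding power2_diff power2_abs by (simp only: mult.assoc)
    hence "\<bar>a m\<bar> * \<bar>a n\<bar> \<le> ((a m)\<^sup>2 + (a n)\<^sup>2) / 2" by (simp only: field_simps)
    hence "(\<bar>a m\<bar> * \<bar>a n\<bar>) * \<bar>cov M (X m) (X n)\<bar> \<le> ((a m)\<^sup>2 + (a n)\<^sup>2) / 2 * C"
      by (intro mult_mono c) auto
    moreover have "a m * a n * cov M (X m) (X n) \<le> (\<bar>a m\<bar> * \<bar>a n\<bar>) * \<bar>cov M (X m) (X n)\<bar>"
      by (metis abs_ge_self abs_mult)
    ultimately show ?thesis using True by (simp add: mult.commute)
  qed (use range in auto)
  \<comment> \<open>For positive \<open>L\<close> the strict inequality admits at most
    \<open>2 * L - 1\<close> sites; the wider count also covers \<open>L = 0\<close>.\<close>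
  have cnt: "(\<Sum>n\<in>F. if \<bar>m - n\<bar> < L then g else 0) \<le> (2 * L + 1) * g" if "0 \<le> g" for m :: int and g :: real
  proof -
    have "(\<Sum>n\<in>F. if \<bar>m - n\<bar> < L then g else 0) = real (card {n\<in>F. \<bar>m - n\<bar> < L}) * g"
      using F by (simp add: sum.If_cases Int_def)
    also have "card {n\<in>F. \<bar>m - n\<bar> < L} \<le> card {m-L..m+L}"
      by (intro card_mono) auto
    hence "real (card {n\<in>F. \<bar>m - n\<bar> < L}) * g \<le> (2 * L + 1) * g"
      using L that by (intro mult_right_mono) auto
    finally show ?thesis .
  qed
  have "cov M (\<lambda>w. \<Sum>n\<in>F. a n * X n w) (\<lambda>w. \<Sum>n\<in>F. a n * X n w)
      = (\<Sum>m\<in>F. \<Sum>n\<in>F. a m * a n * cov M (X m) (X n))"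
    by (simp add: cov_sum_left cov_sum_right square_integrable_sum square_integrable_scale
        cov_scale_left cov_scale_right X sum_distrib_left mult.assoc)
  also have "\<dots> \<le> (\<Sum>m\<in>F. \<Sum>n\<in>F. if \<bar>m - n\<bar> < L then C * ((a m)\<^sup>2 + (a n)\<^sup>2) / 2 else 0)"
    by (intro sum_mono le)
  also have "\<dots> = (\<Sum>m\<in>F. \<Sum>n\<in>F. if \<bar>m - n\<bar> < L then C * (a m)\<^sup>2 / 2 else 0)
      + (\<Sum>m\<in>F. \<Sum>n\<in>F. if \<bar>m - n\<bar> < L then C * (a n)\<^sup>2 / 2 else 0)"
    unfolding sum.distrib[symmetric] by (intro sum.cong refl) (simp add: field_simps)
  also have "(\<Sum>m\<in>F. \<Sum>n\<in>F. if \<bar>m - n\<bar> < L then C * (a n)\<^sup>2 / 2 else 0)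
      = (\<Sum>m\<in>F. \<Sum>n\<in>F. if \<bar>m - n\<bar> < L then C * (a m)\<^sup>2 / 2 else 0)"
    by (subst sum.swap) (simp add: abs_minus_commute)
  also have "(\<Sum>m\<in>F. \<Sum>n\<in>F. if \<bar>m - n\<bar> < L then C * (a m)\<^sup>2 / 2 else 0)
      \<le> (\<Sum>m\<in>F. (2 * L + 1) * (C * (a m)\<^sup>2 / 2))"
    using C0 by (intro sum_mono cnt) simp
  hence "(\<Sum>m\<in>F. \<Sum>n\<in>F. if \<bar>m - n\<bar> < L then C * (a m)\<^sup>2 / 2 else 0)
       + (\<Sum>m\<in>F. \<Sum>n\<in>F. if \<bar>m - n\<bar> < L then C * (a m)\<^sup>2 / 2 else 0)
      \<le> 2 * (\<Sum>m\<in>F. (2 * L + 1) * (C * (a m)\<^sup>2 / 2))" by simp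
  also have "\<dots> = (2 * L + 1) * C * (\<Sum>n\<in>F. (a n)\<^sup>2)"
    by (simp add: sum_distrib_left mult.assoc)
  finally show ?thesis .
qed

text \<open>A Bessel inequality: test \<open>Y\<close> against \<open>\<Sum>n. a n * X n\<close> with \<open>a n = cov Y (X n)\<close>.\<close>

lemma cov_finite_range_tendsto_0:
  fixes X :: "int \<Rightarrow> 'a \<Rightarrow> real" and L :: int and C :: real
  assumes X: "\<And>n. square_integrable M (X n)" and Y: "square_integrable M Y"
    and range: "\<And>m n. \<bar>m - n\<bar> \<ge> L \<Longrightarrow> cov M (X m) (X n) = 0"
    and C: "\<And>n. cov M (X n) (X n) \<le> C" and e: "inj (e :: nat \<Rightarrow> int)"
  shows "(\<lambda>N. cov M Y (X (e N))) \<longlonglongrightarrow> 0"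
proof -
  define a where "a n = cov M Y (X n)" for n
  define K where "K = (2 * real_of_int (max 0 L) + 1) * C * cov M Y Y"
  have bnd: "(\<Sum>n\<in>F. (a n)\<^sup>2) \<le> K" if F: "finite F" for F
  proof -
    let ?S = "\<lambda>w. \<Sum>n\<in>F. a n * X n w" and ?T = "\<Sum>n\<in>F. (a n)\<^sup>2"
    have S: "square_integrable M ?S" by (intro square_integrable_sum square_integrable_scale X)
    have "cov M Y ?S = ?T"
      by (simp add: cov_sum_right square_integrable_scale X Y cov_scale_right a_def power2_eq_square)
    hence "?T\<^sup>2 \<le> cov M Y Y * cov M ?S ?S" using cov_Cauchy_Schwarz[OF Y S] by simp
    also have "\<dots> \<le> cov M Y Y * ((2 * real_of_int (max 0 L) + 1) * C * ?T)"
    proof (intro mult_left_mono cov_self_nonneg)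
      show "cov M ?S ?S \<le> (2 * real_of_int (max 0 L) + 1) * C * ?T"
        using variance_sum_finite_range[where L = "max 0 L" and a = a, OF F X range C] by simp
    qed
    \<comment> \<open>The choice of coefficients puts the same sum on both sides; one factor cancels
      and the bound becomes uniform in \<open>F\<close>.\<close>
    finally have "?T * ?T \<le> K * ?T" by (simp add: K_def power2_eq_square ac_simps)
    moreover have "0 \<le> ?T" by (intro sum_nonneg) simp
    moreover have "0 \<le> K"
      using C[of 0] cov_self_nonneg[of "X 0"] cov_self_nonneg[of Y] by (simp add: K_def)
    ultimately show ?thesis by (cases "?T = 0") auto
  qed
  have "summable (\<lambda>N. (a (e N))\<^sup>2)"
  proof (rule bounded_imp_summable)
    fix n
    have "(\<Sum>k\<le>n. (a (e k))\<^sup>2) = (\<Sum>m\<in>e ` {..n}. (a m)\<^sup>2)"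
      using e by (subst sum.reindex) (auto intro: inj_on_subset)
    also have "\<dots> \<le> K" by (rule bnd) simp
    finally show "(\<Sum>k\<le>n. (a (e k))\<^sup>2) \<le> K" .
  qed simp
  hence "(\<lambda>N. (a (e N))\<^sup>2) \<longlonglongrightarrow> 0" by (rule summable_LIMSEQ_zero)
  hence "(\<lambda>N. sqrt ((a (e N))\<^sup>2)) \<longlonglongrightarrow> sqrt 0" by (rule tendsto_real_sqrt)
  hence "(\<lambda>N. \<bar>a (e N)\<bar>) \<longlonglongrightarrow> 0" by simp
  thus ?thesis by (simp add: tendsto_rabs_zero_iff a_def)
qed

end

section \<open>The marginal distributions\<close>

text \<open>Ratio test: the square contributes a ratio tending to 1, so any number strictly between
  \<open>c\<close> and 1 is eventually an upper bound; the midpoint is taken.\<close>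

lemma summable_square_times_geometric:
  fixes g :: "nat \<Rightarrow> real"
  assumes nn: "\<And>n. 0 \<le> g n" and c: "0 \<le> c" "c < 1"
    and le: "\<And>n. n \<ge> N \<Longrightarrow> g (Suc n) \<le> c * g n"
  shows "summable (\<lambda>n. (real n)\<^sup>2 * g n)"
proof -
  \<comment> \<open>For \<open>n \<ge> 6 / (1 - c)\<close> one has
    \<open>(2 * n + 1) * c \<le> 3 * n \<le> (1 - c) / 2 * n^2\<close>, and this is
    \<open>(n + 1)^2 * c \<le> (1 + c) / 2 * n^2\<close> rearranged.\<close>
  obtain K :: nat where K: "6 / (1 - c) \<le> real K" using real_arch_simple by blast
  show ?thesis
  proof (rule summable_ratio_test)
    show "(1 + c) / 2 < 1" using c by simp
    fix n assume n: "max (max N K) 1 \<le> n"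
    hence n1: "1 \<le> real n" by simp
    have "6 / (1 - c) \<le> real n" using K n by linarith
    hence "6 \<le> real n * (1 - c)" using c by (simp add: field_simps)
    hence "6 * real n \<le> real n * (1 - c) * real n" using n1 by (intro mult_right_mono) auto
    moreover have "(2 * real n + 1) * c \<le> (2 * real n + 1) * 1" using c by (intro mult_left_mono) auto
    ultimately have "(real n + 1)\<^sup>2 * c \<le> (1 + c) / 2 * (real n)\<^sup>2"
      using n1 by (simp add: power2_eq_square algebra_simps)
    hence "(real n + 1)\<^sup>2 * c * g n \<le> (1 + c) / 2 * (real n)\<^sup>2 * g n"
      by (rule mult_right_mono) (rule nn)
    moreover have "(real n + 1)\<^sup>2 * g (Suc n) \<le> (real n + 1)\<^sup>2 * c * g n"
      unfolding mult.assoc using n by (intro mult_left_mono le) auto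
    ultimately have "(real n + 1)\<^sup>2 * g (Suc n) \<le> (1 + c) / 2 * (real n)\<^sup>2 * g n"
      by (rule order_trans[rotated])
    hence "(real (Suc n))\<^sup>2 * g (Suc n) \<le> (1 + c) / 2 * ((real n)\<^sup>2 * g n)"
      unfolding of_nat_Suc mult.assoc by (simp only: add.commute)
    thus "norm ((real (Suc n))\<^sup>2 * g (Suc n)) \<le> (1 + c) / 2 * norm ((real n)\<^sup>2 * g n)"
      using nn by simp
  qed
qed

lemma integrable_count_space_int:
  fixes g :: "int \<Rightarrow> real"
  assumes "\<And>n. 0 \<le> g n" "summable (\<lambda>n. g (int n))" "summable (\<lambda>n. g (- int n))"
  shows "integrable (count_space UNIV) g"
proof -
  have "Infinite_Set_Sum.abs_summable_on g (range int)"
    using assms by (subst abs_summable_on_reindex_iff[symmetric]) (auto simp: abs_summable_on_nat_iff')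
  moreover have "Infinite_Set_Sum.abs_summable_on g (range (\<lambda>n. - int n))"
    using assms by (subst abs_summable_on_reindex_iff[symmetric]) (auto simp: abs_summable_on_nat_iff' inj_def)
  ultimately have "Infinite_Set_Sum.abs_summable_on g (range int \<union> range (\<lambda>n. - int n))"
    by (rule abs_summable_on_union)
  moreover have "range int \<union> range (\<lambda>n. - int n) = UNIV"
  proof -
    have "x \<in> range int \<union> range (\<lambda>n. - int n)" for x by (cases x rule: int_cases2) auto
    thus ?thesis by blast
  qed
  ultimately show ?thesis by (simp add: abs_summable_on_def)
qed

lemma mem_spins_iff: "z \<in> spins a b \<longleftrightarrow> a \<le> Fin z \<and> Fin z \<le> b"
  by (cases a; cases b) (auto simp: spins_def one_extended_def)

section \<open>Positivity and monotonicity of \<open>f\<close>\<close>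

context deposition_rates
begin

lemma zero_mem_spins: "0 \<in> spins \<omega>min \<omega>max"
  using \<omega>min_le \<omega>max_ge order_trans[of "Fin 0" "Fin 1" \<omega>max]
  by (simp add: mem_spins_iff zero_extended_def one_extended_def)

lemma spins_convex:
  "x \<in> spins \<omega>min \<omega>max \<Longrightarrow> y \<in> spins \<omega>min \<omega>max \<Longrightarrow> x \<le> z \<Longrightarrow> z \<le> y \<Longrightarrow> z \<in> spins \<omega>min \<omega>max"
  unfolding mem_spins_iff
  using order_trans[of \<omega>min "Fin x" "Fin z"] order_trans[of "Fin z" "Fin y" \<omega>max] by simp

text \<open>In each of the three admissible situations at least one rate is nonzero away from the
  walls; the properties of \<open>f\<close> are read off from that rate.\<close>

lemma rates_cases:
  obtains (p) "\<And>y z. y \<in> spins \<omega>min \<omega>max \<Longrightarrow> z \<in> spins \<omega>min \<omega>max \<Longrightarrow> Fin y \<noteq> \<omega>min \<Longrightarrow> Fin z \<noteq> \<omega>max \<Longrightarrow> p y z \<noteq> 0"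
  | (q) "\<And>y z. y \<in> spins \<omega>min \<omega>max \<Longrightarrow> z \<in> spins \<omega>min \<omega>max \<Longrightarrow> Fin y \<noteq> \<omega>max \<Longrightarrow> Fin z \<noteq> \<omega>min \<Longrightarrow> q y z \<noteq> 0"
  using rates_nonzero unfolding Let_def by blast

lemma zero_neq_max: "Fin 0 \<noteq> \<omega>max"
  using \<omega>max_ge by (auto simp: one_extended_def)

text \<open>The spin 0 serves as partner: it is not \<open>\<omega>max\<close>, so
  \<open>p z 0\<close> or \<open>q 0 z\<close> is nonzero, and either of them contains
  \<open>f z\<close> as a factor.\<close>

lemma f_pos:
  assumes z: "z \<in> spins \<omega>min \<omega>max" and m: "Fin z \<noteq> \<omega>min"
  shows "0 < f z"
proof -
  obtain s\<^sub>p s\<^sub>q :: "int \<Rightarrow> int \<Rightarrow> real" where s: "\<And>y z. y \<in> spins \<omega>min \<omega>max \<Longrightarrow> z \<in> spins \<omega>min \<omega>max \<Longrightarrow>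
      p y z = s\<^sub>p y (z + 1) * f y \<and> q y z = s\<^sub>q (y + 1) z * f z"
    using rates_product by metis
  have "f z \<noteq> 0"
  proof (cases rule: rates_cases)
    case p
    from p[OF z zero_mem_spins m zero_neq_max] s[OF z zero_mem_spins] show ?thesis by auto
  next
    case q
    from q[OF zero_mem_spins z zero_neq_max m] s[OF zero_mem_spins z] show ?thesis by auto
  qed
  with f_nonneg[OF z] show ?thesis by simp
qed

text \<open>By symmetry \<open>p z z\<close> and \<open>p (z + 1) (z - 1)\<close> carry the same
  factor \<open>s\<^sub>p z (z + 1)\<close>, next to \<open>f z\<close> and
  \<open>f (z + 1)\<close>. Attractivity in both arguments compares the two rates, and the common
  factor cancels. The same works with \<open>q z z\<close> and \<open>q (z - 1) (z + 1)\<close>. The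
  comparison uses the spin \<open>z - 1\<close>, hence the separate case
  \<open>z = \<omega>min\<close>, where \<open>f z = 0\<close>.\<close>

lemma f_Suc_mono:
  assumes z: "z \<in> spins \<omega>min \<omega>max" and z1: "z + 1 \<in> spins \<omega>min \<omega>max"
  shows "f z \<le> f (z + 1)"
proof (cases "Fin z = \<omega>min")
  case True
  thus ?thesis using f_min[of z] f_nonneg[OF z1] by simp
next
  case False
  hence m: "z - 1 \<in> spins \<omega>min \<omega>max"
    using z order_trans[of "Fin (z - 1)" "Fin z" \<omega>max] unfolding mem_spins_iff
    by (cases \<omega>min) auto
  have M: "Fin z \<noteq> \<omega>max" using z1 by (auto simp: mem_spins_iff)
  have fz: "0 < f z" by (rule f_pos[OF z False])
  obtain s\<^sub>p s\<^sub>q :: "int \<Rightarrow> int \<Rightarrow> real" where sym: "\<And>y z. s\<^sub>p y z = s\<^sub>p z y" "\<And>y z. s\<^sub>q y z = s\<^sub>q z y"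
    and s: "\<And>y z. y \<in> spins \<omega>min \<omega>max \<Longrightarrow> z \<in> spins \<omega>min \<omega>max \<Longrightarrow>
      p y z = s\<^sub>p y (z + 1) * f y \<and> q y z = s\<^sub>q (y + 1) z * f z"
    using rates_product by metis
  have key: ?thesis if "\<sigma> * f z \<noteq> 0" "0 \<le> \<sigma> * f z" "\<sigma> * f z \<le> \<sigma> * f (z + 1)" for \<sigma>
  proof -
    have "0 < \<sigma>" using that(1,2) fz by (auto simp: zero_le_mult_iff)
    thus ?thesis using that(3) by simp
  qed
  show ?thesis
  proof (cases rule: rates_cases)
    case p
    have "p z z \<le> p (z + 1) (z - 1)"
      using rates_attractive[OF z m] rates_attractive[OF m z] z z1 rates_attractive[of "z-1" z] by force
    thus ?thesis
      using key[of "s\<^sub>p z (z + 1)"] p[OF z z False M] rates_nonneg[OF z z] s[OF z z] s[OF z1 m] sym(1)[of z "z+1"] by simp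
  next
    case q
    have "q z z \<le> q (z - 1) (z + 1)"
      using rates_attractive[OF z z z1] rates_attractive[of "z + 1" "z - 1"] m z z1 by force
    thus ?thesis
      using key[of "s\<^sub>q (z + 1) z"] q[OF z z M False] rates_nonneg[OF z z] s[OF z z] s[OF m z1] sym(2)[of z "z+1"] by simp
  qed
qed

lemma f_mono:
  assumes "x \<le> y" "x \<in> spins \<omega>min \<omega>max" "y \<in> spins \<omega>min \<omega>max"
  shows "f x \<le> f y"
  using assms(1,3)
proof (induction y rule: int_ge_induct)
  case (step i)
  have "i \<in> spins \<omega>min \<omega>max" using spins_convex[OF assms(2) step.prems(1)] step.hyps by simp
  with step f_Suc_mono[of i] show ?case by force
qed simp

lemma f_Pinf_gt:
  assumes th: "\<theta> \<in> theta_range \<omega>min \<omega>max f" and M: "\<omega>max = Pinf"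
  shows "\<exists>n::nat. n \<ge> 1 \<and> exp \<theta> < f (int n)"
proof -
  have mem: "int (Suc n) \<in> spins \<omega>min \<omega>max" for n
    using zero_mem_spins M order_trans[of \<omega>min "Fin 0" "Fin (int (Suc n))"] by (simp add: mem_spins_iff)
  have pos: "0 < f (int (Suc n))" for n
    by (rule f_pos[OF mem]) (use \<omega>min_le in \<open>auto simp: zero_extended_def\<close>)
  let ?X = "\<lambda>n. ereal (ln (f (int n)))"
  \<comment> \<open>The sequence is started at 1 because \<open>f 0 = 0\<close> when
    \<open>\<omega>min = 0\<close>, and then the default value \<open>ln 0 = 0\<close> could spoil
    monotonicity.\<close>
  have "incseq (\<lambda>n. ?X (Suc n))"
    by (rule incseq_SucI) (use f_mono[OF _ mem mem] pos in \<open>simp del: of_nat_Suc\<close>)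
  hence "(\<lambda>n. ?X (Suc n)) \<longlonglongrightarrow> (SUP n. ?X (Suc n))" by (rule LIMSEQ_SUP)
  hence "?X \<longlonglongrightarrow> (SUP n. ?X (Suc n))" by (rule LIMSEQ_imp_Suc)
  hence "lim ?X = (SUP n. ?X (Suc n))" by (rule limI)
  hence "ereal \<theta> < (SUP n. ?X (Suc n))" using th M by (simp add: theta_range_def theta_upper_def)
  then obtain n where "\<theta> < ln (f (int (Suc n)))" by (auto simp: less_SUP_iff)
  hence "exp \<theta> < f (int (Suc n))" using pos by (metis exp_less_mono exp_ln)
  thus ?thesis by (intro exI[of _ "Suc n"]) simp
qed

lemma f_Minf_less:
  assumes th: "\<theta> \<in> theta_range \<omega>min \<omega>max f" and M: "\<omega>min = Minf"
  shows "\<exists>n::nat. f (- int n) < exp \<theta>"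
proof -
  have mem: "- int n \<in> spins \<omega>min \<omega>max" for n
    using zero_mem_spins M order_trans[of "Fin (- int n)" "Fin 0" \<omega>max] by (simp add: mem_spins_iff)
  have pos: "0 < f (- int n)" for n
    by (rule f_pos[OF mem]) (simp add: M)
  let ?X = "\<lambda>n. ereal (ln (f (- int n)))"
  have "decseq ?X"
    by (rule decseq_SucI) (use f_mono[OF _ mem mem] pos in \<open>simp del: of_nat_Suc\<close>)
  hence "?X \<longlonglongrightarrow> (INF n. ?X n)" by (rule LIMSEQ_INF)
  hence "lim ?X = (INF n. ?X n)" by (rule limI)
  hence "(INF n. ?X n) < ereal \<theta>" using th M by (simp add: theta_range_def theta_lower_def)
  then obtain n where "ln (f (- int n)) < \<theta>" by (auto simp: INF_less_iff)
  hence "f (- int n) < exp \<theta>" using pos by (metis exp_less_mono exp_ln)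
  thus ?thesis by blast
qed

section \<open>The unnormalised weights of the marginal and their tails\<close>

definition weight :: "real \<Rightarrow> int \<Rightarrow> real" where
  "weight \<theta> z = (if z \<in> spins \<omega>min \<omega>max then exp (\<theta> * real_of_int z) / ffact f z else 0)"

lemma ffact_pos:
  assumes z: "z \<in> spins \<omega>min \<omega>max"
  shows "0 < ffact f z"
proof -
  have "0 < f y" if "1 \<le> y" "y \<le> z" for y
  proof (rule f_pos)
    show "y \<in> spins \<omega>min \<omega>max" using spins_convex[OF zero_mem_spins z] that by simp
    show "Fin y \<noteq> \<omega>min" using that \<omega>min_le by (auto simp: zero_extended_def)
  qed
  moreover have "0 < f y" if "z + 1 \<le> y" "y \<le> 0" for y
  proof (rule f_pos)
    show "y \<in> spins \<omega>min \<omega>max" using spins_convex[OF z zero_mem_spins] that by simp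
    show "Fin y \<noteq> \<omega>min" using that z by (auto simp: mem_spins_iff)
  qed
  ultimately show ?thesis unfolding ffact_def by (auto intro!: prod_pos)
qed

lemma weight_nonneg: "0 \<le> weight \<theta> z"
  using ffact_pos[of z] by (auto simp: weight_def less_imp_le)

lemma weight_pos: "z \<in> spins \<omega>min \<omega>max \<Longrightarrow> 0 < weight \<theta> z"
  using ffact_pos[of z] by (auto simp: weight_def)

text \<open>Consecutive weights have ratio \<open>exp \<theta> / f (z + 1)\<close>; this is what
  \<open>ffact\<close> is designed for. Its definition is split at 0, so the recursion is proved
  separately upwards and downwards.\<close>

lemma weight_up:
  assumes "0 \<le> z" "z + 1 \<in> spins \<omega>min \<omega>max"
  shows "weight \<theta> (z + 1) * f (z + 1) = weight \<theta> z * exp \<theta>"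
proof -
  have z: "z \<in> spins \<omega>min \<omega>max" using spins_convex[OF zero_mem_spins assms(2)] assms(1) by simp
  have "0 < f (z + 1)"
    by (rule f_pos[OF assms(2)]) (use assms \<omega>min_le in \<open>auto simp: zero_extended_def\<close>)
  moreover have "ffact f (z + 1) = ffact f z * f (z + 1)"
  proof -
    have "{1..z + 1} = insert (z + 1) {1..z}" using assms by auto
    thus ?thesis using assms by (simp add: ffact_def)
  qed
  ultimately show ?thesis
    using z assms by (simp add: weight_def distrib_left exp_add)
qed

lemma weight_down:
  assumes "z \<le> 0" "z - 1 \<in> spins \<omega>min \<omega>max"
  shows "weight \<theta> (z - 1) * exp \<theta> = weight \<theta> z * f z"
proof -
  have z: "z \<in> spins \<omega>min \<omega>max" using spins_convex[OF assms(2) zero_mem_spins] assms(1) by simp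
  have "0 < f z"
    by (rule f_pos[OF z]) (use assms in \<open>auto simp: mem_spins_iff\<close>)
  moreover have "ffact f (z - 1) * f z = ffact f z"
  proof -
    have "{z..0} = insert z {z+1..0}" using assms by auto
    thus ?thesis using assms \<open>0 < f z\<close> by (simp add: ffact_def)
  qed
  moreover have "exp (\<theta> * real_of_int z) = exp (\<theta> * real_of_int (z - 1)) * exp \<theta>"
    by (simp add: exp_add[symmetric] algebra_simps)
  ultimately show ?thesis
    using z assms ffact_pos[OF z] ffact_pos[OF assms(2)] by (simp add: weight_def field_simps)
qed

text \<open>The strict upper bound on \<open>\<theta>\<close> enters here. For infinite
  \<open>\<omega>max\<close> it makes some \<open>f N\<close> exceed \<open>exp \<theta>\<close>,
  and by monotonicity the ratio of consecutive weights stays below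
  \<open>exp \<theta> / f N < 1\<close> from there on. For finite \<open>\<omega>max\<close> the
  weights end, and \<open>c = 0\<close> does.\<close>

lemma weight_tail_up:
  assumes th: "\<theta> \<in> theta_range \<omega>min \<omega>max f"
  shows "\<exists>c N. 0 \<le> c \<and> c < 1 \<and> (\<forall>n\<ge>N. weight \<theta> (int (Suc n)) \<le> c * weight \<theta> (int n))"
proof (cases \<omega>max)
  case (Fin m)
  have "weight \<theta> (int (Suc n)) \<le> 0 * weight \<theta> (int n)" if "n \<ge> nat m" for n
  proof -
    have "int (Suc n) \<notin> spins \<omega>min \<omega>max" using that by (auto simp: mem_spins_iff Fin)
    thus ?thesis by (simp add: weight_def del: of_nat_Suc)
  qed
  thus ?thesis by (intro exI[of _ 0] exI[of _ "nat m"]) auto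
next
  case Pinf
  obtain N where N: "N \<ge> 1" "exp \<theta> < f (int N)" using f_Pinf_gt[OF th Pinf] by blast
  hence fN: "0 < f (int N)" using exp_gt_zero[of \<theta>] by linarith
  have mem: "int n \<in> spins \<omega>min \<omega>max" for n
    using zero_mem_spins Pinf order_trans[of \<omega>min "Fin 0" "Fin (int n)"] by (simp add: mem_spins_iff)
  have "weight \<theta> (int (Suc n)) \<le> exp \<theta> / f (int N) * weight \<theta> (int n)" if "n \<ge> N" for n
  proof -
    have "f (int N) \<le> f (int (Suc n))" using that by (intro f_mono mem) auto
    hence "weight \<theta> (int (Suc n)) * f (int N) \<le> weight \<theta> (int (Suc n)) * f (int (Suc n))"
      by (intro mult_left_mono weight_nonneg)
    also have "\<dots> = weight \<theta> (int n) * exp \<theta>" using weight_up[of "int n" \<theta>] mem[of "Suc n"]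
      by (simp add: add.commute)
    finally have "weight \<theta> (int (Suc n)) * f (int N) \<le> weight \<theta> (int n) * exp \<theta>" .
    thus ?thesis using fN by (simp add: field_simps)
  qed
  thus ?thesis using N fN
    by (intro exI[of _ "exp \<theta> / f (int N)"] exI[of _ N]) (auto simp: less_imp_le)
next
  case Minf
  thus ?thesis using \<omega>max_ge by (simp add: one_extended_def)
qed

lemma weight_tail_down:
  assumes th: "\<theta> \<in> theta_range \<omega>min \<omega>max f"
  shows "\<exists>c N. 0 \<le> c \<and> c < 1 \<and> (\<forall>n\<ge>N. weight \<theta> (- int (Suc n)) \<le> c * weight \<theta> (- int n))"
proof (cases \<omega>min)
  case (Fin m)
  have "weight \<theta> (- int (Suc n)) \<le> 0 * weight \<theta> (- int n)" if "n \<ge> nat (- m)" for n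
  proof -
    have "- int (Suc n) \<notin> spins \<omega>min \<omega>max" using that by (auto simp: mem_spins_iff Fin)
    thus ?thesis by (simp add: weight_def del: of_nat_Suc)
  qed
  thus ?thesis by (intro exI[of _ 0] exI[of _ "nat (- m)"]) auto
next
  case Minf
  obtain N where N: "f (- int N) < exp \<theta>" using f_Minf_less[OF th Minf] by blast
  have mem: "- int n \<in> spins \<omega>min \<omega>max" for n
    using zero_mem_spins Minf order_trans[of "Fin (- int n)" "Fin 0" \<omega>max] by (simp add: mem_spins_iff)
  have "weight \<theta> (- int (Suc n)) \<le> f (- int N) / exp \<theta> * weight \<theta> (- int n)" if "n \<ge> N" for n
  proof -
    have e: "- int (Suc n) = - int n - 1" by simp
    have "weight \<theta> (- int (Suc n)) * exp \<theta> = weight \<theta> (- int n) * f (- int n)"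
      unfolding e by (rule weight_down) (simp, rule mem[of "Suc n", unfolded e])
    also have "\<dots> \<le> weight \<theta> (- int n) * f (- int N)"
      using that by (intro mult_left_mono weight_nonneg f_mono mem) auto
    finally show ?thesis using exp_gt_zero[of \<theta>] by (simp add: field_simps)
  qed
  thus ?thesis using N exp_gt_zero[of \<theta>] f_nonneg[OF mem[of N]]
    by (intro exI[of _ "f (- int N) / exp \<theta>"] exI[of _ N]) (auto simp: field_simps)
next
  case Pinf
  thus ?thesis using \<omega>min_le by (simp add: zero_extended_def)
qed

text \<open>Geometric tails on both sides give the spins a second moment; all covariances of spins
  below rest on this.\<close>

lemma weight_square_integrable:
  assumes th: "\<theta> \<in> theta_range \<omega>min \<omega>max f"
  shows "integrable (count_space UNIV) (\<lambda>z. (real_of_int z)\<^sup>2 * weight \<theta> z)"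
proof (rule integrable_count_space_int)
  show "summable (\<lambda>n. (real_of_int (int n))\<^sup>2 * weight \<theta> (int n))"
    using weight_tail_up[OF th]
    by (auto intro!: summable_square_times_geometric weight_nonneg)
  show "summable (\<lambda>n. (real_of_int (- int n))\<^sup>2 * weight \<theta> (- int n))"
    using weight_tail_down[OF th]
    by (auto intro!: summable_square_times_geometric weight_nonneg)
qed (simp add: weight_nonneg)

lemma weight_integrable:
  assumes th: "\<theta> \<in> theta_range \<omega>min \<omega>max f"
  shows "integrable (count_space UNIV) (weight \<theta>)"
proof (rule Bochner_Integration.integrable_bound)
  \<comment> \<open>The mass at 0 is added because \<open>z^2\<close> dominates 1 only away from the
    origin.\<close>
  have "integrable (count_space UNIV) (\<lambda>z::int. weight \<theta> 0 * indicator {0} z)"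
    by (intro integrable_mult_right) simp
  thus "integrable (count_space UNIV) (\<lambda>z. (real_of_int z)\<^sup>2 * weight \<theta> z + weight \<theta> 0 * indicator {0} z)"
    by (intro Bochner_Integration.integrable_add weight_square_integrable th)
  show "AE z in count_space UNIV. norm (weight \<theta> z) \<le> norm ((real_of_int z)\<^sup>2 * weight \<theta> z + weight \<theta> 0 * indicator {0} z)"
  proof (rule AE_I2)
    fix z :: int
    show "norm (weight \<theta> z) \<le> norm ((real_of_int z)\<^sup>2 * weight \<theta> z + weight \<theta> 0 * indicator {0} z)"
    proof (cases "z = 0")
      case False
      hence "1 \<le> \<bar>real_of_int z\<bar>" by linarith
      hence "1 \<le> (real_of_int z)\<^sup>2" by (metis one_le_power power2_abs)
      hence "1 * weight \<theta> z \<le> (real_of_int z)\<^sup>2 * weight \<theta> z" by (intro mult_right_mono weight_nonneg)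
      thus ?thesis using False weight_nonneg[of \<theta> z] by simp
    qed simp
  qed
qed simp

lemma Zpart_eq:
  assumes th: "\<theta> \<in> theta_range \<omega>min \<omega>max f"
  shows "Zpart \<omega>min \<omega>max f \<theta> = (\<integral>z. weight \<theta> z \<partial>count_space UNIV)"
proof -
  have "Infinite_Set_Sum.abs_summable_on (weight \<theta>) UNIV" using weight_integrable[OF th] by (simp add: abs_summable_on_def)
  hence "(\<integral>z. weight \<theta> z \<partial>count_space UNIV) = infsum (weight \<theta>) UNIV"
    using infsetsum_infsum[of "weight \<theta>" UNIV] by (simp add: infsetsum_def)
  also have "\<dots> = Zpart \<omega>min \<omega>max f \<theta>"
    unfolding Zpart_def by (rule infsum_cong_neutral) (auto simp: weight_def)
  finally show ?thesis by simp
qed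

lemma Zpart_pos:
  assumes th: "\<theta> \<in> theta_range \<omega>min \<omega>max f"
  shows "0 < Zpart \<omega>min \<omega>max f \<theta>"
proof -
  have "weight \<theta> 0 = integral\<^sup>L (count_space UNIV) (\<lambda>z::int. weight \<theta> 0 * indicator {0} z)" by simp
  also have "\<dots> \<le> (\<integral>z. weight \<theta> z \<partial>count_space UNIV)"
    by (intro integral_mono weight_integrable th integrable_mult_right integrable_real_indicator)
       (auto simp: weight_nonneg split: split_indicator)
  finally show ?thesis using weight_pos[OF zero_mem_spins, of \<theta>] by (simp add: Zpart_eq th)
qed

lemma mu_eq: "mu \<omega>min \<omega>max f \<theta> = density (count_space UNIV) (\<lambda>z. ennreal (weight \<theta> z / Zpart \<omega>min \<omega>max f \<theta>))"
  unfolding mu_def weight_def by (intro arg_cong2[where f = density] refl ext) (simp add: mult.commute)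

lemma sets_mu [simp]: "sets (mu \<omega>min \<omega>max f \<theta>) = UNIV"
  by (simp add: mu_def)

lemma prob_space_mu:
  assumes th: "\<theta> \<in> theta_range \<omega>min \<omega>max f"
  shows "prob_space (mu \<omega>min \<omega>max f \<theta>)"
proof
  have "emeasure (mu \<omega>min \<omega>max f \<theta>) (space (mu \<omega>min \<omega>max f \<theta>))
      = (\<integral>\<^sup>+z. ennreal (weight \<theta> z / Zpart \<omega>min \<omega>max f \<theta>) \<partial>count_space UNIV)"
    by (simp add: mu_eq emeasure_density)
  also have "\<dots> = ennreal (\<integral>z. weight \<theta> z / Zpart \<omega>min \<omega>max f \<theta> \<partial>count_space UNIV)"
    using Zpart_pos[OF th] weight_integrable[OF th]
    by (intro nn_integral_eq_integral) (auto simp: weight_nonneg less_imp_le)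
  also have "\<dots> = 1" using Zpart_pos[OF th] Zpart_eq[OF th] by simp
  finally show "emeasure (mu \<omega>min \<omega>max f \<theta>) (space (mu \<omega>min \<omega>max f \<theta>)) = 1" .
qed

lemma square_integrable_mu:
  assumes th: "\<theta> \<in> theta_range \<omega>min \<omega>max f"
  shows "square_integrable (mu \<omega>min \<omega>max f \<theta>) real_of_int"
proof -
  have "integrable (count_space UNIV) (\<lambda>z. weight \<theta> z / Zpart \<omega>min \<omega>max f \<theta> * (real_of_int z)\<^sup>2)"
    using integrable_mult_right[OF weight_square_integrable[OF th], of "1 / Zpart \<omega>min \<omega>max f \<theta>"]
    by (simp add: ac_simps)
  thus ?thesis unfolding square_integrable_def mu_eq
    using Zpart_pos[OF th]
    by (subst integrable_density) (auto simp: weight_nonneg less_imp_le intro: AE_I2)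
qed

lemma AE_mu_spins: "AE z in mu \<omega>min \<omega>max f \<theta>. z \<in> spins \<omega>min \<omega>max"
  unfolding mu_def by (subst AE_density) (auto intro: AE_I2)

text \<open>Every admissible spin is an atom, so a statement holding for almost every value of a
  spin holds for each admissible value.\<close>

lemma measure_mu_singleton_pos:
  assumes th: "\<theta> \<in> theta_range \<omega>min \<omega>max f" and k: "k \<in> spins \<omega>min \<omega>max"
  shows "emeasure (mu \<omega>min \<omega>max f \<theta>) {k} \<noteq> 0"
  using weight_pos[OF k, of \<theta>] Zpart_pos[OF th] unfolding mu_eq
  by (simp add: emeasure_density nn_integral_indicator_singleton)

end

section \<open>The product distribution\<close>

lemma space_conf [simp]: "space conf = UNIV"
  by (simp add: conf_def space_PiM)

lemma measurable_conf_component [measurable]: "(\<lambda>x. x i) \<in> conf \<rightarrow>\<^sub>M count_space UNIV"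
  unfolding conf_def by measurable

lemma measurable_into_conf:
  assumes "\<And>i. (\<lambda>x. f x i) \<in> N \<rightarrow>\<^sub>M count_space UNIV"
  shows "f \<in> N \<rightarrow>\<^sub>M conf"
  unfolding conf_def by (rule measurable_PiM_single') (use assms in \<open>auto simp: space_PiM\<close>)

text \<open>The integers are countable and discrete, so an arbitrary \<open>F\<close> is allowed; in
  particular the rates are measurable functions of the configuration whatever \<open>p\<close> and
  \<open>q\<close> are.\<close>

lemma measurable_int_binary:
  fixes f g :: "'x \<Rightarrow> int"
  assumes "f \<in> N \<rightarrow>\<^sub>M count_space UNIV" "g \<in> N \<rightarrow>\<^sub>M count_space UNIV" "\<And>i j. F i j \<in> space L"
  shows "(\<lambda>x. F (f x) (g x)) \<in> N \<rightarrow>\<^sub>M L"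
  by (rule measurable_compose_countable[OF measurable_compose_countable[OF _ assms(2)] assms(1)])
     (simp add: assms(3))

definition shift :: "int \<Rightarrow> (int \<Rightarrow> int) \<Rightarrow> int \<Rightarrow> int" where
  "shift k x = (\<lambda>i. x (i + k))"

lemma measurable_shift [measurable]: "shift k \<in> conf \<rightarrow>\<^sub>M conf"
  by (rule measurable_into_conf) (simp add: shift_def)

lemma measurable_slope [measurable]: "slope \<in> conf \<rightarrow>\<^sub>M conf"
  by (rule measurable_into_conf) (auto simp: slope_def intro: measurable_int_binary)

lemma cov_distr:
  assumes "T \<in> M \<rightarrow>\<^sub>M N" "X \<in> borel_measurable N" "Y \<in> borel_measurable N"
  shows "cov (distr M N T) X Y = cov M (\<lambda>w. X (T w)) (\<lambda>w. Y (T w))"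
  using assms unfolding cov_def by (simp add: integral_distr)

lemma square_integrable_distr:
  assumes "T \<in> M \<rightarrow>\<^sub>M N" "square_integrable (distr M N T) X"
  shows "square_integrable M (\<lambda>w. X (T w))"
  using assms unfolding square_integrable_def
  by (auto simp: measurable_compose integrable_distr_eq)

lemma square_integrable_distr_iff:
  assumes "T \<in> M \<rightarrow>\<^sub>M N" "X \<in> borel_measurable N"
  shows "square_integrable (distr M N T) X \<longleftrightarrow> square_integrable M (\<lambda>w. X (T w))"
  using assms unfolding square_integrable_def
  by (auto simp: measurable_compose integrable_distr_eq)

context deposition_rates
begin

lemma sets_Mu [simp, measurable_cong]: "sets (Mu \<omega>min \<omega>max f \<theta>) = sets conf"
  unfolding Mu_def conf_def by (rule sets_PiM_cong) (simp_all add: mu_def)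

lemma space_Mu [simp]: "space (Mu \<omega>min \<omega>max f \<theta>) = UNIV"
  using sets_eq_imp_space_eq[OF sets_Mu[of \<theta>]] by simp

lemma space_mu [simp]: "space (mu \<omega>min \<omega>max f \<theta>) = UNIV"
  by (simp add: mu_def)

context
  fixes \<theta> assumes th: "\<theta> \<in> theta_range \<omega>min \<omega>max f"
begin

interpretation mu: prob_space "mu \<omega>min \<omega>max f \<theta>" by (rule prob_space_mu[OF th])

lemma prob_space_Mu: "prob_space (Mu \<omega>min \<omega>max f \<theta>)"
  unfolding Mu_def by (rule prob_space_PiM) (rule prob_space_mu[OF th])

interpretation Mu: prob_space "Mu \<omega>min \<omega>max f \<theta>" by (rule prob_space_Mu)

lemma distr_Mu_shift: "distr (Mu \<omega>min \<omega>max f \<theta>) conf (shift k) = Mu \<omega>min \<omega>max f \<theta>"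
proof -
  let ?P = "PiM UNIV (\<lambda>_::int. mu \<omega>min \<omega>max f \<theta>)"
  have "distr ?P ?P (\<lambda>\<omega>. \<lambda>n\<in>UNIV. \<omega> (n + k)) = ?P"
    by (rule distr_PiM_reindex[where f = "\<lambda>i. i + k" and I = UNIV and K = UNIV])
       (auto simp: prob_space_mu[OF th] inj_def)
  moreover have "(\<lambda>\<omega>. \<lambda>n\<in>UNIV. \<omega> (n + k)) = shift k" by (auto simp: shift_def fun_eq_iff)
  moreover have "distr (Mu \<omega>min \<omega>max f \<theta>) conf (shift k) = distr ?P ?P (shift k)"
    unfolding Mu_def by (rule distr_cong) (use sets_Mu in \<open>simp_all add: Mu_def\<close>)
  ultimately show ?thesis by (simp add: Mu_def)
qed

lemma distr_Mu_component: "distr (Mu \<omega>min \<omega>max f \<theta>) (mu \<omega>min \<omega>max f \<theta>) (\<lambda>\<omega>. \<omega> i) = mu \<omega>min \<omega>max f \<theta>"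
  unfolding Mu_def by (rule distr_PiM_component) (auto simp: prob_space_mu[OF th])

text \<open>Replacing one coordinate by an independent copy preserves a product law. This isolates
  the spin at the origin in the proof of positive association.\<close>

lemma distr_Mu_resample:
  "distr (mu \<omega>min \<omega>max f \<theta> \<Otimes>\<^sub>M Mu \<omega>min \<omega>max f \<theta>) conf (\<lambda>(x, X). X(i := x)) = Mu \<omega>min \<omega>max f \<theta>"
proof -
  let ?P = "PiM UNIV (\<lambda>_::int. mu \<omega>min \<omega>max f \<theta>)"
  have "distr (mu \<omega>min \<omega>max f \<theta> \<Otimes>\<^sub>M ?P) (PiM (insert i UNIV) (\<lambda>_::int. mu \<omega>min \<omega>max f \<theta>)) (\<lambda>(x, X). X(i := x))
      = PiM (insert i UNIV) (\<lambda>_::int. mu \<omega>min \<omega>max f \<theta>)"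
    by (rule distr_pair_PiM_eq_PiM[where M = "\<lambda>_. mu \<omega>min \<omega>max f \<theta>" and i' = i and I = UNIV])
       (auto simp: prob_space_mu[OF th])
  hence "distr (mu \<omega>min \<omega>max f \<theta> \<Otimes>\<^sub>M ?P) ?P (\<lambda>(x, X). X(i := x)) = ?P" by simp
  moreover have "distr (mu \<omega>min \<omega>max f \<theta> \<Otimes>\<^sub>M Mu \<omega>min \<omega>max f \<theta>) conf (\<lambda>(x, X). X(i := x))
     = distr (mu \<omega>min \<omega>max f \<theta> \<Otimes>\<^sub>M ?P) ?P (\<lambda>(x, X). X(i := x))"
    unfolding Mu_def by (rule distr_cong) (use sets_Mu in \<open>simp_all add: Mu_def\<close>)
  ultimately show ?thesis by (simp add: Mu_def)
qed

lemma measurable_Mu_component: "(\<lambda>\<omega>. \<omega> i) \<in> Mu \<omega>min \<omega>max f \<theta> \<rightarrow>\<^sub>M mu \<omega>min \<omega>max f \<theta>"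
  using measurable_conf_component[of i]
  by (simp add: measurable_cong_sets[OF sets_Mu refl] measurable_cong_sets[OF refl, of "mu \<omega>min \<omega>max f \<theta>" "count_space UNIV"])

lemma square_integrable_Mu_component: "square_integrable (Mu \<omega>min \<omega>max f \<theta>) (\<lambda>\<omega>. real_of_int (\<omega> i))"
  by (rule square_integrable_distr[OF measurable_Mu_component])
     (simp add: distr_Mu_component square_integrable_mu[OF th])

lemma AE_Mu_spins: "AE \<omega> in Mu \<omega>min \<omega>max f \<theta>. \<omega> i \<in> spins \<omega>min \<omega>max"
  unfolding Mu_def by (rule AE_PiM_component) (auto simp: prob_space_mu[OF th] AE_mu_spins)

text \<open>Functions of disjoint blocks of independent coordinates are independent. Coinciding
  indices are allowed within a block, so functions of a single spin are included.\<close>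

lemma cov_Mu_disjoint:
  assumes F: "square_integrable (Mu \<omega>min \<omega>max f \<theta>) (\<lambda>\<omega>. F (\<omega> i) (\<omega> j))"
    and G: "square_integrable (Mu \<omega>min \<omega>max f \<theta>) (\<lambda>\<omega>. G (\<omega> k) (\<omega> l))"
    and disj: "{i, j} \<inter> {k, l} = {}"
  shows "cov (Mu \<omega>min \<omega>max f \<theta>) (\<lambda>\<omega>. F (\<omega> i) (\<omega> j)) (\<lambda>\<omega>. G (\<omega> k) (\<omega> l)) = 0"
proof -
  let ?Mu = "Mu \<omega>min \<omega>max f \<theta>" and ?mu = "mu \<omega>min \<omega>max f \<theta>"
  \<comment> \<open>Independence of the coordinates amounts to their joint law being the product of
    the marginals, and the joint map is the identity.\<close>
  have "distr ?Mu (PiM UNIV (\<lambda>_. ?mu)) (\<lambda>x. \<lambda>i\<in>UNIV. x i) = PiM UNIV (\<lambda>i. distr ?Mu ?mu (\<lambda>\<omega>. \<omega> i))"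
    unfolding distr_Mu_component by (simp add: Mu_def restrict_UNIV distr_id2)
  hence ind: "Mu.indep_vars (\<lambda>_. ?mu) (\<lambda>i \<omega>. \<omega> i) UNIV"
    by (subst Mu.indep_vars_iff_distr_eq_PiM) (auto simp: measurable_Mu_component)
  have meas: "(\<lambda>x. F' (x a) (x b)) \<in> borel_measurable (PiM {a, b} (\<lambda>_. ?mu))" for F' :: "int \<Rightarrow> int \<Rightarrow> real" and a b :: int
  proof (rule measurable_int_binary)
    have "(\<lambda>x. x c) \<in> PiM {a, b} (\<lambda>_. ?mu) \<rightarrow>\<^sub>M ?mu" if "c \<in> {a, b}" for c
      using that by (rule measurable_component_singleton)
    thus "(\<lambda>x. x a) \<in> PiM {a, b} (\<lambda>_. ?mu) \<rightarrow>\<^sub>M count_space UNIV" "(\<lambda>x. x b) \<in> PiM {a, b} (\<lambda>_. ?mu) \<rightarrow>\<^sub>M count_space UNIV"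
      by (auto cong: measurable_cong_sets simp: measurable_cong_sets[OF refl, of "count_space UNIV" ?mu])
  qed simp
  have "Mu.indep_var borel ((\<lambda>x. F (x i) (x j)) \<circ> (\<lambda>\<omega>. restrict (\<lambda>i. \<omega> i) {i, j}))
     borel ((\<lambda>x. G (x k) (x l)) \<circ> (\<lambda>\<omega>. restrict (\<lambda>i. \<omega> i) {k, l}))"
    by (rule Mu.indep_var_compose[OF Mu.indep_var_restrict[OF ind disj]]) (auto intro: meas)
  hence "Mu.indep_var borel (\<lambda>\<omega>. F (\<omega> i) (\<omega> j)) borel (\<lambda>\<omega>. G (\<omega> k) (\<omega> l))"
    by (simp add: o_def)
  from Mu.indep_var_lebesgue_integral[OF this Mu.square_integrable_integrable[OF F] Mu.square_integrable_integrable[OF G]]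
  show ?thesis by (simp add: Mu.cov_eq[OF F G])
qed

lemma square_integrable_rate:
  "square_integrable (Mu \<omega>min \<omega>max f \<theta>) (\<lambda>\<omega>. p (\<omega> i) (\<omega> (i + 1)))"
  "square_integrable (Mu \<omega>min \<omega>max f \<theta>) (\<lambda>\<omega>. q (\<omega> i) (\<omega> (i + 1)))"
proof -
  have m: "(\<lambda>\<omega>. F (\<omega> a) (\<omega> b)) \<in> borel_measurable conf" for F :: "int \<Rightarrow> int \<Rightarrow> real" and a b
    by (rule measurable_int_binary) auto
  have 0: "square_integrable (Mu \<omega>min \<omega>max f \<theta>) (\<lambda>\<omega>. F (\<omega> i) (\<omega> (i + 1)))"
    if "integrable (Mu \<omega>min \<omega>max f \<theta>) (\<lambda>\<omega>. F (\<omega> 0) (\<omega> 1) ^ 2)" for F :: "int \<Rightarrow> int \<Rightarrow> real"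
  proof -
    have "square_integrable (distr (Mu \<omega>min \<omega>max f \<theta>) conf (shift i)) (\<lambda>\<omega>. F (\<omega> 0) (\<omega> 1))"
      unfolding distr_Mu_shift using that m[of F 0 1]
      by (simp add: square_integrable_def measurable_cong_sets[OF sets_Mu refl])
    hence "square_integrable (Mu \<omega>min \<omega>max f \<theta>) (\<lambda>\<omega>. F (shift i \<omega> 0) (shift i \<omega> 1))"
      by (rule square_integrable_distr[rotated]) (simp add: measurable_cong_sets[OF sets_Mu refl])
    thus ?thesis by (simp add: shift_def add.commute)
  qed
  show "square_integrable (Mu \<omega>min \<omega>max f \<theta>) (\<lambda>\<omega>. p (\<omega> i) (\<omega> (i + 1)))"
    "square_integrable (Mu \<omega>min \<omega>max f \<theta>) (\<lambda>\<omega>. q (\<omega> i) (\<omega> (i + 1)))"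
    using rates_moments[OF th, of 2] by (auto intro: 0)
qed

end

end

section \<open>Disintegration\<close>

text \<open>The dependence of the integrand on \<open>x\<close> is absorbed into the measure:
  pushing \<open>L x\<close> forward along \<open>y\<close> to \<open>(x, y)\<close> leaves a fixed
  integrand on the product space.\<close>

lemma integral_measurable_subprob_algebra2:
  fixes f :: "'a \<Rightarrow> 'b \<Rightarrow> real"
  assumes f [measurable]: "(\<lambda>(x, y). f x y) \<in> borel_measurable (M \<Otimes>\<^sub>M N)"
    and L [measurable]: "L \<in> M \<rightarrow>\<^sub>M subprob_algebra N"
  shows "(\<lambda>x. integral\<^sup>L (L x) (f x)) \<in> borel_measurable M"
proof -
  note measurable_distr2 [measurable]
  have "(\<lambda>x. integral\<^sup>L (distr (L x) (M \<Otimes>\<^sub>M N) (\<lambda>y. (x, y))) (\<lambda>(x, y). f x y)) \<in> borel_measurable M"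
    by measurable
  thus ?thesis
    by (rule measurable_cong[THEN iffD1, rotated])
       (simp add: integral_distr measurable_cong_sets[OF sets_kernel[OF L] refl])
qed

text \<open>The iterated integral is finite, so the inner one is finite for almost every
  \<open>x\<close>. On the exceptional null set the Bochner integral takes its default value 0,
  which does no harm.\<close>

lemma integral_disintegration_nonneg:
  fixes G :: "'b \<times> 'c \<Rightarrow> real"
  assumes T: "T \<in> M \<rightarrow>\<^sub>M N \<Otimes>\<^sub>M E" and K: "K \<in> N \<rightarrow>\<^sub>M prob_algebra E"
    and dis: "\<And>g. g \<in> borel_measurable (N \<Otimes>\<^sub>M E) \<Longrightarrow> (\<integral>\<^sup>+w. g (T w) \<partial>M) = (\<integral>\<^sup>+x. \<integral>\<^sup>+y. g (x, y) \<partial>K x \<partial>N)"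
    and G: "G \<in> borel_measurable (N \<Otimes>\<^sub>M E)" "integrable M (\<lambda>w. G (T w))" and nn: "\<And>z. 0 \<le> G z"
  shows "AE x in N. integrable (K x) (\<lambda>y. G (x, y))"
    "integrable N (\<lambda>x. \<integral>y. G (x, y) \<partial>K x)"
    "(\<integral>w. G (T w) \<partial>M) = (\<integral>x. \<integral>y. G (x, y) \<partial>K x \<partial>N)"
proof -
  have Ks: "K \<in> N \<rightarrow>\<^sub>M subprob_algebra E" by (rule measurable_prob_algebraD[OF K])
  have Gm: "(\<lambda>y. G (x, y)) \<in> borel_measurable (K x)" if "x \<in> space N" for x
    using that G(1) subprob_measurableD(2)[OF Ks that]
    by (simp add: measurable_cong_sets[of "K x" E] measurable_Pair2)
  have mm: "(\<lambda>x. \<integral>y. G (x, y) \<partial>K x) \<in> borel_measurable N"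
    using G(1) Ks by (intro integral_measurable_subprob_algebra2) auto
  have nm: "(\<lambda>x. \<integral>\<^sup>+y. ennreal (G (x, y)) \<partial>K x) \<in> borel_measurable N"
    using G(1) Ks by (intro nn_integral_measurable_subprob_algebra2) auto
  have eq: "(\<integral>\<^sup>+x. \<integral>\<^sup>+y. ennreal (G (x, y)) \<partial>K x \<partial>N) = ennreal (\<integral>w. G (T w) \<partial>M)"
    using dis[of "\<lambda>z. ennreal (G z)"] G nn by (simp add: nn_integral_eq_integral)
  hence "(\<integral>\<^sup>+x. \<integral>\<^sup>+y. ennreal (G (x, y)) \<partial>K x \<partial>N) \<noteq> \<infinity>" by simp
  hence "AE x in N. (\<integral>\<^sup>+y. ennreal (G (x, y)) \<partial>K x) \<noteq> \<infinity>"
    by (rule nn_integral_PInf_AE[OF nm])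
  hence ae: "AE x in N. integrable (K x) (\<lambda>y. G (x, y)) \<and> (\<integral>\<^sup>+y. ennreal (G (x, y)) \<partial>K x) = ennreal (\<integral>y. G (x, y) \<partial>K x)"
  proof (rule AE_mp, intro AE_I2 impI)
    fix x assume x: "x \<in> space N" and fin: "(\<integral>\<^sup>+y. ennreal (G (x, y)) \<partial>K x) \<noteq> \<infinity>"
    have i: "integrable (K x) (\<lambda>y. G (x, y))"
      using fin Gm[OF x] nn by (intro integrableI_nonneg) (auto simp: top.not_eq_extremum)
    thus "integrable (K x) (\<lambda>y. G (x, y)) \<and> (\<integral>\<^sup>+y. ennreal (G (x, y)) \<partial>K x) = ennreal (\<integral>y. G (x, y) \<partial>K x)"
      using nn by (simp add: nn_integral_eq_integral)
  qed
  thus "AE x in N. integrable (K x) (\<lambda>y. G (x, y))" by eventually_elim simp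
  have "(\<integral>\<^sup>+x. ennreal (\<integral>y. G (x, y) \<partial>K x) \<partial>N) = (\<integral>\<^sup>+x. \<integral>\<^sup>+y. ennreal (G (x, y)) \<partial>K x \<partial>N)"
    using ae by (intro nn_integral_cong_AE) auto
  with eq have e: "(\<integral>\<^sup>+x. ennreal (\<integral>y. G (x, y) \<partial>K x) \<partial>N) = ennreal (\<integral>w. G (T w) \<partial>M)" by simp
  show "integrable N (\<lambda>x. \<integral>y. G (x, y) \<partial>K x)"
    using mm e nn by (intro integrableI_nonneg) auto
  show "(\<integral>w. G (T w) \<partial>M) = (\<integral>x. \<integral>y. G (x, y) \<partial>K x \<partial>N)"
    using integral_eq_nn_integral[OF mm] e nn by simp
qed

text \<open>Positive and negative parts are both integrable over \<open>M\<close>, so their inner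
  integrals are finite almost everywhere and may be subtracted.\<close>

lemma integral_disintegration:
  fixes G :: "'b \<times> 'c \<Rightarrow> real"
  assumes T: "T \<in> M \<rightarrow>\<^sub>M N \<Otimes>\<^sub>M E" and K: "K \<in> N \<rightarrow>\<^sub>M prob_algebra E"
    and dis: "\<And>g. g \<in> borel_measurable (N \<Otimes>\<^sub>M E) \<Longrightarrow> (\<integral>\<^sup>+w. g (T w) \<partial>M) = (\<integral>\<^sup>+x. \<integral>\<^sup>+y. g (x, y) \<partial>K x \<partial>N)"
    and G: "G \<in> borel_measurable (N \<Otimes>\<^sub>M E)" "integrable M (\<lambda>w. G (T w))"
  shows "integrable N (\<lambda>x. \<integral>y. G (x, y) \<partial>K x)"
    "(\<integral>w. G (T w) \<partial>M) = (\<integral>x. \<integral>y. G (x, y) \<partial>K x \<partial>N)"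
proof -
  let ?p = "\<lambda>z. max 0 (G z)" and ?m = "\<lambda>z. max 0 (- G z)"
  have i: "integrable M (\<lambda>w. ?p (T w))" "integrable M (\<lambda>w. ?m (T w))" using G(2) by auto
  have meas: "?p \<in> borel_measurable (N \<Otimes>\<^sub>M E)" "?m \<in> borel_measurable (N \<Otimes>\<^sub>M E)" using G(1) by auto
  have p: "AE x in N. integrable (K x) (\<lambda>y. ?p (x, y))" "integrable N (\<lambda>x. \<integral>y. ?p (x, y) \<partial>K x)"
      "(\<integral>w. ?p (T w) \<partial>M) = (\<integral>x. \<integral>y. ?p (x, y) \<partial>K x \<partial>N)"
    by (rule integral_disintegration_nonneg[OF T K dis meas(1) i(1)]; simp)+
  have m: "AE x in N. integrable (K x) (\<lambda>y. ?m (x, y))" "integrable N (\<lambda>x. \<integral>y. ?m (x, y) \<partial>K x)"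
      "(\<integral>w. ?m (T w) \<partial>M) = (\<integral>x. \<integral>y. ?m (x, y) \<partial>K x \<partial>N)"
    by (rule integral_disintegration_nonneg[OF T K dis meas(2) i(2)]; simp)+
  have split: "G z = ?p z - ?m z" for z by simp
  have ae: "AE x in N. (\<integral>y. G (x, y) \<partial>K x) = (\<integral>y. ?p (x, y) \<partial>K x) - (\<integral>y. ?m (x, y) \<partial>K x)"
    using p(1) m(1)
  proof eventually_elim
    case (elim x)
    show ?case by (subst split) (rule Bochner_Integration.integral_diff[OF elim])
  qed
  have meas': "(\<lambda>x. \<integral>y. G (x, y) \<partial>K x) \<in> borel_measurable N"
    using G(1) measurable_prob_algebraD[OF K] by (intro integral_measurable_subprob_algebra2) auto
  have int: "integrable N (\<lambda>x. (\<integral>y. ?p (x, y) \<partial>K x) - (\<integral>y. ?m (x, y) \<partial>K x))"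
    using p(2) m(2) by auto
  show "integrable N (\<lambda>x. \<integral>y. G (x, y) \<partial>K x)"
    using int meas' ae by (subst integrable_cong_AE[OF _ _ ae]) auto
  have "(\<integral>w. G (T w) \<partial>M) = (\<integral>w. ?p (T w) \<partial>M) - (\<integral>w. ?m (T w) \<partial>M)"
    by (subst split) (rule Bochner_Integration.integral_diff[OF i])
  also have "\<dots> = (\<integral>x. \<integral>y. ?p (x, y) \<partial>K x \<partial>N) - (\<integral>x. \<integral>y. ?m (x, y) \<partial>K x \<partial>N)"
    using p(3) m(3) by simp
  also have "\<dots> = (\<integral>x. (\<integral>y. ?p (x, y) \<partial>K x) - (\<integral>y. ?m (x, y) \<partial>K x) \<partial>N)"
    using p(2) m(2) by (intro Bochner_Integration.integral_diff[symmetric]) auto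
  also have "\<dots> = (\<integral>x. \<integral>y. G (x, y) \<partial>K x \<partial>N)"
    using int meas' ae by (intro integral_cong_AE) auto
  finally show "(\<integral>w. G (T w) \<partial>M) = (\<integral>x. \<integral>y. G (x, y) \<partial>K x \<partial>N)" .
qed

section \<open>The semigroup as a jointly measurable kernel\<close>

context deposition_dynamics
begin

lemma space_heights [simp]: "space (heights W) = {x. slope x \<in> W}"
  by (simp add: heights_def space_restrict_space)

lemma measurable_heights_id: "(\<lambda>x. x) \<in> heights W \<rightarrow>\<^sub>M conf"
  unfolding heights_def by (rule measurable_restrict_space1) simp

lemma measurable_heights_component [measurable]: "(\<lambda>x. x i) \<in> heights W \<rightarrow>\<^sub>M count_space UNIV"
  using measurable_compose[OF measurable_heights_id measurable_conf_component] .

lemma measurable_heights_slope [measurable]: "slope \<in> heights W \<rightarrow>\<^sub>M conf"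
  using measurable_compose[OF measurable_heights_id measurable_slope] .

lemma measurable_into_heights:
  "g \<in> N \<rightarrow>\<^sub>M conf \<Longrightarrow> (\<And>x. x \<in> space N \<Longrightarrow> slope (g x) \<in> W) \<Longrightarrow> g \<in> N \<rightarrow>\<^sub>M heights W"
  unfolding heights_def by (rule measurable_restrict_space2) auto

lemma S_prob:
  assumes "0 \<le> t" "slope x \<in> W"
  shows "prob_space (S t x)" "sets (S t x) = sets (heights W)" "space (S t x) = {x. slope x \<in> W}"
proof -
  show "prob_space (S t x)" and s: "sets (S t x) = sets (heights W)"
    using measurable_space[OF kernel[OF assms(1)], of x] assms(2) by (auto simp: space_prob_algebra)
  show "space (S t x) = {x. slope x \<in> W}" using sets_eq_imp_space_eq[OF s] by simp
qed

text \<open>The Dynkin formula represents the expectation as an indefinite integral of an integrable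
  function of time. The argument \<open>max 0 s\<close> extends it constantly to negative times, so
  that the kernel lives on the whole real line.\<close>

lemma continuous_semigroup:
  assumes c: "cylinder \<phi>" "bounded (range \<phi>)" and x: "slope x \<in> W"
  shows "continuous_on UNIV (\<lambda>s. \<integral>g. \<phi> g \<partial>S (max 0 s) x)"
proof -
  let ?G = "\<lambda>s. \<integral>g. gen p q \<phi> g \<partial>S s x"
  have "continuous_on {0..T} (\<lambda>s. \<integral>g. \<phi> g \<partial>S s x)" if T: "0 \<le> T" for T
  proof -
    have si: "set_integrable lborel {0..T} ?G" using gen_integrable[OF c T x] by blast
    have "continuous_on {0..T} (\<lambda>s. \<phi> x + integral {0..s} ?G)"
      by (intro continuous_intros indefinite_integral_continuous_1 set_borel_integral_eq_integral(1) si)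
    moreover have "(\<integral>g. \<phi> g \<partial>S s x) = \<phi> x + integral {0..s} ?G" if "s \<in> {0..T}" for s
    proof -
      have "set_integrable lborel {0..s} ?G" using gen_integrable[OF c _ x] that by auto
      thus ?thesis using dynkin[OF c _ x, of s] that by (simp add: set_borel_integral_eq_integral(2))
    qed
    ultimately show ?thesis by (subst continuous_on_cong[OF refl]) auto
  qed note cont = this
  \<comment> \<open>Open half-lines are neighbourhoods of their points, so continuity on compact
    time intervals becomes continuity at every point.\<close>
  have "continuous_on {..<T} (\<lambda>s. \<integral>g. \<phi> g \<partial>S (max 0 s) x)" for T
  proof (rule continuous_on_compose2[OF cont[of "max 0 T"]])
    show "continuous_on {..<T} (max (0::real))" by (intro continuous_intros)
  qed auto
  hence "isCont (\<lambda>s. \<integral>g. \<phi> g \<partial>S (max 0 s) x) s" for s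
    by (rule continuous_on_interior[where S = "{..<s+1}"]) (simp add: interior_open)
  thus ?thesis by (simp add: continuous_at_imp_continuous_on)
qed

text \<open>Boxes with finitely many constrained coordinates generate the sigma-algebra and are
  stable under intersection, and their indicators are bounded cylinder functions. For these,
  \<open>u s x\<close> is measurable in \<open>x\<close> and continuous in \<open>s\<close>, hence
  jointly measurable.\<close>

lemma measurable_kernel_joint:
  "(\<lambda>(s, x). S (max 0 s) x) \<in> borel \<Otimes>\<^sub>M heights W \<rightarrow>\<^sub>M prob_algebra (heights W)"
proof -
  let ?\<Omega> = "{x. slope x \<in> W}" and ?P = "prod_algebra UNIV (\<lambda>_::int. count_space (UNIV :: int set))"
  have Psub: "?P \<subseteq> sets conf" unfolding conf_def sets_PiM by auto
  have gen: "sets (heights W) = sigma_sets ?\<Omega> ((\<inter>) ?\<Omega> ` ?P)"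
  proof -
    have "{x \<in> space conf. slope x \<in> W} \<in> sets conf" using tempered_sets by measurable
    hence "?\<Omega> \<in> sets conf" by simp
    hence "?\<Omega> \<in> sigma_sets UNIV ?P" by (simp add: conf_def sets_PiM PiE_UNIV_domain)
    from sigma_sets_Int[OF this] show ?thesis
      by (simp add: heights_def sets_restrict_space conf_def sets_PiM PiE_UNIV_domain)
  qed
  show ?thesis
  proof (rule measurable_prob_algebra_generated[OF gen])
    show "Int_stable ((\<inter>) ?\<Omega> ` ?P)"
    proof (rule Int_stableI)
      fix a b assume "a \<in> (\<inter>) ?\<Omega> ` ?P" "b \<in> (\<inter>) ?\<Omega> ` ?P"
      then obtain A B where "A \<in> ?P" "B \<in> ?P" "a = ?\<Omega> \<inter> A" "b = ?\<Omega> \<inter> B" by blast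
      moreover from this have "A \<inter> B \<in> ?P" using Int_stable_prod_algebra by (auto simp: Int_stable_def)
      ultimately show "a \<inter> b \<in> (\<inter>) ?\<Omega> ` ?P" by (auto intro!: image_eqI[of _ _ "A \<inter> B"])
    qed
    show "(\<inter>) ?\<Omega> ` ?P \<subseteq> Pow ?\<Omega>" by auto
  next
    fix a :: "real \<times> (int \<Rightarrow> int)" assume "a \<in> space (borel \<Otimes>\<^sub>M heights W)"
    thus "prob_space (case a of (s, x) \<Rightarrow> S (max 0 s) x)" "sets (case a of (s, x) \<Rightarrow> S (max 0 s) x) = sets (heights W)"
      by (auto simp: space_pair_measure S_prob split: prod.split)
  next
    fix B assume "B \<in> (\<inter>) ?\<Omega> ` ?P"
    then obtain A where A: "A \<in> ?P" "B = ?\<Omega> \<inter> A" by blast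
    define u :: "real \<Rightarrow> (int \<Rightarrow> int) \<Rightarrow> real" where "u s x = (\<integral>g. indicator A g \<partial>S (max 0 s) x)" for s and x :: "int \<Rightarrow> int"
    have Ac: "A \<in> sets conf" using A Psub by auto
    have Bh: "B \<in> sets (heights W)" using Ac A(2) by (auto simp: heights_def sets_restrict_space)
    from prod_algebraE[OF A(1)] obtain J E where J: "A = prod_emb UNIV (\<lambda>_. count_space UNIV) J (Pi\<^sub>E J E)" "finite J"
      by metis
    have cyl: "cylinder (indicator A :: _ \<Rightarrow> real)" unfolding cylinder_def
    proof (intro exI[of _ J] conjI allI impI)
      fix g h :: "int \<Rightarrow> int" assume "\<forall>i\<in>J. g i = h i"
      thus "indicator A g = (indicator A h :: real)"
        unfolding J(1) by (auto simp: prod_emb_def indicator_def PiE_UNIV_domain PiE_iff)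
    qed (rule J(2))
    have bdd: "bounded (range (indicator A :: _ \<Rightarrow> real))"
      by (rule boundedI[of _ 1]) (auto simp: indicator_def)
    have um: "u s \<in> borel_measurable (heights W)" for s
    proof -
      have "(indicator A :: _ \<Rightarrow> real) \<in> borel_measurable (heights W)"
        using measurable_compose[OF measurable_heights_id borel_measurable_indicator[OF Ac]] .
      note int = integral_measurable_subprob_algebra[OF this]
      show ?thesis unfolding u_def
        by (rule measurable_compose[OF measurable_prob_algebraD[OF kernel] int]) simp
    qed
    \<comment> \<open>Rounding time up to the grid of mesh \<open>1 / (n + 1)\<close>: the rounded
      time has countably many values, so joint measurability reduces to fixed times, and continuity
      removes the rounding.\<close>
    let ?a = "\<lambda>n s. real_of_int \<lceil>real (Suc n) * s\<rceil> / real (Suc n)"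
    have lim: "(\<lambda>n. u (?a n s) x) \<longlonglongrightarrow> u s x" if x: "slope x \<in> W" for s x
    proof -
      have "(\<lambda>n. ?a n s) \<longlonglongrightarrow> s"
      proof (rule tendsto_sandwich[where f = "\<lambda>_. s" and h = "\<lambda>n. s + 1 / real (Suc n)"])
        show "\<forall>\<^sub>F n in sequentially. s \<le> ?a n s"
          by (intro always_eventually allI) (simp add: pos_le_divide_eq mult.commute del: of_nat_Suc)
        show "\<forall>\<^sub>F n in sequentially. ?a n s \<le> s + 1 / real (Suc n)"
        proof (intro always_eventually allI)
          fix n
          have "real_of_int \<lceil>real (Suc n) * s\<rceil> \<le> real (Suc n) * s + 1" by linarith
          hence "?a n s \<le> (real (Suc n) * s + 1) / real (Suc n)" by (rule divide_right_mono) simp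
          also have "\<dots> = s + 1 / real (Suc n)" by (simp add: add_divide_distrib del: of_nat_Suc)
          finally show "?a n s \<le> s + 1 / real (Suc n)" .
        qed
        show "(\<lambda>n. s + 1 / real (Suc n)) \<longlonglongrightarrow> s"
          using tendsto_add[OF tendsto_const[of s] LIMSEQ_Suc[OF lim_1_over_n]] by simp
      qed simp
      thus ?thesis
        unfolding u_def by (rule continuous_on_tendsto_compose[OF continuous_semigroup[OF cyl bdd x]]) auto
    qed
    have appr: "(\<lambda>z. u (?a n (fst z)) (snd z)) \<in> borel_measurable (borel \<Otimes>\<^sub>M heights W)" for n
    proof (rule measurable_compose_countable[where f = "\<lambda>k z. u (real_of_int k / real (Suc n)) (snd z)"])
      show "(\<lambda>z. u (real_of_int i / real (Suc n)) (snd z)) \<in> borel_measurable (borel \<Otimes>\<^sub>M heights W)" for i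
        using measurable_compose[OF measurable_snd um] .
      show "(\<lambda>z. \<lceil>real (Suc n) * fst z\<rceil>) \<in> borel \<Otimes>\<^sub>M heights W \<rightarrow>\<^sub>M count_space UNIV"
        by measurable
    qed
    have "(\<lambda>z. u (fst z) (snd z)) \<in> borel_measurable (borel \<Otimes>\<^sub>M heights W)"
      by (rule borel_measurable_LIMSEQ_metric[where f = "\<lambda>n z. u (?a n (fst z)) (snd z)", OF appr])
         (auto intro!: lim simp del: of_nat_Suc simp: space_pair_measure)
    hence "(\<lambda>z. ennreal (u (fst z) (snd z))) \<in> borel_measurable (borel \<Otimes>\<^sub>M heights W)" by simp
    moreover have "emeasure (case z of (s, x) \<Rightarrow> S (max 0 s) x) B = ennreal (u (fst z) (snd z))"
      if "z \<in> space (borel \<Otimes>\<^sub>M heights W)" for z :: "real \<times> (int \<Rightarrow> int)"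
    proof -
      obtain s x where z: "z = (s, x)" "slope x \<in> W" using \<open>z \<in> _\<close> by (auto simp: space_pair_measure)
      interpret K: prob_space "S (max 0 s) x" using z by (intro S_prob) auto
      have sp: "space (S (max 0 s) x) = ?\<Omega>" "sets (S (max 0 s) x) = sets (heights W)"
        using S_prob(2,3)[of "max 0 s" x] z by simp_all
      have "u s x = (\<integral>g. indicator B g \<partial>S (max 0 s) x)"
        unfolding u_def by (rule Bochner_Integration.integral_cong) (auto simp: A(2) sp indicator_def)
      also have "\<dots> = measure (S (max 0 s) x) B"
        using Bh sp by (simp add: A(2) Int_ac)
      finally show ?thesis by (simp add: z K.emeasure_eq_measure)
    qed
    ultimately show "(\<lambda>a. emeasure (case a of (s, x) \<Rightarrow> S (max 0 s) x) B) \<in> borel_measurable (borel \<Otimes>\<^sub>M heights W)"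
      by (subst measurable_cong)
  qed
qed

end

section \<open>The stationary process\<close>

definition increment :: "(int \<Rightarrow> int) \<Rightarrow> (int \<Rightarrow> int) \<Rightarrow> int \<Rightarrow> int" where
  "increment x y = (\<lambda>i. y i - x i)"

text \<open>The section of \<open>slope\<close> that pins the height at the origin to 0. The signs
  follow the convention that a slope is the height on the left minus the height on the
  right.\<close>

definition integrate :: "(int \<Rightarrow> int) \<Rightarrow> int \<Rightarrow> int" where
  "integrate \<omega> i = (if 0 \<le> i then - (\<Sum>j=1..i. \<omega> j) else (\<Sum>j=i+1..0. \<omega> j))"

lemma slope_integrate: "slope (integrate \<omega>) = \<omega>"
proof
  fix i :: int
  consider "1 \<le> i" | "i = 0" | "i < 0" by linarith
  thus "slope (integrate \<omega>) i = \<omega> i"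
  proof cases
    case 1
    hence "{1..i} = insert i {1..i-1}" by auto
    thus ?thesis using 1 by (simp add: slope_def integrate_def)
  next
    case 2
    thus ?thesis by (simp add: slope_def integrate_def)
  next
    case 3
    hence "{i..0} = insert i {i+1..0}" by auto
    thus ?thesis using 3 by (simp add: slope_def integrate_def)
  qed
qed

lemma slope_eq_imp_diff_const:
  assumes "slope x = slope y"
  shows "x i - y i = x 0 - y 0"
proof (induction i rule: int_induct[where k = 0])
  case (step1 i)
  have "slope x (i + 1) = slope y (i + 1)" using assms by simp
  with step1 show ?case by (simp add: slope_def)
next
  case (step2 i)
  have "slope x i = slope y i" using assms by simp
  with step2 show ?case by (simp add: slope_def)
qed simp

lemma eq_integrate_slope: "x = (\<lambda>i. integrate (slope x) i + x 0)"
proof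
  fix i
  have "x i - integrate (slope x) i = x 0 - integrate (slope x) 0"
    by (rule slope_eq_imp_diff_const) (simp add: slope_integrate)
  thus "x i = integrate (slope x) i + x 0" by (simp add: integrate_def)
qed

lemma slope_add_const [simp]: "slope (\<lambda>i. x i + c) = slope x"
  by (simp add: slope_def fun_eq_iff)

lemma slope_shift: "slope (shift k x) = shift k (slope x)"
  by (simp add: slope_def shift_def fun_eq_iff algebra_simps)

lemma measurable_integrate [measurable]: "integrate \<in> conf \<rightarrow>\<^sub>M conf"
proof (rule measurable_into_conf)
  have s: "(\<lambda>\<omega>. \<Sum>j\<in>J. \<omega> j) \<in> conf \<rightarrow>\<^sub>M count_space (UNIV :: int set)" for J :: "int set"
  proof (induction J rule: infinite_finite_induct)
    case (insert j J)
    hence "(\<lambda>\<omega>. \<omega> j + (\<Sum>j\<in>J. \<omega> j)) \<in> conf \<rightarrow>\<^sub>M count_space (UNIV :: int set)"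
      by (intro measurable_int_binary[where F = "(+)"]) simp_all
    thus ?case using insert by simp
  qed simp_all
  show "(\<lambda>\<omega>. integrate \<omega> i) \<in> conf \<rightarrow>\<^sub>M count_space UNIV" for i
  proof (cases "0 \<le> i")
    case True
    thus ?thesis unfolding integrate_def
      using measurable_compose[OF s, of uminus "count_space UNIV"] by simp
  next
    case False
    thus ?thesis unfolding integrate_def using s by simp
  qed
qed

lemma height_difference:
  "y a - y (a + int N) = (\<Sum>i=1..int N. slope y (i + a))"
proof (induction N)
  case (Suc N)
  have "{1..int (Suc N)} = insert (int N + 1) {1..int N}" by auto
  hence "(\<Sum>i=1..int (Suc N). slope y (i + a)) = slope y (int N + 1 + a) + (\<Sum>i=1..int N. slope y (i + a))" by simp
  also have "\<dots> = slope y (int N + 1 + a) + (y a - y (a + int N))" using Suc by simp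
  also have "\<dots> = y a - y (a + int (Suc N))" by (simp add: slope_def ac_simps)
  finally show ?case by simp
qed simp

text \<open>Reconstructs the slopes at the later time from initial slopes and increments, the pair
  whose law is shift invariant; quantities at the later time thereby become functions of that
  pair.\<close>

definition final_slope :: "(int \<Rightarrow> int) \<times> (int \<Rightarrow> int) \<Rightarrow> int \<Rightarrow> int" where
  "final_slope z = (\<lambda>i. fst z i + slope (snd z) i)"

lemma measurable_final_slope [measurable]: "final_slope \<in> conf \<Otimes>\<^sub>M conf \<rightarrow>\<^sub>M conf"
proof (rule measurable_into_conf)
  show "(\<lambda>z. final_slope z i) \<in> conf \<Otimes>\<^sub>M conf \<rightarrow>\<^sub>M count_space UNIV" for i
    unfolding final_slope_def
    by (rule measurable_int_binary[where F = "(+)", OF measurable_compose[OF measurable_fst measurable_conf_component]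
          measurable_compose[OF measurable_compose[OF measurable_snd measurable_slope] measurable_conf_component]]) simp
qed

lemma final_slope_increment [simp]: "final_slope (slope x, increment x y) = slope y"
  by (simp add: final_slope_def slope_def increment_def fun_eq_iff)

lemma final_slope_shift [simp]: "final_slope (shift k a, shift k b) = shift k (final_slope (a, b))"
  by (simp add: final_slope_def slope_shift) (simp add: shift_def)

lemma increment_shift: "increment (shift k x) (shift k y) = shift k (increment x y)"
  by (simp add: increment_def shift_def)

section \<open>Increments started from a fixed height configuration\<close>

context deposition_dynamics
begin

lemma measurable_increment: "(\<lambda>(x, y). increment x y) \<in> heights W \<Otimes>\<^sub>M heights W \<rightarrow>\<^sub>M conf"
proof (rule measurable_into_conf)
  fix i
  show "(\<lambda>z. (case z of (x, y) \<Rightarrow> increment x y) i) \<in> heights W \<Otimes>\<^sub>M heights W \<rightarrow>\<^sub>M count_space UNIV"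
    unfolding increment_def split_beta
    by (rule measurable_int_binary[where F = "(-)", OF measurable_compose[OF measurable_snd measurable_heights_component]
        measurable_compose[OF measurable_fst measurable_heights_component]]) simp
qed

lemma measurable_integrate_heights: "integrate \<in> restrict_space conf W \<rightarrow>\<^sub>M heights W"
proof (rule measurable_into_heights)
  show "integrate \<in> restrict_space conf W \<rightarrow>\<^sub>M conf" by (rule measurable_restrict_space1) measurable
qed (simp add: slope_integrate space_restrict_space)

definition mean_increment :: "real \<Rightarrow> ((int \<Rightarrow> int) \<times> (int \<Rightarrow> int) \<Rightarrow> ennreal) \<Rightarrow> (int \<Rightarrow> int) \<Rightarrow> ennreal" where
  "mean_increment s G x = (\<integral>\<^sup>+y. G (slope x, increment x y) \<partial>S s x)"

lemma measurable_slope_increment: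
  "(\<lambda>(x, y). (slope x, increment x y)) \<in> heights W \<Otimes>\<^sub>M heights W \<rightarrow>\<^sub>M conf \<Otimes>\<^sub>M conf"
  unfolding split_beta
  using measurable_increment measurable_compose[OF measurable_fst measurable_heights_slope]
  by (intro measurable_Pair) (auto simp: split_beta)

lemma measurable_mean_increment:
  assumes "0 \<le> s" "G \<in> borel_measurable (conf \<Otimes>\<^sub>M conf)"
  shows "mean_increment s G \<in> borel_measurable (heights W)"
  unfolding mean_increment_def
  using measurable_compose[OF measurable_slope_increment assms(2)] kernel[OF assms(1)]
  by (intro nn_integral_measurable_subprob_algebra2 measurable_prob_algebraD) (auto simp: split_beta)

lemma measurable_shift_heights: "shift k \<in> heights W \<rightarrow>\<^sub>M heights W"
  by (rule measurable_into_heights, rule measurable_compose[OF measurable_heights_id measurable_shift])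
     (auto simp: slope_shift, auto simp: shift_def tempered_shift)

lemma measurable_add_const_heights: "(\<lambda>g i. g i + c) \<in> heights W \<rightarrow>\<^sub>M heights W"
proof (rule measurable_into_heights)
  show "(\<lambda>g i. g i + c) \<in> heights W \<rightarrow>\<^sub>M conf"
    by (rule measurable_into_conf, rule measurable_compose[OF measurable_heights_component]) simp
qed simp

text \<open>Adding a constant to the starting heights adds the same constant to the evolved ones and
  cancels in the increments. A height configuration is determined by its slopes up to such a
  constant, so only the slopes of the start matter.\<close>

lemma mean_increment_cong:
  assumes s: "0 \<le> s" and x: "slope x \<in> W" and G: "G \<in> borel_measurable (conf \<Otimes>\<^sub>M conf)"
  shows "mean_increment s G x = mean_increment s G (integrate (slope x))"
proof -
  let ?z = "integrate (slope x)"
  have z: "slope ?z \<in> W" using x by (simp add: slope_integrate)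
  have Gm: "(\<lambda>y. G (slope x, increment x y)) \<in> borel_measurable (heights W)"
    using measurable_compose[OF measurable_compose[OF measurable_Pair1' measurable_slope_increment] G] x
    by simp
  have "mean_increment s G x = (\<integral>\<^sup>+y. G (slope x, increment x y) \<partial>S s (\<lambda>i. ?z i + x 0))"
    unfolding mean_increment_def by (subst eq_integrate_slope[of x, symmetric]) (rule refl)
  also have "\<dots> = (\<integral>\<^sup>+y. G (slope x, increment x (\<lambda>i. y i + x 0)) \<partial>S s ?z)"
    using Gm by (subst height_translation[OF s z], subst nn_integral_distr)
       (auto simp: S_prob[OF s z] measurable_add_const_heights cong: measurable_cong_sets)
  also have "\<dots> = mean_increment s G ?z"
  proof -
    have "increment x (\<lambda>i. y i + x 0) = increment ?z y" for y
      unfolding increment_def by (subst eq_integrate_slope[of x]) simp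
    thus ?thesis by (simp add: mean_increment_def slope_integrate)
  qed
  finally show ?thesis .
qed

lemma mean_increment_shift:
  assumes s: "0 \<le> s" and x: "slope x \<in> W" and G: "G \<in> borel_measurable (conf \<Otimes>\<^sub>M conf)"
  shows "mean_increment s G (shift k x) = mean_increment s (\<lambda>(a, b). G (shift k a, shift k b)) x"
proof -
  have x': "slope (shift k x) \<in> W" unfolding slope_shift unfolding shift_def by (rule tempered_shift[OF x])
  have Gm: "(\<lambda>y. G (slope (shift k x), increment (shift k x) y)) \<in> borel_measurable (heights W)"
    using measurable_compose[OF measurable_compose[OF measurable_Pair1' measurable_slope_increment] G] x'
    by simp
  have "S s (shift k x) = distr (S s x) (heights W) (shift k)"
    using space_translation[OF s x, of k] by (simp add: shift_def[abs_def])
  hence "mean_increment s G (shift k x)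
      = (\<integral>\<^sup>+y. G (slope (shift k x), increment (shift k x) (shift k y)) \<partial>S s x)"
    using Gm unfolding mean_increment_def
    by (simp, subst nn_integral_distr)
       (auto simp: S_prob[OF s x] measurable_shift_heights cong: measurable_cong_sets)
  also have "\<dots> = mean_increment s (\<lambda>(a, b). G (shift k a, shift k b)) x"
    unfolding mean_increment_def by (simp add: slope_shift increment_shift)
  finally show ?thesis .
qed

end

section \<open>Two-point laws of the stationary process\<close>

locale stationary_dynamics = deposition_dynamics \<omega>min \<omega>max p q f W S
  for \<omega>min \<omega>max p q f W S +
  fixes M :: "'a measure" and h :: "real \<Rightarrow> 'a \<Rightarrow> int \<Rightarrow> int" and \<theta> :: real
  assumes theta: "\<theta> \<in> theta_range \<omega>min \<omega>max f"
    and markov: "markov_process M (heights W) S h"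
    and initial: "distr M conf (\<lambda>w. slope (h 0 w)) = Mu \<omega>min \<omega>max f \<theta>"
begin

sublocale M: prob_space M
  using markov by (simp add: markov_process_def)

sublocale Mu: prob_space "Mu \<omega>min \<omega>max f \<theta>"
  by (rule prob_space_Mu[OF theta])

abbreviation "Stat \<equiv> Mu \<omega>min \<omega>max f \<theta>"

lemma measurable_h: "0 \<le> s \<Longrightarrow> h s \<in> M \<rightarrow>\<^sub>M heights W"
  using markov by (simp add: markov_process_def)

definition init :: "(int \<Rightarrow> int) measure" where
  "init = distr M (heights W) (h 0)"

lemma sets_init [simp, measurable_cong]: "sets init = sets (heights W)"
  by (simp add: init_def)

lemma space_init [simp]: "space init = {x. slope x \<in> W}"
  by (simp add: init_def)

sublocale init: prob_space init
  unfolding init_def by (rule M.prob_space_distr[OF measurable_h]) simp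

lemma distr_init_slope: "distr init conf slope = Stat"
  unfolding init_def using initial
  by (subst distr_distr[OF _ measurable_h]) (simp_all add: o_def)

text \<open>The event that \<open>h 0\<close> lies in \<open>A\<close> belongs to the history up to
  time 0, so the conditional probability given by the Markov property may be integrated over
  it.\<close>

lemma markov_rectangle:
  assumes s: "0 \<le> s" and A: "A \<in> sets (heights W)" and B: "B \<in> sets (heights W)"
  shows "emeasure M {w \<in> space M. h 0 w \<in> A \<and> h s w \<in> B} = (\<integral>\<^sup>+x. indicator A x * emeasure (S s x) B \<partial>init)"
proof -
  let ?F = "history M (heights W) h 0"
  let ?A = "h 0 -` A \<inter> space M" and ?B = "h s -` B \<inter> space M"
  have "subalgebra M ?F"
    unfolding subalgebra_def history_def
  proof (intro conjI)
    let ?C = "{h u -` B \<inter> space M |u B. 0 \<le> u \<and> u \<le> 0 \<and> B \<in> sets (heights W)}"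
    have "?C \<subseteq> sets M" by (auto intro: measurable_sets[OF measurable_h])
    moreover have "?C \<subseteq> Pow (space M)" by auto
    ultimately show "sets (sigma (space M) ?C) \<subseteq> sets M"
      using sets.sigma_sets_subset[of ?C M] by (simp add: sets_measure_of)
  qed (simp add: space_measure_of_conv)
  then interpret F: sigma_finite_subalgebra M ?F
    using finite_measure_subalgebra.intro[OF M.finite_measure_axioms]
    by (intro finite_measure_subalgebra_is_sigma_finite) (auto simp: finite_measure_subalgebra_axioms_def)
  have AF: "?A \<in> sets ?F"
    unfolding history_def using A by (subst sets_measure_of) (auto intro!: sigma_sets.Basic)
  have AM: "?A \<in> sets M" and BM: "?B \<in> sets M"
    using measurable_sets[OF measurable_h] A B s by auto
  have mS: "(\<lambda>x. measure (S s x) B) \<in> borel_measurable (heights W)"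
    using measurable_compose[OF kernel[OF s] measurable_measure_prob_algebra[OF B]] .
  have mS': "(\<lambda>w. measure (S s (h 0 w)) B) \<in> borel_measurable M"
    using measurable_compose[OF measurable_h mS] by simp
  have ce: "AE w in M. real_cond_exp M ?F (indicator ?B) w = measure (S s (h 0 w)) B"
  proof -
    have "\<forall>u\<ge>0. \<forall>t\<ge>0. \<forall>B\<in>sets (heights W). AE w in M.
        real_cond_exp M (history M (heights W) h u) (indicator (h (u + t) -` B \<inter> space M)) w = measure (S t (h u w)) B"
      using markov unfolding markov_process_def by blast
    from this[rule_format, of 0 s, OF order_refl s B] show ?thesis by simp
  qed
  have le1: "measure (S s (h 0 w)) B \<le> 1" if "w \<in> space M" for w
    using measurable_space[OF measurable_h[of 0] that] S_prob(1)[OF s, of "h 0 w"]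
    by (auto intro: prob_space.prob_le_1)
  have "(\<integral>w\<in>?A. indicat_real ?B w \<partial>M) = (\<integral>w\<in>?A. real_cond_exp M ?F (indicat_real ?B) w \<partial>M)"
    by (rule F.real_cond_exp_intA[OF _ AF]) (use BM in \<open>simp add: M.emeasure_eq_measure\<close>)
  also have "\<dots> = (\<integral>w\<in>?A. measure (S s (h 0 w)) B \<partial>M)"
    using ce AM mS' by (intro set_lebesgue_integral_cong_AE) auto
  finally have f: "(\<integral>w\<in>?A. indicat_real ?B w \<partial>M) = (\<integral>w\<in>?A. measure (S s (h 0 w)) B \<partial>M)" .
  have "(\<integral>w. indicat_real (?A \<inter> ?B) w \<partial>M) = (\<integral>w\<in>?A. indicat_real ?B w \<partial>M)"
    unfolding set_lebesgue_integral_def by (rule Bochner_Integration.integral_cong) (auto simp: indicator_def)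
  also note f
  also have "(\<integral>w\<in>?A. measure (S s (h 0 w)) B \<partial>M) = (\<integral>w. indicat_real A (h 0 w) * measure (S s (h 0 w)) B \<partial>M)"
    unfolding set_lebesgue_integral_def
    by (rule Bochner_Integration.integral_cong) (auto simp: indicator_def)
  finally have e: "(\<integral>w. indicat_real (?A \<inter> ?B) w \<partial>M) = (\<integral>w. indicat_real A (h 0 w) * measure (S s (h 0 w)) B \<partial>M)" .
  have mA: "(\<lambda>w. indicator A (h 0 w) :: real) \<in> borel_measurable M"
    by (rule measurable_compose[OF measurable_h borel_measurable_indicator[OF A]]) simp
  have "emeasure M {w \<in> space M. h 0 w \<in> A \<and> h s w \<in> B} = emeasure M (?A \<inter> ?B)"
    by (rule arg_cong[where f = "emeasure M"]) auto
  also have "\<dots> = ennreal (\<integral>w. indicator (?A \<inter> ?B) w \<partial>M)"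
    using AM BM by (simp add: M.emeasure_eq_measure)
  also have "\<dots> = (\<integral>\<^sup>+w. ennreal (indicator A (h 0 w) * measure (S s (h 0 w)) B) \<partial>M)"
    unfolding e using le1 mA mS'
    by (intro nn_integral_eq_integral[symmetric] M.integrable_const_bound[where B = 1] AE_I2 borel_measurable_times)
       (auto simp: indicator_def)
  also have "\<dots> = (\<integral>\<^sup>+w. indicator A (h 0 w) * emeasure (S s (h 0 w)) B \<partial>M)"
  proof (rule nn_integral_cong)
    fix w assume "w \<in> space M"
    hence "prob_space (S s (h 0 w))" using measurable_space[OF measurable_h[of 0]] S_prob(1)[OF s] by auto
    then interpret prob_space "S s (h 0 w)" .
    show "ennreal (indicator A (h 0 w) * measure (S s (h 0 w)) B) = indicator A (h 0 w) * emeasure (S s (h 0 w)) B"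
      by (simp add: emeasure_eq_measure indicator_def)
  qed
  also have "\<dots> = (\<integral>\<^sup>+x. indicator A x * emeasure (S s x) B \<partial>init)"
    unfolding init_def using A measurable_emeasure_subprob_algebra[OF B] measurable_prob_algebraD[OF kernel[OF s]]
    by (subst nn_integral_distr[OF measurable_h]) (auto intro!: borel_measurable_times measurable_compose)
  finally show ?thesis .
qed

lemma measurable_pair_h: "0 \<le> s \<Longrightarrow> (\<lambda>w. (h 0 w, h s w)) \<in> M \<rightarrow>\<^sub>M heights W \<Otimes>\<^sub>M heights W"
  by (intro measurable_Pair measurable_h) simp_all

lemma kernel_init: "0 \<le> s \<Longrightarrow> S s \<in> init \<rightarrow>\<^sub>M prob_algebra (heights W)"
  using kernel by (simp cong: measurable_cong_sets)

text \<open>Rectangles determine a law on the product. This is the form in which the Markov property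
  enters what follows: every quantity considered compares time 0 with one later time, and its
  expectation is an iterated integral over the start and over \<open>S s\<close>.\<close>

lemma two_point_law:
  assumes s: "0 \<le> s"
  shows "distr M (heights W \<Otimes>\<^sub>M heights W) (\<lambda>w. (h 0 w, h s w))
    = init \<bind> (\<lambda>x. distr (S s x) (heights W \<Otimes>\<^sub>M heights W) (Pair x))"
proof -
  let ?H = "heights W" and ?HH = "heights W \<Otimes>\<^sub>M heights W"
  let ?K = "\<lambda>x. distr (S s x) ?HH (Pair x)"
  let ?E = "{a \<times> b |a b. a \<in> sets ?H \<and> b \<in> sets ?H}"
  have K: "?K \<in> ?H \<rightarrow>\<^sub>M prob_algebra ?HH"
    using kernel[OF s] by (intro measurable_distr_prob_space2) auto
  have Ki: "?K \<in> init \<rightarrow>\<^sub>M subprob_algebra ?HH"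
    using measurable_prob_algebraD[OF K] by (simp cong: measurable_cong_sets)
  have sb: "sets (init \<bind> ?K) = sets ?HH"
    using sets_bind[of init ?K ?HH] sets_kernel[OF Ki] init.not_empty by auto
  show ?thesis
  proof (rule measure_eqI_generator_eq[OF Int_stable_pair_measure_generator[of ?H ?H] pair_measure_closed])
    show "sets (distr M ?HH (\<lambda>w. (h 0 w, h s w))) = sigma_sets (space ?H \<times> space ?H) ?E"
      by (simp add: sets_pair_measure)
    show "sets (init \<bind> ?K) = sigma_sets (space ?H \<times> space ?H) ?E"
      by (simp only: sb sets_pair_measure)
    show "range (\<lambda>_::nat. space ?H \<times> space ?H) \<subseteq> ?E"
      using sets.top[of ?H] by blast
    show "emeasure (distr M ?HH (\<lambda>w. (h 0 w, h s w))) (space ?H \<times> space ?H) \<noteq> \<infinity>"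
      using measurable_pair_h[OF s]
      by (subst emeasure_distr) (auto simp: space_pair_measure[symmetric] simp del: space_heights)
    fix X assume "X \<in> ?E"
    then obtain A B where X: "X = A \<times> B" "A \<in> sets ?H" "B \<in> sets ?H" by blast
    have "emeasure (distr M ?HH (\<lambda>w. (h 0 w, h s w))) X = emeasure M {w \<in> space M. h 0 w \<in> A \<and> h s w \<in> B}"
      using measurable_pair_h[OF s] X
      by (subst emeasure_distr) (auto intro!: arg_cong[where f = "emeasure M"])
    also have "\<dots> = (\<integral>\<^sup>+x. indicator A x * emeasure (S s x) B \<partial>init)" by (rule markov_rectangle[OF s X(2,3)])
    also have "\<dots> = (\<integral>\<^sup>+x. emeasure (?K x) X \<partial>init)"
    proof (rule nn_integral_cong)
      fix x assume "x \<in> space init"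
      hence x: "slope x \<in> W" by simp
      have "Pair x -` X \<inter> space (S s x) = (if x \<in> A then B else {})"
        using sets.sets_into_space[OF X(3)] by (auto simp: X(1) S_prob[OF s x])
      thus "indicator A x * emeasure (S s x) B = emeasure (?K x) X"
        using X x S_prob(2)[OF s x]
        by (subst emeasure_distr) (auto simp: measurable_Pair1' cong: measurable_cong_sets)
    qed
    also have "\<dots> = emeasure (init \<bind> ?K) X"
      using X by (intro emeasure_bind[symmetric, OF init.not_empty Ki]) auto
    finally show "emeasure (distr M ?HH (\<lambda>w. (h 0 w, h s w))) X = emeasure (init \<bind> ?K) X" .
  qed auto
qed

lemma nn_integral_two_point:
  assumes s: "0 \<le> s" and G: "G \<in> borel_measurable (heights W \<Otimes>\<^sub>M heights W)"
  shows "(\<integral>\<^sup>+w. G (h 0 w, h s w) \<partial>M) = (\<integral>\<^sup>+x. \<integral>\<^sup>+y. G (x, y) \<partial>S s x \<partial>init)"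
proof -
  let ?HH = "heights W \<Otimes>\<^sub>M heights W"
  let ?K = "\<lambda>x. distr (S s x) ?HH (Pair x)"
  have "?K \<in> heights W \<rightarrow>\<^sub>M prob_algebra ?HH"
    using kernel[OF s] by (intro measurable_distr_prob_space2) auto
  hence Ki: "?K \<in> init \<rightarrow>\<^sub>M subprob_algebra ?HH"
    using measurable_prob_algebraD by (simp cong: measurable_cong_sets)
  have "(\<integral>\<^sup>+w. G (h 0 w, h s w) \<partial>M) = (\<integral>\<^sup>+z. G z \<partial>distr M ?HH (\<lambda>w. (h 0 w, h s w)))"
    by (rule nn_integral_distr[symmetric, OF measurable_pair_h[OF s]]) (use G in simp)
  also have "\<dots> = (\<integral>\<^sup>+x. \<integral>\<^sup>+z. G z \<partial>?K x \<partial>init)"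
    unfolding two_point_law[OF s] by (rule nn_integral_bind[OF G Ki])
  also have "\<dots> = (\<integral>\<^sup>+x. \<integral>\<^sup>+y. G (x, y) \<partial>S s x \<partial>init)"
  proof (rule nn_integral_cong)
    fix x assume "x \<in> space init"
    thus "(\<integral>\<^sup>+z. G z \<partial>?K x) = (\<integral>\<^sup>+y. G (x, y) \<partial>S s x)"
      using S_prob(2)[OF s, of x] G by (subst nn_integral_distr) (auto simp: measurable_Pair1' cong: measurable_cong_sets)
  qed
  finally show ?thesis .
qed

lemma integral_two_point:
  fixes G :: "(int \<Rightarrow> int) \<times> (int \<Rightarrow> int) \<Rightarrow> real"
  assumes s: "0 \<le> s" and G: "G \<in> borel_measurable (heights W \<Otimes>\<^sub>M heights W)"
    and int: "integrable M (\<lambda>w. G (h 0 w, h s w))"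
  shows "integrable init (\<lambda>x. \<integral>y. G (x, y) \<partial>S s x)"
    "(\<integral>w. G (h 0 w, h s w) \<partial>M) = (\<integral>x. \<integral>y. G (x, y) \<partial>S s x \<partial>init)"
proof -
  have HH: "sets (init \<Otimes>\<^sub>M heights W) = sets (heights W \<Otimes>\<^sub>M heights W)"
    by (rule sets_pair_measure_cong) simp_all
  have T: "(\<lambda>w. (h 0 w, h s w)) \<in> M \<rightarrow>\<^sub>M init \<Otimes>\<^sub>M heights W"
    using measurable_pair_h[OF s] by (simp add: measurable_cong_sets[OF refl HH])
  have G': "G \<in> borel_measurable (init \<Otimes>\<^sub>M heights W)"
    using G by (simp add: measurable_cong_sets[OF HH refl])
  have dis: "(\<integral>\<^sup>+w. g (h 0 w, h s w) \<partial>M) = (\<integral>\<^sup>+x. \<integral>\<^sup>+y. g (x, y) \<partial>S s x \<partial>init)"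
    if "g \<in> borel_measurable (init \<Otimes>\<^sub>M heights W)" for g
    using that by (intro nn_integral_two_point[OF s]) (simp add: measurable_cong_sets[OF HH refl])
  show "integrable init (\<lambda>x. \<integral>y. G (x, y) \<partial>S s x)"
    "(\<integral>w. G (h 0 w, h s w) \<partial>M) = (\<integral>x. \<integral>y. G (x, y) \<partial>S s x \<partial>init)"
    using integral_disintegration[OF T kernel_init[OF s] dis G' int] by auto
qed

lemma nn_integral_increment_slope:
  assumes s: "0 \<le> s" and G: "G \<in> borel_measurable (conf \<Otimes>\<^sub>M conf)"
  shows "(\<integral>\<^sup>+w. G (slope (h 0 w), increment (h 0 w) (h s w)) \<partial>M) = (\<integral>\<^sup>+x. mean_increment s G x \<partial>init)"
  using nn_integral_two_point[OF s measurable_compose[OF measurable_slope_increment G]]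
  by (simp add: split_beta mean_increment_def)

text \<open>\<open>mean_increment\<close> factors through the slopes, so shifting the start amounts
  to shifting the slope configuration, whose law is a homogeneous product measure.\<close>

lemma nn_integral_mean_increment_shift:
  assumes s: "0 \<le> s" and G: "G \<in> borel_measurable (conf \<Otimes>\<^sub>M conf)"
  shows "(\<integral>\<^sup>+x. mean_increment s G (shift k x) \<partial>init) = (\<integral>\<^sup>+x. mean_increment s G x \<partial>init)"
proof -
  \<comment> \<open>The factorisation through the slopes; the value 0 off \<open>W\<close> is never
    met, since \<open>init\<close> lives on heights with tempered slopes.\<close>
  define \<Gamma> where "\<Gamma> \<omega> = (if \<omega> \<in> W then mean_increment s G (integrate \<omega>) else 0)" for \<omega>
  have \<Gamma>m: "\<Gamma> \<in> borel_measurable conf"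
    unfolding \<Gamma>_def using tempered_sets
    by (subst measurable_restrict_space_iff[symmetric])
       (auto intro: measurable_compose[OF measurable_integrate_heights measurable_mean_increment[OF s G]])
  have \<Gamma>: "mean_increment s G x = \<Gamma> (slope x)" if "slope x \<in> W" for x
    using mean_increment_cong[OF s that G] that by (simp add: \<Gamma>_def)
  have sl: "slope (shift k x) \<in> W" if "slope x \<in> W" for x
    unfolding slope_shift unfolding shift_def by (rule tempered_shift[OF that])
  have "(\<integral>\<^sup>+x. mean_increment s G (shift k x) \<partial>init) = (\<integral>\<^sup>+x. \<Gamma> (shift k (slope x)) \<partial>init)"
    by (intro nn_integral_cong) (simp add: \<Gamma> sl slope_shift[symmetric])
  also have "\<dots> = (\<integral>\<^sup>+\<omega>. \<Gamma> (shift k \<omega>) \<partial>Stat)"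
    unfolding distr_init_slope[symmetric]
    by (subst nn_integral_distr) (auto intro!: measurable_compose[OF measurable_shift \<Gamma>m] cong: measurable_cong_sets)
  also have "\<dots> = (\<integral>\<^sup>+\<omega>. \<Gamma> \<omega> \<partial>distr Stat conf (shift k))"
    by (subst nn_integral_distr) (auto intro!: \<Gamma>m cong: measurable_cong_sets)
  also have "\<dots> = (\<integral>\<^sup>+\<omega>. \<Gamma> \<omega> \<partial>Stat)" by (simp add: distr_Mu_shift[OF theta])
  also have "\<dots> = (\<integral>\<^sup>+x. \<Gamma> (slope x) \<partial>init)"
    unfolding distr_init_slope[symmetric]
    by (subst nn_integral_distr) (auto intro!: \<Gamma>m cong: measurable_cong_sets)
  also have "\<dots> = (\<integral>\<^sup>+x. mean_increment s G x \<partial>init)"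
    by (intro nn_integral_cong) (simp add: \<Gamma>)
  finally show ?thesis .
qed

lemma measurable_slope_increment_h:
  "0 \<le> s \<Longrightarrow> (\<lambda>w. (slope (h 0 w), increment (h 0 w) (h s w))) \<in> M \<rightarrow>\<^sub>M conf \<Otimes>\<^sub>M conf"
  using measurable_compose[OF measurable_pair_h measurable_slope_increment] by simp

lemma measurable_shift_pair: "(\<lambda>(a, b). (shift k a, shift k b)) \<in> conf \<Otimes>\<^sub>M conf \<rightarrow>\<^sub>M conf \<Otimes>\<^sub>M conf"
  by measurable

text \<open>The law of the initial heights need not be shift invariant. The increments are, since their
  transition kernel depends on the initial slopes only.\<close>

lemma shift_invariance:
  assumes s: "0 \<le> s"
  defines "P \<equiv> distr M (conf \<Otimes>\<^sub>M conf) (\<lambda>w. (slope (h 0 w), increment (h 0 w) (h s w)))"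
  shows "distr P (conf \<Otimes>\<^sub>M conf) (\<lambda>(a, b). (shift k a, shift k b)) = P"
proof (rule measure_eqI)
  let ?\<tau> = "\<lambda>(a, b). (shift k a, shift k b)"
  fix A assume "A \<in> sets (distr P (conf \<Otimes>\<^sub>M conf) ?\<tau>)"
  hence A: "A \<in> sets (conf \<Otimes>\<^sub>M conf)" by simp
  have iA: "(indicator A :: _ \<Rightarrow> ennreal) \<in> borel_measurable (conf \<Otimes>\<^sub>M conf)" using A by simp
  have iA': "(\<lambda>(a, b). indicator A (shift k a, shift k b) :: ennreal) \<in> borel_measurable (conf \<Otimes>\<^sub>M conf)"
    using measurable_compose[OF measurable_shift_pair[of k] iA] by (simp add: split_beta)
  have "emeasure (distr P (conf \<Otimes>\<^sub>M conf) ?\<tau>) A = (\<integral>\<^sup>+z. indicator A z \<partial>distr P (conf \<Otimes>\<^sub>M conf) ?\<tau>)"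
    using A by simp
  also have "\<dots> = (\<integral>\<^sup>+z. indicator A (?\<tau> z) \<partial>P)"
    unfolding P_def by (rule nn_integral_distr) (use measurable_shift_pair iA in \<open>simp_all cong: measurable_cong_sets\<close>)
  also have "\<dots> = (\<integral>\<^sup>+w. indicator A (?\<tau> (slope (h 0 w), increment (h 0 w) (h s w))) \<partial>M)"
    unfolding P_def
    by (rule nn_integral_distr[OF measurable_slope_increment_h[OF s]]) (use iA' in \<open>simp add: split_beta\<close>)
  also have "\<dots> = (\<integral>\<^sup>+x. mean_increment s (\<lambda>(a, b). indicator A (shift k a, shift k b)) x \<partial>init)"
    using nn_integral_increment_slope[OF s iA'] by simp
  also have "\<dots> = (\<integral>\<^sup>+x. mean_increment s (indicator A) (shift k x) \<partial>init)"
    by (intro nn_integral_cong) (simp add: mean_increment_shift[OF s _ iA])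
  also have "\<dots> = (\<integral>\<^sup>+x. mean_increment s (indicator A) x \<partial>init)"
    by (rule nn_integral_mean_increment_shift[OF s iA])
  also have "\<dots> = (\<integral>\<^sup>+w. indicator A (slope (h 0 w), increment (h 0 w) (h s w)) \<partial>M)"
    by (rule nn_integral_increment_slope[OF s iA, symmetric])
  also have "\<dots> = (\<integral>\<^sup>+z. indicator A z \<partial>P)"
    unfolding P_def by (rule nn_integral_distr[OF measurable_slope_increment_h[OF s], symmetric]) (use iA in simp)
  also have "\<dots> = emeasure P A" using A by (simp add: P_def)
  finally show "emeasure (distr P (conf \<Otimes>\<^sub>M conf) ?\<tau>) A = emeasure P A" .
qed (simp add: P_def)

text \<open>Averaging the kernel over the initial law gives the law at time \<open>s\<close>. The
  assumed stationarity prescribes the slopes of \<open>\<nu>\<close> alone, so it covers an initial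
  law with arbitrary overall height.\<close>

lemma stationary_slope:
  assumes s: "0 \<le> s"
  shows "distr M conf (\<lambda>w. slope (h s w)) = Stat"
proof -
  have "distr M (heights W) (h s) = init \<bind> S s"
  proof (rule measure_eqI)
    have sb: "sets (init \<bind> S s) = sets (heights W)"
      using init.prob_space_axioms kernel[OF s] by (intro sets_bind') (auto simp: space_prob_algebra)
    thus "sets (distr M (heights W) (h s)) = sets (init \<bind> S s)" by simp
    fix A assume "A \<in> sets (distr M (heights W) (h s))"
    hence A: "A \<in> sets (heights W)" by simp
    have "emeasure (distr M (heights W) (h s)) A = (\<integral>\<^sup>+w. indicator A (h s w) \<partial>M)"
      using A nn_integral_distr[OF measurable_h[OF s], of "indicator A"] by simp
    also have "\<dots> = (\<integral>\<^sup>+x. \<integral>\<^sup>+y. indicator A y \<partial>S s x \<partial>init)"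
      using nn_integral_two_point[OF s, of "\<lambda>z. indicator A (snd z)"] A by simp
    also have "\<dots> = (\<integral>\<^sup>+x. emeasure (S s x) A \<partial>init)"
      using A by (intro nn_integral_cong) (simp add: S_prob[OF s])
    also have "\<dots> = emeasure (init \<bind> S s) A"
      using A measurable_prob_algebraD[OF kernel_init[OF s]] by (intro emeasure_bind[symmetric] init.not_empty) auto
    finally show "emeasure (distr M (heights W) (h s)) A = emeasure (init \<bind> S s) A" .
  qed
  moreover have "distr (init \<bind> S s) conf slope = Stat"
    using init.prob_space_axioms
    by (intro stationary[OF theta s] distr_init_slope) (simp add: space_prob_algebra)
  moreover have "distr (distr M (heights W) (h s)) conf slope = distr M conf (\<lambda>w. slope (h s w))"
    by (subst distr_distr[OF _ measurable_h[OF s]]) (simp_all add: o_def)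
  ultimately show ?thesis by simp
qed

end

section \<open>The Dynkin formula under the stationary law\<close>

text \<open>Clamping, rather than cutting off to 0, keeps the truncation monotone and 1-Lipschitz: a
  unit jump changes a clipped height by at most 1, and attractivity applies to clipped
  spins.\<close>

definition clip :: "nat \<Rightarrow> real \<Rightarrow> real" where
  "clip K a = max (- real K) (min (real K) a)"

lemma clip_abs_le: "\<bar>clip K a\<bar> \<le> real K" "\<bar>clip K a\<bar> \<le> \<bar>a\<bar>"
  by (auto simp: clip_def)

lemma clip_diff_le: "\<bar>clip K a - clip K b\<bar> \<le> \<bar>a - b\<bar>"
  by (auto simp: clip_def)

lemma clip_eq: "\<bar>a\<bar> \<le> real K \<Longrightarrow> clip K a = a"
  by (auto simp: clip_def)

lemma clip_zero [simp]: "clip K 0 = 0"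
  by (simp add: clip_def)

lemma measurable_clip [measurable]: "clip K \<in> borel_measurable borel"
  unfolding clip_def[abs_def] by measurable

lemma clip_tendsto: "(\<lambda>K. clip K a) \<longlonglongrightarrow> a"
proof (rule tendsto_eventually)
  obtain N :: nat where "\<bar>a\<bar> \<le> real N" using real_arch_simple by blast
  thus "\<forall>\<^sub>F K in sequentially. clip K a = a"
    by (auto intro!: eventually_sequentiallyI[of N] clip_eq)
qed

lemma clip_step_tendsto: "(\<lambda>K. clip K (real_of_int (a + e)) - clip K (real_of_int a)) \<longlonglongrightarrow> real_of_int e"
  using tendsto_diff[OF clip_tendsto clip_tendsto, of "real_of_int (a + e)" "real_of_int a"] by simp

lemma clip_step_le: "\<bar>clip K (real_of_int (a + 1)) - clip K (real_of_int a)\<bar> \<le> 1"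
  using clip_diff_le[of K "real_of_int (a + 1)" "real_of_int a"] by simp

lemma half_square_sum: "a * b \<le> (a\<^sup>2 + b\<^sup>2) / 2" for a b :: real
  using zero_le_power2[of "a - b"] by (simp add: power2_diff)

context deposition_dynamics
begin

definition pair_gen :: "int \<Rightarrow> int \<Rightarrow> ((int \<Rightarrow> int) \<Rightarrow> int \<Rightarrow> int \<Rightarrow> real) \<Rightarrow> (int \<Rightarrow> int) \<times> (int \<Rightarrow> int) \<Rightarrow> real" where
  "pair_gen i j F = (\<lambda>(x, y).
     p (slope y i) (slope y (i + 1)) * (F x (increment x y i + 1) (increment x y j) - F x (increment x y i) (increment x y j)) +
     q (slope y i) (slope y (i + 1)) * (F x (increment x y i - 1) (increment x y j) - F x (increment x y i) (increment x y j)) +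
     p (slope y j) (slope y (j + 1)) * (F x (increment x y i) (increment x y j + 1) - F x (increment x y i) (increment x y j)) +
     q (slope y j) (slope y (j + 1)) * (F x (increment x y i) (increment x y j - 1) - F x (increment x y i) (increment x y j)))"

lemma gen_pair:
  assumes ij: "i \<noteq> j"
  shows "gen p q (\<lambda>y. F x (increment x y i) (increment x y j)) y = pair_gen i j F (x, y)"
proof -
  have inf: "(\<Sum>\<^sub>\<infinity>k\<in>UNIV. g k) = g i + g j" if "\<And>k. k \<noteq> i \<Longrightarrow> k \<noteq> j \<Longrightarrow> g k = 0" for g :: "int \<Rightarrow> real"
  proof -
    have "(\<Sum>\<^sub>\<infinity>k\<in>UNIV. g k) = (\<Sum>\<^sub>\<infinity>k\<in>{i, j}. g k)"
      by (rule infsum_cong_neutral) (use that in auto)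
    thus ?thesis using ij by simp
  qed
  show ?thesis unfolding gen_def pair_gen_def
    by (subst inf, use ij in \<open>simp add: increment_def\<close>)+
       (use ij in \<open>simp add: increment_def algebra_simps\<close>)
qed

text \<open>Absolute values are taken because the rates are known to be nonnegative only at
  admissible spins, while the bounds below are pointwise.\<close>

definition total_rate :: "int \<Rightarrow> (int \<Rightarrow> int) \<Rightarrow> real" where
  "total_rate i \<omega> = \<bar>p (\<omega> i) (\<omega> (i + 1))\<bar> + \<bar>q (\<omega> i) (\<omega> (i + 1))\<bar>"

lemma measurable_total_rate [measurable]: "total_rate i \<in> borel_measurable conf"
  unfolding total_rate_def[abs_def] by (rule measurable_int_binary) auto

lemma pair_gen_bound:
  assumes "\<And>a b. \<bar>F x (a + 1) b - F x a b\<bar> \<le> B" "\<And>a b. \<bar>F x a (b + 1) - F x a b\<bar> \<le> B'"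
  shows "\<bar>pair_gen i j F (x, y)\<bar> \<le> total_rate i (slope y) * B + total_rate j (slope y) * B'"
proof -
  have m: "\<bar>F x (a - 1) b - F x a b\<bar> \<le> B" "\<bar>F x a (b - 1) - F x a b\<bar> \<le> B'" for a b
    using assms(1)[of "a - 1" b] assms(2)[of a "b - 1"] by simp_all
  have le: "\<bar>r * d\<bar> \<le> \<bar>r\<bar> * C" if "\<bar>d\<bar> \<le> C" for r d C :: real
    using that by (simp add: abs_mult mult_left_mono)
  let ?a = "increment x y i" and ?b = "increment x y j"
  have "\<bar>pair_gen i j F (x, y)\<bar> \<le> \<bar>p (slope y i) (slope y (i + 1))\<bar> * B + \<bar>q (slope y i) (slope y (i + 1))\<bar> * B
      + \<bar>p (slope y j) (slope y (j + 1))\<bar> * B' + \<bar>q (slope y j) (slope y (j + 1))\<bar> * B'"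
    unfolding pair_gen_def prod.case
    by (intro order_trans[OF abs_triangle_ineq] add_mono le assms m)
  thus ?thesis by (simp add: total_rate_def algebra_simps)
qed

lemma measurable_increment_at: "(\<lambda>z. increment (fst z) (snd z) i) \<in> heights W \<Otimes>\<^sub>M heights W \<rightarrow>\<^sub>M count_space UNIV"
  unfolding increment_def
  by (rule measurable_int_binary[where F = "(-)", OF measurable_compose[OF measurable_snd measurable_heights_component]
        measurable_compose[OF measurable_fst measurable_heights_component]]) simp

lemma measurable_snd_slope: "(\<lambda>z. slope (snd z) i) \<in> heights W \<Otimes>\<^sub>M heights W \<rightarrow>\<^sub>M count_space UNIV"
  by (rule measurable_compose[OF measurable_compose[OF measurable_snd measurable_heights_slope] measurable_conf_component])

lemma measurable_F_disp:
  assumes "\<And>a b. (\<lambda>x. F x a b) \<in> borel_measurable (heights W)"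
  shows "(\<lambda>z. F (fst z) (u (increment (fst z) (snd z) i)) (v (increment (fst z) (snd z) j))) \<in> borel_measurable (heights W \<Otimes>\<^sub>M heights W)"
proof (rule measurable_compose_countable[OF _ measurable_increment_at[of i]])
  fix a
  show "(\<lambda>z. F (fst z) (u a) (v (increment (fst z) (snd z) j))) \<in> borel_measurable (heights W \<Otimes>\<^sub>M heights W)"
    by (rule measurable_compose_countable[OF _ measurable_increment_at[of j]])
       (rule measurable_compose[OF measurable_fst assms])
qed

lemma measurable_pair_gen:
  assumes F: "\<And>a b. (\<lambda>x. F x a b) \<in> borel_measurable (heights W)"
  shows "pair_gen i j F \<in> borel_measurable (heights W \<Otimes>\<^sub>M heights W)"
proof -
  have r: "(\<lambda>z. g (slope (snd z) k) (slope (snd z) (k + 1))) \<in> borel_measurable (heights W \<Otimes>\<^sub>M heights W)"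
    for g :: "int \<Rightarrow> int \<Rightarrow> real" and k
    by (rule measurable_int_binary[OF measurable_snd_slope measurable_snd_slope]) simp
  note F' = measurable_F_disp[OF F, where u = "\<lambda>a. a" and v = "\<lambda>b. b"]
    measurable_F_disp[OF F, where u = "\<lambda>a. a + 1" and v = "\<lambda>b. b"] measurable_F_disp[OF F, where u = "\<lambda>a. a - 1" and v = "\<lambda>b. b"]
    measurable_F_disp[OF F, where u = "\<lambda>a. a" and v = "\<lambda>b. b + 1"] measurable_F_disp[OF F, where u = "\<lambda>a. a" and v = "\<lambda>b. b - 1"]
  show ?thesis
    unfolding pair_gen_def split_beta
    by (intro borel_measurable_add borel_measurable_times borel_measurable_diff F' r[of p i] r[of q i] r[of p j] r[of q j])
qed

end

context stationary_dynamics
begin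

lemma measurable_slope_h: "0 \<le> s \<Longrightarrow> (\<lambda>w. slope (h s w)) \<in> M \<rightarrow>\<^sub>M conf"
  using measurable_compose[OF measurable_h measurable_heights_slope] .

lemma measurable_Stat: "X \<in> borel_measurable conf \<Longrightarrow> X \<in> borel_measurable Stat"
  by (simp cong: measurable_cong_sets)

lemma square_integrable_slope_iff:
  assumes "0 \<le> s" "X \<in> borel_measurable conf"
  shows "square_integrable M (\<lambda>w. X (slope (h s w))) \<longleftrightarrow> square_integrable Stat X"
  using square_integrable_distr_iff[OF measurable_slope_h assms(2)] assms by (simp add: stationary_slope)

lemma expectation_slope:
  fixes X :: "(int \<Rightarrow> int) \<Rightarrow> real"
  assumes "0 \<le> s" "X \<in> borel_measurable conf"
  shows "M.expectation (\<lambda>w. X (slope (h s w))) = Mu.expectation X"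
  using integral_distr[OF measurable_slope_h assms(2)] assms by (simp add: stationary_slope)

lemma cov_slope:
  assumes "0 \<le> s" "X \<in> borel_measurable conf" "Y \<in> borel_measurable conf"
  shows "cov M (\<lambda>w. X (slope (h s w))) (\<lambda>w. Y (slope (h s w))) = cov Stat X Y"
  using cov_distr[OF measurable_slope_h assms(2,3)] assms by (simp add: stationary_slope)

lemma square_integrable_total_rate: "square_integrable Stat (total_rate i)"
proof (rule Mu.square_integrable_bound[OF _ measurable_Stat[OF measurable_total_rate]])
  show "square_integrable Stat (\<lambda>\<omega>. \<bar>p (\<omega> i) (\<omega> (i + 1))\<bar> + \<bar>q (\<omega> i) (\<omega> (i + 1))\<bar>)"
    by (intro Mu.square_integrable_add square_integrable_abs square_integrable_rate[OF theta])
qed (simp add: total_rate_def)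

lemma square_integrable_total_rate_h: "0 \<le> s \<Longrightarrow> square_integrable M (\<lambda>w. total_rate i (slope (h s w)))"
  using square_integrable_total_rate by (subst square_integrable_slope_iff) auto

lemma measurable_pair_max: "(\<lambda>(s, x). S (max 0 s) x) \<in> lborel \<Otimes>\<^sub>M init \<rightarrow>\<^sub>M subprob_algebra (heights W)"
  using measurable_prob_algebraD[OF measurable_kernel_joint]
  by (simp cong: measurable_cong_sets sets_pair_measure_cong
      add: measurable_cong_sets[OF sets_pair_measure_cong[OF sets_lborel sets_init] refl])

lemma measurable_kernel_integral:
  fixes G :: "(int \<Rightarrow> int) \<times> (int \<Rightarrow> int) \<Rightarrow> real"
  assumes G: "G \<in> borel_measurable (heights W \<Otimes>\<^sub>M heights W)"
  shows "(\<lambda>(s, x). \<integral>y. G (x, y) \<partial>S (max 0 s) x) \<in> borel_measurable (lborel \<Otimes>\<^sub>M init)"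
proof -
  have "(\<lambda>z. (snd (fst z), snd z)) \<in> (lborel \<Otimes>\<^sub>M init) \<Otimes>\<^sub>M heights W \<rightarrow>\<^sub>M heights W \<Otimes>\<^sub>M heights W"
    by (rule measurable_Pair)
       (auto intro!: measurable_compose[OF measurable_fst] simp: measurable_cong_sets[OF refl sets_init[symmetric]])
  from measurable_compose[OF this G]
  have "(\<lambda>(z, y). G (snd z, y)) \<in> borel_measurable ((lborel \<Otimes>\<^sub>M init) \<Otimes>\<^sub>M heights W)"
    by (simp add: case_prod_beta')
  from integral_measurable_subprob_algebra2[OF this measurable_pair_max]
  show ?thesis by (simp add: split_beta)
qed

text \<open>For each fixed time \<open>h s\<close> is measurable on the sample space, which says
  nothing about dependence on \<open>s\<close>. Writing the expectation through the jointly
  measurable kernel makes it measurable in time.\<close>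

lemma measurable_expectation_time:
  fixes G :: "(int \<Rightarrow> int) \<times> (int \<Rightarrow> int) \<Rightarrow> real"
  assumes G: "G \<in> borel_measurable (heights W \<Otimes>\<^sub>M heights W)"
    and int: "\<And>s. 0 \<le> s \<Longrightarrow> s \<le> t \<Longrightarrow> integrable M (\<lambda>w. G (h 0 w, h s w))"
  shows "(\<lambda>s. indicator {0..t} s * M.expectation (\<lambda>w. G (h 0 w, h s w))) \<in> borel_measurable lborel"
proof -
  have "(\<lambda>s. \<integral>x. \<integral>y. G (x, y) \<partial>S (max 0 s) x \<partial>init) \<in> borel_measurable lborel"
    using init.borel_measurable_lebesgue_integral[OF measurable_kernel_integral[OF G]] by simp
  hence "(\<lambda>s. indicator {0..t} s * (\<integral>x. \<integral>y. G (x, y) \<partial>S (max 0 s) x \<partial>init)) \<in> borel_measurable lborel"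
    by measurable
  moreover have "indicator {0..t} s * M.expectation (\<lambda>w. G (h 0 w, h s w))
      = indicator {0..t} s * (\<integral>x. \<integral>y. G (x, y) \<partial>S (max 0 s) x \<partial>init)" for s
    using integral_two_point(2)[OF _ G int] by (auto simp: indicator_def max_def)
  ultimately show ?thesis by (simp only:)
qed

text \<open>For each start \<open>x\<close> the Dynkin formula applies to the bounded cylinder
  function obtained by freezing \<open>x\<close> in \<open>F\<close>; the result is then averaged
  over the initial law. The generator term is at most \<open>2 * B\<close> times the total rates,
  whose means do not depend on time by stationarity.\<close>

lemma dynkin_stationary:
  fixes F :: "(int \<Rightarrow> int) \<Rightarrow> int \<Rightarrow> int \<Rightarrow> real"
  assumes ij: "i \<noteq> j" and t: "0 \<le> t"
    and F: "\<And>a b. (\<lambda>x. F x a b) \<in> borel_measurable (heights W)"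
    and B: "\<And>x a b. \<bar>F x a b\<bar> \<le> B"
  shows "M.expectation (\<lambda>w. F (h 0 w) (increment (h 0 w) (h t w) i) (increment (h 0 w) (h t w) j))
      = M.expectation (\<lambda>w. F (h 0 w) 0 0) + (LINT s:{0..t}|lborel. M.expectation (\<lambda>w. pair_gen i j F (h 0 w, h s w)))" (is ?A)
    "set_integrable lborel {0..t} (\<lambda>s. M.expectation (\<lambda>w. pair_gen i j F (h 0 w, h s w)))" (is ?B)
    "0 \<le> s \<Longrightarrow> integrable M (\<lambda>w. pair_gen i j F (h 0 w, h s w))" (is "_ \<Longrightarrow> ?C s")
proof -
  let ?\<phi> = "\<lambda>x y. F x (increment x y i) (increment x y j)" and ?G = "pair_gen i j F"
  have Gm: "?G \<in> borel_measurable (heights W \<Otimes>\<^sub>M heights W)" by (rule measurable_pair_gen[OF F])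
  have Bd: "\<bar>F x a b - F x c d\<bar> \<le> 2 * B" for x a b c d
    using B[of x a b] B[of x c d] by linarith
  have Gb: "\<bar>?G (x, y)\<bar> \<le> 2 * B * (total_rate i (slope y) + total_rate j (slope y))" for x y
    using pair_gen_bound[of F x "2 * B" "2 * B" i j y] Bd by (simp add: algebra_simps)
  have Ri: "integrable M (\<lambda>w. 2 * B * (total_rate i (slope (h s w)) + total_rate j (slope (h s w))))" if "0 \<le> s" for s
    using M.square_integrable_integrable[OF square_integrable_total_rate_h[OF that]] by auto
  show C: "?C s" if "0 \<le> s" for s
  proof (rule Bochner_Integration.integrable_bound[OF Ri[OF that]])
    show "(\<lambda>w. ?G (h 0 w, h s w)) \<in> borel_measurable M"
      using measurable_compose[OF measurable_pair_h[OF that] Gm] .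
    show "AE w in M. norm (?G (h 0 w, h s w)) \<le> norm (2 * B * (total_rate i (slope (h s w)) + total_rate j (slope (h s w))))"
      by (rule AE_I2) (simp only: real_norm_def, rule order_trans[OF Gb abs_ge_self])
  qed
  define c where "c = 2 * B * (Mu.expectation (total_rate i) + Mu.expectation (total_rate j))"
  have ER: "M.expectation (\<lambda>w. 2 * B * (total_rate i (slope (h s w)) + total_rate j (slope (h s w)))) = c" if "0 \<le> s" for s
    using M.square_integrable_integrable[OF square_integrable_total_rate_h[OF that]]
    by (simp add: c_def expectation_slope[OF that])
  define u where "u s x = (\<integral>y. ?G (x, y) \<partial>S (max 0 s) x)" for s x
  let ?g = "\<lambda>(s, x). indicator {0..t} s * u s x"
  interpret P: pair_sigma_finite lborel init ..
  have um: "(\<lambda>(s, x). u s x) \<in> borel_measurable (lborel \<Otimes>\<^sub>M init)"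
    unfolding u_def by (rule measurable_kernel_integral[OF Gm])
  have gm: "?g \<in> borel_measurable (lborel \<Otimes>\<^sub>M init)"
    using um by (auto simp: split_beta intro!: borel_measurable_times measurable_compose[OF measurable_fst])
  \<comment> \<open>The hypothesis of Fubini's theorem: the absolute integral over
    \<open>{0..t}\<close> and the starts is at most \<open>t * c\<close>.\<close>
  have gint: "integrable (lborel \<Otimes>\<^sub>M init) ?g"
  proof (rule integrableI_bounded[OF gm])
    have "(\<integral>\<^sup>+z. ennreal (norm (?g z)) \<partial>(lborel \<Otimes>\<^sub>M init)) = (\<integral>\<^sup>+s. \<integral>\<^sup>+x. ennreal (norm (?g (s, x))) \<partial>init \<partial>lborel)"
      using gm by (intro init.nn_integral_fst[symmetric]) auto
    also have "\<dots> \<le> (\<integral>\<^sup>+s. ennreal c * indicator {0..t} s \<partial>lborel)"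
    proof (rule nn_integral_mono)
      fix s :: real
      show "(\<integral>\<^sup>+x. ennreal (norm (?g (s, x))) \<partial>init) \<le> ennreal c * indicator {0..t} s"
      proof (cases "s \<in> {0..t}")
        case True
        hence s: "0 \<le> s" "max 0 s = s" by auto
        have "(\<integral>\<^sup>+x. ennreal (norm (?g (s, x))) \<partial>init) = (\<integral>\<^sup>+x. ennreal (norm (\<integral>y. ?G (x, y) \<partial>S s x)) \<partial>init)"
          using True by (simp add: u_def s)
        also have "\<dots> \<le> (\<integral>\<^sup>+x. \<integral>\<^sup>+y. ennreal (norm (?G (x, y))) \<partial>S s x \<partial>init)"
        proof (rule nn_integral_mono)
          fix x
          show "ennreal (norm (\<integral>y. ?G (x, y) \<partial>S s x)) \<le> (\<integral>\<^sup>+y. ennreal (norm (?G (x, y))) \<partial>S s x)"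
          proof (cases "integrable (S s x) (\<lambda>y. ?G (x, y))")
            case True thus ?thesis by (rule integral_norm_bound_ennreal)
          next
            case False thus ?thesis by (simp add: not_integrable_integral_eq)
          qed
        qed
        also have "\<dots> = (\<integral>\<^sup>+w. ennreal (norm (?G (h 0 w, h s w))) \<partial>M)"
          using nn_integral_two_point[OF s(1), of "\<lambda>z. ennreal (norm (?G z))"] Gm by simp
        also have "\<dots> \<le> (\<integral>\<^sup>+w. ennreal (2 * B * (total_rate i (slope (h s w)) + total_rate j (slope (h s w)))) \<partial>M)"
          by (intro nn_integral_mono ennreal_leI) (simp add: Gb)
        also have "\<dots> = ennreal c"
          using ER[OF s(1)] Ri[OF s(1)] abs_ge_zero[THEN order_trans, OF Gb]
          by (subst nn_integral_eq_integral) auto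
        finally show ?thesis using True by simp
      qed simp
    qed
    also have "\<dots> < \<infinity>" using t by (simp add: nn_integral_cmult_indicator ennreal_mult_less_top)
    finally show "(\<integral>\<^sup>+z. ennreal (norm (?g z)) \<partial>(lborel \<Otimes>\<^sub>M init)) < \<infinity>" .
  qed
  have us: "(\<integral>x. u s x \<partial>init) = M.expectation (\<lambda>w. ?G (h 0 w, h s w))" if "0 \<le> s" for s
    using integral_two_point(2)[OF that Gm C[OF that]] that by (simp add: u_def)
  have sl: "indicator {0..t} s *\<^sub>R M.expectation (\<lambda>w. ?G (h 0 w, h s w)) = (\<integral>x. indicator {0..t} s * u s x \<partial>init)" for s
    using us by (cases "s \<in> {0..t}") auto
  show ?B
    unfolding set_integrable_def sl using P.integrable_fst'[OF gint] by simp
  have Fint: "integrable M (\<lambda>w. ?\<phi> (h 0 w) (h t w))" and Fm: "(\<lambda>z. ?\<phi> (fst z) (snd z)) \<in> borel_measurable (heights W \<Otimes>\<^sub>M heights W)"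
  proof -
    show m: "(\<lambda>z. ?\<phi> (fst z) (snd z)) \<in> borel_measurable (heights W \<Otimes>\<^sub>M heights W)"
      using measurable_F_disp[OF F, where u = "\<lambda>a. a" and i = i and v = "\<lambda>b. b" and j = j] .
    show "integrable M (\<lambda>w. ?\<phi> (h 0 w) (h t w))"
      using measurable_compose[OF measurable_pair_h[OF t] m] B
      by (intro M.integrable_const_bound[where B = B]) auto
  qed
  have dyn: "(\<integral>y. ?\<phi> x y \<partial>S t x) = F x 0 0 + (\<integral>s. indicator {0..t} s * u s x \<partial>lborel)" if x: "slope x \<in> W" for x
  proof -
    have cyl: "cylinder (?\<phi> x)" unfolding cylinder_def
      by (intro exI[of _ "{i, j}"]) (auto simp: increment_def)
    have bdd: "bounded (range (?\<phi> x))" by (rule boundedI[of _ B]) (use B in auto)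
    have "(\<integral>y. ?\<phi> x y \<partial>S t x) = F x 0 0 + (LINT s:{0..t}|lborel. \<integral>y. ?G (x, y) \<partial>S s x)"
    proof -
      have "gen p q (?\<phi> x) = (\<lambda>y. ?G (x, y))" by (rule ext, rule gen_pair[OF ij])
      moreover have "?\<phi> x x = F x 0 0" by (simp add: increment_def)
      ultimately show ?thesis using dynkin[OF cyl bdd t x] by (simp only:)
    qed
    also have "(LINT s:{0..t}|lborel. \<integral>y. ?G (x, y) \<partial>S s x) = (\<integral>s. indicator {0..t} s * u s x \<partial>lborel)"
      unfolding set_lebesgue_integral_def u_def
      by (rule Bochner_Integration.integral_cong) (auto simp: indicator_def max_def)
    finally show ?thesis .
  qed
  have i1: "integrable init (\<lambda>x. F x 0 0)"
    using F[of 0 0] B by (intro init.integrable_const_bound[where B = B]) (auto cong: measurable_cong_sets)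
  have i2: "integrable init (\<lambda>x. \<integral>s. indicator {0..t} s * u s x \<partial>lborel)"
    using P.integrable_snd[OF gint] by simp
  have "M.expectation (\<lambda>w. ?\<phi> (h 0 w) (h t w)) = (\<integral>x. \<integral>y. ?\<phi> x y \<partial>S t x \<partial>init)"
    using integral_two_point(2)[OF t Fm] Fint by simp
  also have "\<dots> = (\<integral>x. F x 0 0 + (\<integral>s. indicator {0..t} s * u s x \<partial>lborel) \<partial>init)"
    by (rule Bochner_Integration.integral_cong) (simp_all add: dyn)
  also have "\<dots> = (\<integral>x. F x 0 0 \<partial>init) + (\<integral>x. \<integral>s. indicator {0..t} s * u s x \<partial>lborel \<partial>init)"
    by (rule Bochner_Integration.integral_add[OF i1 i2])
  also have "(\<integral>x. F x 0 0 \<partial>init) = M.expectation (\<lambda>w. F (h 0 w) 0 0)"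
    unfolding init_def by (rule integral_distr[OF measurable_h F]) simp
  also have "(\<integral>x. \<integral>s. indicator {0..t} s * u s x \<partial>lborel \<partial>init) = (\<integral>s. \<integral>x. indicator {0..t} s * u s x \<partial>init \<partial>lborel)"
    using P.Fubini_integral[of "\<lambda>s x. indicator {0..t} s * u s x"] gint by simp
  also have "\<dots> = (LINT s:{0..t}|lborel. M.expectation (\<lambda>w. ?G (h 0 w, h s w)))"
    unfolding set_lebesgue_integral_def sl ..
  finally show ?A .
qed

section \<open>Second moments of the height increments and the Dynkin formula for products\<close>

definition rise :: "int \<Rightarrow> real \<Rightarrow> 'a \<Rightarrow> real" where
  "rise i s w = real_of_int (increment (h 0 w) (h s w) i)"

text \<open>The generator applied to the height at site \<open>i\<close>, that is, its instantaneous
  drift.\<close>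

definition net :: "int \<Rightarrow> (int \<Rightarrow> int) \<Rightarrow> real" where
  "net i \<omega> = p (\<omega> i) (\<omega> (i + 1)) - q (\<omega> i) (\<omega> (i + 1))"

definition flux :: "int \<Rightarrow> real \<Rightarrow> 'a \<Rightarrow> real" where
  "flux i s w = net i (slope (h s w))"

lemma measurable_increment_at_real: "(\<lambda>z. real_of_int (increment (fst z) (snd z) i)) \<in> borel_measurable (heights W \<Otimes>\<^sub>M heights W)"
  by (rule measurable_compose[OF measurable_increment_at]) simp

lemma measurable_rise [measurable]: "0 \<le> s \<Longrightarrow> rise i s \<in> borel_measurable M"
  using measurable_compose[OF measurable_pair_h measurable_increment_at_real] by (simp add: rise_def[abs_def])

lemma measurable_net [measurable]: "net i \<in> borel_measurable conf"
  unfolding net_def[abs_def] by (rule measurable_int_binary) auto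

lemma net_abs_le: "\<bar>net i \<omega>\<bar> \<le> total_rate i \<omega>"
  by (simp add: net_def total_rate_def)

lemma square_integrable_net: "square_integrable Stat (net i)"
  by (rule Mu.square_integrable_bound[OF square_integrable_total_rate measurable_Stat[OF measurable_net]])
     (use net_abs_le in \<open>force intro: order_trans[OF _ abs_ge_self]\<close>)

lemma square_integrable_flux: "0 \<le> s \<Longrightarrow> square_integrable M (flux i s)"
  using square_integrable_net by (simp add: flux_def[abs_def] square_integrable_slope_iff)

text \<open>The bound is uniform in the truncation level \<open>K\<close>: with \<open>U\<close> the supremum over \<open>[0, T]\<close> of the
  left-hand side, the Dynkin formula gives \<open>U \<le> T \<rho> + U / 2\<close>.\<close>

lemma truncated_second_moment_le:
  fixes i :: int and T t :: real and K :: nat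
  assumes T: "0 < T"
  defines "\<rho> \<equiv> Mu.expectation (\<lambda>\<omega>. total_rate i \<omega> + 2 * T * (total_rate i \<omega>)\<^sup>2)"
  assumes t: "0 \<le> t" "t \<le> T"
  shows "M.expectation (\<lambda>w. (clip K (rise i t w))\<^sup>2) \<le> 2 * T * \<rho>"
proof -
  define u where "u s = M.expectation (\<lambda>w. (clip K (rise i s w))\<^sup>2)" for s
  define U where "U = (SUP s\<in>{0..T}. u s)"
  have sq: "(clip K a)\<^sup>2 \<le> (real K)\<^sup>2" for a using clip_abs_le(1)[of K a] by (simp add: abs_le_square_iff[symmetric])
  have int: "integrable M (\<lambda>w. (clip K (rise i s w))\<^sup>2)" if "0 \<le> s" for s
    using sq that by (intro M.integrable_const_bound[where B = "(real K)\<^sup>2"]) auto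
  have uK: "u s \<le> (real K)\<^sup>2" if "0 \<le> s" for s
    unfolding u_def using integral_mono[OF int[OF that], of "\<lambda>_. (real K)\<^sup>2"] sq by (simp add: M.prob_space)
  \<comment> \<open>Truncation makes the supremum \<open>U\<close> finite, so that
    \<open>U / 2\<close> can later be absorbed into \<open>U\<close>.\<close>
  have bdd: "bdd_above (u ` {0..T})" by (rule bdd_aboveI[of _ "(real K)\<^sup>2"]) (use uK in auto)
  have uU: "u s \<le> U" if "0 \<le> s" "s \<le> T" for s
    unfolding U_def using that by (intro cSUP_upper bdd) auto
  let ?F = "\<lambda>(x :: int \<Rightarrow> int) (a :: int) (b :: int). (clip K (real_of_int a))\<^sup>2"
  let ?G = "pair_gen i (i + 1) ?F"
  have F: "(\<lambda>x. ?F x a b) \<in> borel_measurable (heights W)" "\<bar>?F x a b\<bar> \<le> (real K)\<^sup>2" for a b x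
    using sq by auto
  \<comment> \<open>The function ignores its second increment; \<open>i + 1\<close> merely provides
    a site different from \<open>i\<close>.\<close>
  note dyn = dynkin_stationary[where F = ?F and B = "(real K)\<^sup>2" and i = i and j = "i + 1", OF _ _ F]
  have step: "\<bar>(clip K (a + e))\<^sup>2 - (clip K a)\<^sup>2\<bar> \<le> 2 * \<bar>clip K a\<bar> + 1" if "\<bar>e\<bar> \<le> 1" for a e
  proof -
    have d: "\<bar>clip K (a + e) - clip K a\<bar> \<le> 1" using clip_diff_le[of K "a + e" a] that by simp
    have "(clip K (a + e))\<^sup>2 - (clip K a)\<^sup>2 = (clip K (a + e) - clip K a) * (2 * clip K a + (clip K (a + e) - clip K a))"
      by (simp add: power2_eq_square algebra_simps)
    hence "\<bar>(clip K (a + e))\<^sup>2 - (clip K a)\<^sup>2\<bar> = \<bar>clip K (a + e) - clip K a\<bar> * \<bar>2 * clip K a + (clip K (a + e) - clip K a)\<bar>"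
      by (simp only: abs_mult)
    also have "\<dots> \<le> 1 * (2 * \<bar>clip K a\<bar> + 1)" using d by (intro mult_mono) auto
    finally show ?thesis by simp
  qed
  have G_le: "?G (x, y) \<le> total_rate i (slope y) + 2 * T * (total_rate i (slope y))\<^sup>2 + (clip K (real_of_int (increment x y i)))\<^sup>2 / (2 * T)" for x y
  proof -
    let ?r = "total_rate i (slope y)" and ?m = "\<bar>clip K (real_of_int (increment x y i))\<bar>"
    let ?P = "p (slope y i) (slope y (i + 1))" and ?Q = "q (slope y i) (slope y (i + 1))"
    let ?a = "real_of_int (increment x y i)"
    have le: "r * d \<le> \<bar>r\<bar> * C" if "\<bar>d\<bar> \<le> C" for r d C :: real
      using that abs_ge_self[of "r * d"] mult_left_mono[OF that abs_ge_zero[of r]] by (simp add: abs_mult)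
    have "?G (x, y) = ?P * ((clip K (?a + 1))\<^sup>2 - (clip K ?a)\<^sup>2) + ?Q * ((clip K (?a + -1))\<^sup>2 - (clip K ?a)\<^sup>2)"
      unfolding pair_gen_def by simp
    also have "\<dots> \<le> \<bar>?P\<bar> * (2 * ?m + 1) + \<bar>?Q\<bar> * (2 * ?m + 1)"
      by (intro add_mono le step) auto
    also have "\<dots> = ?r + 2 * ?r * ?m" by (simp add: total_rate_def algebra_simps)
    \<comment> \<open>Young's inequality, weighted so that the term with \<open>?m\<close>
      contributes at most \<open>U / 2\<close> after integration over a time of length at most
      \<open>T\<close>.\<close>
    also have "2 * ?r * ?m \<le> 2 * T * ?r\<^sup>2 + ?m\<^sup>2 / (2 * T)"
    proof -
      have sq: "(2 * T * r - m)\<^sup>2 / (2 * T) = 2 * T * r\<^sup>2 - 2 * r * m + m\<^sup>2 / (2 * T)" for r m :: real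
        using T by (simp add: field_simps power2_eq_square)
      have "0 \<le> (2 * T * ?r - ?m)\<^sup>2 / (2 * T)" using T by simp
      also note sq
      finally show ?thesis by simp
    qed
    finally show ?thesis by simp
  qed
  have rint: "integrable Stat (\<lambda>\<omega>. total_rate i \<omega> + 2 * T * (total_rate i \<omega>)\<^sup>2)"
    using square_integrable_total_rate[of i] Mu.square_integrable_integrable[OF square_integrable_total_rate[of i]]
    by (auto simp: square_integrable_def)
  have EG: "M.expectation (\<lambda>w. ?G (h 0 w, h s w)) \<le> \<rho> + U / (2 * T)" if s: "0 \<le> s" "s \<le> T" for s
  proof -
    let ?r = "\<lambda>\<omega>. total_rate i \<omega> + 2 * T * (total_rate i \<omega>)\<^sup>2"
    have rm: "?r \<in> borel_measurable conf" by measurable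
    have ri: "integrable M (\<lambda>w. ?r (slope (h s w)))"
      using integrable_distr_eq[OF measurable_slope_h[OF s(1)] rm] rint by (simp add: stationary_slope[OF s(1)])
    have "M.expectation (\<lambda>w. ?G (h 0 w, h s w)) \<le> M.expectation (\<lambda>w. ?r (slope (h s w)) + (clip K (rise i s w))\<^sup>2 / (2 * T))"
      using G_le ri int[OF s(1)] dyn(3)[OF _ t(1) s(1)]
      by (intro integral_mono) (auto simp: rise_def)
    also have "\<dots> = \<rho> + u s / (2 * T)"
      using ri int[OF s(1)] expectation_slope[OF s(1) rm] by (simp add: u_def \<rho>_def)
    also have "\<dots> \<le> \<rho> + U / (2 * T)" using uU[OF s] T by (simp add: divide_right_mono)
    finally show ?thesis .
  qed
  have r0: "0 \<le> \<rho>" unfolding \<rho>_def using T by (intro integral_nonneg_AE AE_I2) (simp add: total_rate_def)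
  have u0: "0 \<le> u s" for s unfolding u_def by (intro integral_nonneg_AE AE_I2) simp
  have U0: "0 \<le> U" using uU[of 0] u0[of 0] T by simp
  have us: "u s \<le> T * \<rho> + U / 2" if s: "0 \<le> s" "s \<le> T" for s
  proof -
    have "u s = (LINT v:{0..s}|lborel. M.expectation (\<lambda>w. ?G (h 0 w, h v w)))"
      using dyn(1)[OF _ s(1)] by (simp add: u_def rise_def)
    also have "\<dots> \<le> (LINT v:{0..s}|lborel. \<rho> + U / (2 * T))"
    proof (rule set_integral_mono)
      show "set_integrable lborel {0..s} (\<lambda>v. M.expectation (\<lambda>w. ?G (h 0 w, h v w)))"
        using dyn(2)[OF _ s(1)] by simp
      show "set_integrable lborel {0..s} (\<lambda>v. \<rho> + U / (2 * T))"
        using s by (simp add: set_integrable_def)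
    qed (use EG s in auto)
    also have "\<dots> = s * (\<rho> + U / (2 * T))"
      using s by (simp add: set_lebesgue_integral_def)
    also have "\<dots> \<le> T * (\<rho> + U / (2 * T))" using s r0 U0 T by (intro mult_right_mono) auto
    also have "\<dots> = T * \<rho> + U / 2" using T by (simp add: field_simps)
    finally show ?thesis .
  qed
  have "U \<le> T * \<rho> + U / 2" unfolding U_def by (rule cSUP_least) (use us T in \<open>auto simp: U_def\<close>)
  hence "U \<le> 2 * T * \<rho>" by simp
  thus ?thesis using uU[OF t] by (simp add: u_def)
qed

text \<open>Fatou's lemma lets the truncation level tend to infinity in a bound that does not depend
  on it. The constant also serves all times up to \<open>T\<close>, as domination under time
  integrals requires.\<close>

lemma square_integrable_rise_bound:
  assumes T: "0 < T"
  shows "\<exists>C. \<forall>s\<in>{0..T}. square_integrable M (rise i s) \<and> M.expectation (\<lambda>w. (rise i s w)\<^sup>2) \<le> C"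
proof -
  define C where "C = 2 * T * Mu.expectation (\<lambda>\<omega>. total_rate i \<omega> + 2 * T * (total_rate i \<omega>)\<^sup>2)"
  have "square_integrable M (rise i s) \<and> M.expectation (\<lambda>w. (rise i s w)\<^sup>2) \<le> C" if s: "0 \<le> s" "s \<le> T" for s
  proof -
    have C: "M.expectation (\<lambda>w. (clip K (rise i s w))\<^sup>2) \<le> C" for K
      unfolding C_def by (rule truncated_second_moment_le[OF T s])
    have C0: "0 \<le> C" by (rule order_trans[OF _ C[of 0]]) simp
    have "(\<integral>\<^sup>+w. ennreal ((rise i s w)\<^sup>2) \<partial>M) = (\<integral>\<^sup>+w. liminf (\<lambda>K. ennreal ((clip K (rise i s w))\<^sup>2)) \<partial>M)"
    proof (rule nn_integral_cong)
      fix w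
      have "(\<lambda>K. ennreal ((clip K (rise i s w))\<^sup>2)) \<longlonglongrightarrow> ennreal ((rise i s w)\<^sup>2)"
        by (intro tendsto_ennrealI tendsto_power clip_tendsto)
      thus "ennreal ((rise i s w)\<^sup>2) = liminf (\<lambda>K. ennreal ((clip K (rise i s w))\<^sup>2))"
        by (rule lim_imp_Liminf[OF sequentially_bot, symmetric])
    qed
    also have "\<dots> \<le> liminf (\<lambda>K. \<integral>\<^sup>+w. ennreal ((clip K (rise i s w))\<^sup>2) \<partial>M)"
      using s by (intro nn_integral_liminf) auto
    also have "\<dots> \<le> liminf (\<lambda>K. ennreal C)"
    proof (intro Liminf_mono always_eventually allI)
      fix K
      have "(clip K a)\<^sup>2 \<le> (real K)\<^sup>2" for a using clip_abs_le(1)[of K a] by (simp add: abs_le_square_iff[symmetric])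
      hence "integrable M (\<lambda>w. (clip K (rise i s w))\<^sup>2)"
        using s by (intro M.integrable_const_bound[where B = "(real K)\<^sup>2"]) auto
      thus "(\<integral>\<^sup>+w. ennreal ((clip K (rise i s w))\<^sup>2) \<partial>M) \<le> ennreal C"
        using C[of K] by (subst nn_integral_eq_integral) (auto intro: ennreal_leI)
    qed
    also have "\<dots> = ennreal C" by (simp add: Liminf_const)
    finally have le: "(\<integral>\<^sup>+w. ennreal ((rise i s w)\<^sup>2) \<partial>M) \<le> ennreal C" .
    have i: "integrable M (\<lambda>w. (rise i s w)\<^sup>2)"
      using s le_less_trans[OF le ennreal_less_top] by (intro integrableI_nonneg) auto
    hence "ennreal (M.expectation (\<lambda>w. (rise i s w)\<^sup>2)) \<le> ennreal C"
      using le by (subst (asm) nn_integral_eq_integral) auto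
    hence "M.expectation (\<lambda>w. (rise i s w)\<^sup>2) \<le> C" using C0 by simp
    thus ?thesis using i s by (simp add: square_integrable_def)
  qed
  thus ?thesis by (intro exI[of _ C]) auto
qed

lemma square_integrable_rise: "0 \<le> s \<Longrightarrow> square_integrable M (rise i s)"
  using square_integrable_rise_bound[of "s + 1" i] by auto

text \<open>Two dominated convergences: for fixed \<open>s\<close> the generator terms converge
  under \<open>L'\<close>, and over \<open>{0..t}\<close> their expectations are bounded by
  \<open>C\<close>. The time-0 term is absent because \<open>F K\<close> vanishes at zero
  increments.\<close>

lemma dynkin_limit:
  fixes F :: "nat \<Rightarrow> (int \<Rightarrow> int) \<Rightarrow> int \<Rightarrow> int \<Rightarrow> real"
    and H L L' :: "(int \<Rightarrow> int) \<times> (int \<Rightarrow> int) \<Rightarrow> real"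
  assumes ij: "i \<noteq> j" and t: "0 \<le> t"
    and F: "\<And>K a b. (\<lambda>x. F K x a b) \<in> borel_measurable (heights W)" "\<And>K x a b. \<bar>F K x a b\<bar> \<le> B K" "\<And>K x. F K x 0 0 = 0"
    and H: "H \<in> borel_measurable (heights W \<Otimes>\<^sub>M heights W)" "integrable M (\<lambda>w. H (h 0 w, h t w))"
      "\<And>x y. (\<lambda>K. F K x (increment x y i) (increment x y j)) \<longlonglongrightarrow> H (x, y)"
      "\<And>K x y. \<bar>F K x (increment x y i) (increment x y j)\<bar> \<le> \<bar>H (x, y)\<bar>"
    and L: "L \<in> borel_measurable (heights W \<Otimes>\<^sub>M heights W)" "\<And>x y. (\<lambda>K. pair_gen i j (F K) (x, y)) \<longlonglongrightarrow> L (x, y)"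
    and L': "\<And>K x y. \<bar>pair_gen i j (F K) (x, y)\<bar> \<le> L' (x, y)"
      "\<And>s. s \<in> {0..t} \<Longrightarrow> integrable M (\<lambda>w. L' (h 0 w, h s w)) \<and> M.expectation (\<lambda>w. L' (h 0 w, h s w)) \<le> C"
  shows "M.expectation (\<lambda>w. H (h 0 w, h t w)) = (LINT s:{0..t}|lborel. M.expectation (\<lambda>w. L (h 0 w, h s w)))
    \<and> set_integrable lborel {0..t} (\<lambda>s. M.expectation (\<lambda>w. L (h 0 w, h s w)))"
proof -
  let ?G = "\<lambda>K. pair_gen i j (F K)"
  note dyn = dynkin_stationary[where F = "F K" and B = "B K" for K, OF ij _ F(1) F(2)]
  have Lm: "(\<lambda>w. L (h 0 w, h s w)) \<in> borel_measurable M" if "0 \<le> s" for s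
    using measurable_compose[OF measurable_pair_h[OF that] L(1)] .
  have L_le: "\<bar>L (x, y)\<bar> \<le> L' (x, y)" for x y
    by (rule LIMSEQ_le_const2[OF tendsto_rabs[OF L(2)]]) (use L'(1) in auto)
  have Lint: "integrable M (\<lambda>w. L (h 0 w, h s w))" if "0 \<le> s" "s \<le> t" for s
    using L'(2)[of s] that L_le
    by (intro Bochner_Integration.integrable_bound[OF _ Lm[OF that(1)], of "\<lambda>w. L' (h 0 w, h s w)"])
       (auto intro!: AE_I2 order_trans[OF L_le abs_ge_self])
  have EG: "\<bar>M.expectation (\<lambda>w. ?G K (h 0 w, h s w))\<bar> \<le> C" if "0 \<le> s" "s \<le> t" for s K
  proof -
    have "\<bar>M.expectation (\<lambda>w. ?G K (h 0 w, h s w))\<bar> \<le> M.expectation (\<lambda>w. \<bar>?G K (h 0 w, h s w)\<bar>)"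
      by (rule integral_abs_bound)
    also have "\<dots> \<le> M.expectation (\<lambda>w. L' (h 0 w, h s w))"
      using dyn(3)[OF that(1) that(1)] L'(2)[of s] that L'(1) by (intro integral_mono) auto
    also have "\<dots> \<le> C" using L'(2)[of s] that by auto
    finally show ?thesis .
  qed
  have lim_s: "(\<lambda>K. M.expectation (\<lambda>w. ?G K (h 0 w, h s w))) \<longlonglongrightarrow> M.expectation (\<lambda>w. L (h 0 w, h s w))"
    if "0 \<le> s" "s \<le> t" for s
  proof (rule integral_dominated_convergence[where w = "\<lambda>w. L' (h 0 w, h s w)"])
    show "(\<lambda>w. ?G K (h 0 w, h s w)) \<in> borel_measurable M" for K
      using borel_measurable_integrable[OF dyn(3)[OF that(1) that(1)]] .
  qed (use Lm L'(2)[of s] that L(2) L'(1) in auto)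
  let ?l = "\<lambda>s. indicator {0..t} s *\<^sub>R M.expectation (\<lambda>w. L (h 0 w, h s w))"
  let ?g = "\<lambda>K s. indicator {0..t} s *\<^sub>R M.expectation (\<lambda>w. ?G K (h 0 w, h s w))"
  have gm: "?g K \<in> borel_measurable lborel" for K
    using dyn(2)[OF t] unfolding set_integrable_def by (rule borel_measurable_integrable)
  have lm: "?l \<in> borel_measurable lborel"
    using measurable_expectation_time[OF L(1) Lint] by simp
  have wi: "integrable lborel (\<lambda>s. indicator {0..t} s * C)"
    using t by (intro integrable_mult_left integrable_real_indicator) auto
  have lim: "AE s in lborel. (\<lambda>K. ?g K s) \<longlonglongrightarrow> ?l s"
    using lim_s by (intro AE_I2) (auto simp: indicator_def)
  have bd: "AE s in lborel. norm (?g K s) \<le> indicator {0..t} s * C" for K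
    using EG by (intro AE_I2) (auto simp: indicator_def)
  have "set_integrable lborel {0..t} (\<lambda>s. M.expectation (\<lambda>w. L (h 0 w, h s w)))"
    unfolding set_integrable_def by (rule integrable_dominated_convergence[OF lm gm wi lim bd])
  moreover have "(\<lambda>K. LINT s:{0..t}|lborel. M.expectation (\<lambda>w. ?G K (h 0 w, h s w)))
      \<longlonglongrightarrow> (LINT s:{0..t}|lborel. M.expectation (\<lambda>w. L (h 0 w, h s w)))"
    unfolding set_lebesgue_integral_def by (rule integral_dominated_convergence[OF lm gm wi lim bd])
  moreover have "(\<lambda>K. M.expectation (\<lambda>w. F K (h 0 w) (increment (h 0 w) (h t w) i) (increment (h 0 w) (h t w) j)))
      \<longlonglongrightarrow> M.expectation (\<lambda>w. H (h 0 w, h t w))"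
  proof (rule integral_dominated_convergence[where w = "\<lambda>w. \<bar>H (h 0 w, h t w)\<bar>"])
    show "(\<lambda>w. F K (h 0 w) (increment (h 0 w) (h t w) i) (increment (h 0 w) (h t w) j)) \<in> borel_measurable M" for K
      using measurable_compose[OF measurable_pair_h[OF t] measurable_F_disp[OF F(1), where u = "\<lambda>a. a" and i = i and v = "\<lambda>b. b" and j = j]]
      by (simp only: fst_conv snd_conv)
    show "(\<lambda>w. H (h 0 w, h t w)) \<in> borel_measurable M" using H(2) by (rule borel_measurable_integrable)
  qed (use H in auto)
  moreover have "M.expectation (\<lambda>w. F K (h 0 w) (increment (h 0 w) (h t w) i) (increment (h 0 w) (h t w) j))
      = (LINT s:{0..t}|lborel. M.expectation (\<lambda>w. ?G K (h 0 w, h s w)))" for K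
    using dyn(1)[OF t, of K] by (simp add: F(3))
  ultimately show ?thesis
    using LIMSEQ_unique by (simp only:) blast
qed

text \<open>At distinct sites the generator obeys the product rule without a quadratic-variation
  term, so the product of two increments has derivative \<open>net i\<close> times the one plus
  \<open>net j\<close> times the other. Clipping each factor separately keeps the product
  bounded.\<close>

lemma expectation_rise_rise:
  assumes ij: "i \<noteq> j" and t: "0 < t"
  shows "M.expectation (\<lambda>w. rise i t w * rise j t w)
      = (LINT s:{0..t}|lborel. M.expectation (\<lambda>w. flux i s w * rise j s w) + M.expectation (\<lambda>w. flux j s w * rise i s w))"
    "set_integrable lborel {0..t} (\<lambda>s. M.expectation (\<lambda>w. flux i s w * rise j s w) + M.expectation (\<lambda>w. flux j s w * rise i s w))"
proof -
  let ?d = "\<lambda>z k. real_of_int (increment (fst z) (snd z) k)"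
  let ?F = "\<lambda>K (x :: int \<Rightarrow> int) (a :: int) (b :: int). clip K (real_of_int a) * clip K (real_of_int b)"
  let ?H = "\<lambda>z. ?d z i * ?d z j"
  let ?L = "\<lambda>z. net i (slope (snd z)) * ?d z j + net j (slope (snd z)) * ?d z i"
  let ?L' = "\<lambda>z. total_rate i (slope (snd z)) * \<bar>?d z j\<bar> + total_rate j (slope (snd z)) * \<bar>?d z i\<bar>"
  obtain Ci Cj where C: "\<And>s. s \<in> {0..t} \<Longrightarrow> M.expectation (\<lambda>w. (rise i s w)\<^sup>2) \<le> Ci" "\<And>s. s \<in> {0..t} \<Longrightarrow> M.expectation (\<lambda>w. (rise j s w)\<^sup>2) \<le> Cj"
    using square_integrable_rise_bound[OF t] by meson
  define \<rho> where "\<rho> k = Mu.expectation (\<lambda>\<omega>. (total_rate k \<omega>)\<^sup>2)" for k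
  \<comment> \<open>The dominating products are split into squares: those of the rates have constant
    mean by stationarity, those of the increments are bounded uniformly up to time
    \<open>t\<close>.\<close>
  have tot: "integrable M (\<lambda>w. total_rate k (slope (h s w)) * \<bar>rise l s w\<bar>)"
    "M.expectation (\<lambda>w. total_rate k (slope (h s w)) * \<bar>rise l s w\<bar>) \<le> (\<rho> k + c) / 2"
    if s: "0 \<le> s" and c: "M.expectation (\<lambda>w. (rise l s w)\<^sup>2) \<le> c" for k l s c
  proof -
    have sq: "square_integrable M (\<lambda>w. \<bar>rise l s w\<bar>)"
      by (intro square_integrable_abs square_integrable_rise s)
    show i: "integrable M (\<lambda>w. total_rate k (slope (h s w)) * \<bar>rise l s w\<bar>)"
      by (rule M.square_integrable_mult_integrable[OF square_integrable_total_rate_h[OF s] sq])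
    have i1: "integrable M (\<lambda>w. (total_rate k (slope (h s w)))\<^sup>2)" "integrable M (\<lambda>w. (rise l s w)\<^sup>2)"
      using square_integrable_total_rate_h[OF s] square_integrable_rise[OF s] by (simp_all add: square_integrable_def)
    have "M.expectation (\<lambda>w. total_rate k (slope (h s w)) * \<bar>rise l s w\<bar>)
        \<le> M.expectation (\<lambda>w. ((total_rate k (slope (h s w)))\<^sup>2 + (rise l s w)\<^sup>2) / 2)"
      using half_square_sum[of _ "\<bar>_\<bar>"] by (intro integral_mono i) (use i1 in auto)
    also have "\<dots> = (\<rho> k + M.expectation (\<lambda>w. (rise l s w)\<^sup>2)) / 2"
      using i1 expectation_slope[OF s, of "\<lambda>\<omega>. (total_rate k \<omega>)\<^sup>2"] by (simp add: \<rho>_def)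
    also have "\<dots> \<le> (\<rho> k + c) / 2" using c by simp
    finally show "M.expectation (\<lambda>w. total_rate k (slope (h s w)) * \<bar>rise l s w\<bar>) \<le> (\<rho> k + c) / 2" .
  qed
  have mS: "(\<lambda>z. X (slope (snd z))) \<in> borel_measurable (heights W \<Otimes>\<^sub>M heights W)" if "X \<in> borel_measurable conf" for X :: "_ \<Rightarrow> real"
    using measurable_compose[OF measurable_compose[OF measurable_snd measurable_heights_slope] that] .
  have conv: "M.expectation (\<lambda>w. ?L (h 0 w, h s w)) = M.expectation (\<lambda>w. flux i s w * rise j s w) + M.expectation (\<lambda>w. flux j s w * rise i s w)"
    if "0 \<le> s" for s
    using M.square_integrable_mult_integrable[OF square_integrable_flux[OF that] square_integrable_rise[OF that]]
    by (simp add: flux_def rise_def)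
  have *: "M.expectation (\<lambda>w. ?H (h 0 w, h t w)) = (LINT s:{0..t}|lborel. M.expectation (\<lambda>w. ?L (h 0 w, h s w)))
      \<and> set_integrable lborel {0..t} (\<lambda>s. M.expectation (\<lambda>w. ?L (h 0 w, h s w)))"
  proof (rule dynkin_limit[where F = ?F and H = ?H and L = ?L and L' = ?L' and B = "\<lambda>K. real K * real K"
        and C = "(\<rho> i + Cj) / 2 + (\<rho> j + Ci) / 2" and i = i and j = j and t = t])
    show "i \<noteq> j" "0 \<le> t" using ij t by auto
    show "\<bar>?F K x a b\<bar> \<le> real K * real K" for K x a b
      unfolding abs_mult by (intro mult_mono clip_abs_le) auto
    show "?H \<in> borel_measurable (heights W \<Otimes>\<^sub>M heights W)"
      by (intro borel_measurable_times measurable_increment_at_real)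
    show "integrable M (\<lambda>w. ?H (h 0 w, h t w))"
      using M.square_integrable_mult_integrable[OF square_integrable_rise square_integrable_rise, of t t i j] t
      by (simp add: rise_def)
    show "(\<lambda>K. ?F K x (increment x y i) (increment x y j)) \<longlonglongrightarrow> ?H (x, y)" for x y
      by (simp, intro tendsto_mult clip_tendsto)
    show "\<bar>?F K x (increment x y i) (increment x y j)\<bar> \<le> \<bar>?H (x, y)\<bar>" for K x y
      by (simp add: abs_mult, intro mult_mono clip_abs_le) auto
    show "?L \<in> borel_measurable (heights W \<Otimes>\<^sub>M heights W)"
      by (intro borel_measurable_add borel_measurable_times measurable_increment_at_real mS measurable_net)
    show "(\<lambda>K. pair_gen i j (?F K) (x, y)) \<longlonglongrightarrow> ?L (x, y)" for x y
    proof -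
      let ?a = "increment x y i" and ?b = "increment x y j"
      have eq: "pair_gen i j (?F K) (x, y) =
          p (slope y i) (slope y (i + 1)) * ((clip K (real_of_int (?a + 1)) - clip K (real_of_int ?a)) * clip K (real_of_int ?b)) +
          q (slope y i) (slope y (i + 1)) * ((clip K (real_of_int (?a + -1)) - clip K (real_of_int ?a)) * clip K (real_of_int ?b)) +
          p (slope y j) (slope y (j + 1)) * ((clip K (real_of_int (?b + 1)) - clip K (real_of_int ?b)) * clip K (real_of_int ?a)) +
          q (slope y j) (slope y (j + 1)) * ((clip K (real_of_int (?b + -1)) - clip K (real_of_int ?b)) * clip K (real_of_int ?a))" for K
        unfolding pair_gen_def by (simp add: algebra_simps)
      have "(\<lambda>K. pair_gen i j (?F K) (x, y)) \<longlonglongrightarrow>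
          p (slope y i) (slope y (i + 1)) * (real_of_int 1 * real_of_int ?b) +
          q (slope y i) (slope y (i + 1)) * (real_of_int (-1) * real_of_int ?b) +
          p (slope y j) (slope y (j + 1)) * (real_of_int 1 * real_of_int ?a) +
          q (slope y j) (slope y (j + 1)) * (real_of_int (-1) * real_of_int ?a)"
        unfolding eq by (intro tendsto_add tendsto_mult clip_step_tendsto clip_tendsto tendsto_const)
      thus ?thesis by (simp add: net_def algebra_simps)
    qed
    show "\<bar>pair_gen i j (?F K) (x, y)\<bar> \<le> ?L' (x, y)" for K x y
    proof -
      let ?a = "real_of_int (increment x y i)" and ?b = "real_of_int (increment x y j)"
      have s1: "\<bar>clip K (real_of_int (a + e)) * c - clip K (real_of_int a) * c\<bar> \<le> \<bar>c\<bar>" if "\<bar>e\<bar> = 1" for a e c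
      proof -
        have "\<bar>clip K (real_of_int (a + e)) - clip K (real_of_int a)\<bar> \<le> 1"
          using clip_diff_le[of K "real_of_int (a + e)" "real_of_int a"] that by simp
        hence "\<bar>clip K (real_of_int (a + e)) - clip K (real_of_int a)\<bar> * \<bar>c\<bar> \<le> 1 * \<bar>c\<bar>" by (rule mult_right_mono) simp
        thus ?thesis by (simp add: left_diff_distrib[symmetric] abs_mult)
      qed
      have s2: "\<bar>clip K (real_of_int (a + e)) * clip K c - clip K (real_of_int a) * clip K c\<bar> \<le> \<bar>c\<bar>" if "\<bar>e\<bar> = 1" for a e c
        using s1[OF that, of a "clip K c"] clip_abs_le(2)[of K c] by linarith
      have s3: "\<bar>clip K c * clip K (real_of_int (a + e)) - clip K c * clip K (real_of_int a)\<bar> \<le> \<bar>c\<bar>" if "\<bar>e\<bar> = 1" for a e c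
        using s2[OF that, of a c] by (simp only: mult.commute)
      have le: "\<bar>r * d\<bar> \<le> \<bar>r\<bar> * c" if "\<bar>d\<bar> \<le> c" for r d c :: real
        using that by (simp add: abs_mult mult_left_mono)
      have "\<bar>pair_gen i j (?F K) (x, y)\<bar> \<le> \<bar>p (slope y i) (slope y (i + 1))\<bar> * \<bar>?b\<bar> + \<bar>q (slope y i) (slope y (i + 1))\<bar> * \<bar>?b\<bar>
          + \<bar>p (slope y j) (slope y (j + 1))\<bar> * \<bar>?a\<bar> + \<bar>q (slope y j) (slope y (j + 1))\<bar> * \<bar>?a\<bar>"
        unfolding pair_gen_def prod.case
        using s2[of 1 "increment x y i" ?b] s2[of "-1" "increment x y i" ?b] s3[of 1 ?a "increment x y j"] s3[of "-1" ?a "increment x y j"]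
        by (intro order_trans[OF abs_triangle_ineq] add_mono le) simp_all
      thus ?thesis by (simp add: total_rate_def algebra_simps)
    qed
    show "integrable M (\<lambda>w. ?L' (h 0 w, h s w)) \<and> M.expectation (\<lambda>w. ?L' (h 0 w, h s w)) \<le> (\<rho> i + Cj) / 2 + (\<rho> j + Ci) / 2"
      if "s \<in> {0..t}" for s
    proof -
      have s: "0 \<le> s" using that by simp
      note A = tot[OF s C(2)[OF that], of i] and B = tot[OF s C(1)[OF that], of j]
      show ?thesis
        using Bochner_Integration.integrable_add[OF A(1) B(1)] Bochner_Integration.integral_add[OF A(1) B(1)]
          add_mono[OF A(2) B(2)]
        by (simp only: rise_def fst_conv snd_conv simp_thms)
    qed
  qed auto
  have c: "indicator {0..t} s *\<^sub>R M.expectation (\<lambda>w. ?L (h 0 w, h s w))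
      = indicator {0..t} s *\<^sub>R (M.expectation (\<lambda>w. flux i s w * rise j s w) + M.expectation (\<lambda>w. flux j s w * rise i s w))" for s
    using conv[of s] by (cases "s \<in> {0..t}") auto
  show "M.expectation (\<lambda>w. rise i t w * rise j t w)
      = (LINT s:{0..t}|lborel. M.expectation (\<lambda>w. flux i s w * rise j s w) + M.expectation (\<lambda>w. flux j s w * rise i s w))"
    using *[THEN conjunct1] unfolding set_lebesgue_integral_def c by (simp only: rise_def fst_conv snd_conv)
  show "set_integrable lborel {0..t} (\<lambda>s. M.expectation (\<lambda>w. flux i s w * rise j s w) + M.expectation (\<lambda>w. flux j s w * rise i s w))"
    using *[THEN conjunct2] unfolding set_integrable_def c .
qed

text \<open>A function of the initial heights is frozen by the dynamics, so the generator acts on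
  the increment alone. Clipping \<open>g\<close> as well admits any square-integrable
  \<open>g\<close>, in particular a sum of initial spins.\<close>

lemma expectation_initial_rise:
  assumes t: "0 \<le> t" and g: "g \<in> borel_measurable (heights W)" "square_integrable M (\<lambda>w. g (h 0 w))"
  shows "M.expectation (\<lambda>w. g (h 0 w) * rise i t w) = (LINT s:{0..t}|lborel. M.expectation (\<lambda>w. g (h 0 w) * flux i s w))"
    "set_integrable lborel {0..t} (\<lambda>s. M.expectation (\<lambda>w. g (h 0 w) * flux i s w))"
proof -
  let ?d = "\<lambda>z k. real_of_int (increment (fst z) (snd z) k)"
  let ?F = "\<lambda>K (x :: int \<Rightarrow> int) (a :: int) (b :: int). clip K (g x) * clip K (real_of_int a)"
  let ?H = "\<lambda>z. g (fst z) * ?d z i"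
  let ?L = "\<lambda>z. g (fst z) * net i (slope (snd z))"
  let ?L' = "\<lambda>z. \<bar>g (fst z)\<bar> * total_rate i (slope (snd z))"
  define c where "c = (M.expectation (\<lambda>w. (g (h 0 w))\<^sup>2) + Mu.expectation (\<lambda>\<omega>. (total_rate i \<omega>)\<^sup>2)) / 2"
  have mS: "(\<lambda>z. X (slope (snd z))) \<in> borel_measurable (heights W \<Otimes>\<^sub>M heights W)" if "X \<in> borel_measurable conf" for X :: "_ \<Rightarrow> real"
    using measurable_compose[OF measurable_compose[OF measurable_snd measurable_heights_slope] that] .
  have mg: "(\<lambda>z. g (fst z)) \<in> borel_measurable (heights W \<Otimes>\<^sub>M heights W)"
    using measurable_compose[OF measurable_fst g(1)] .
  have "M.expectation (\<lambda>w. ?H (h 0 w, h t w)) = (LINT s:{0..t}|lborel. M.expectation (\<lambda>w. ?L (h 0 w, h s w)))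
      \<and> set_integrable lborel {0..t} (\<lambda>s. M.expectation (\<lambda>w. ?L (h 0 w, h s w)))"
  proof (rule dynkin_limit[where F = ?F and H = ?H and L = ?L and L' = ?L' and B = "\<lambda>K. real K * real K"
        and C = c and i = i and j = "i + 1" and t = t])
    show "\<bar>?F K x a b\<bar> \<le> real K * real K" for K x a b
      unfolding abs_mult by (intro mult_mono clip_abs_le) auto
    show "(\<lambda>x. ?F K x a b) \<in> borel_measurable (heights W)" for K a b
      using g(1) by auto
    show "?H \<in> borel_measurable (heights W \<Otimes>\<^sub>M heights W)"
      by (intro borel_measurable_times measurable_increment_at_real mg)
    show "integrable M (\<lambda>w. ?H (h 0 w, h t w))"
      using M.square_integrable_mult_integrable[OF g(2) square_integrable_rise[OF t], of i]
      by (simp_all add: rise_def)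
    show "(\<lambda>K. ?F K x (increment x y i) (increment x y (i + 1))) \<longlonglongrightarrow> ?H (x, y)" for x y
      by (simp, intro tendsto_mult clip_tendsto)
    show "\<bar>?F K x (increment x y i) (increment x y (i + 1))\<bar> \<le> \<bar>?H (x, y)\<bar>" for K x y
      by (simp add: abs_mult, intro mult_mono clip_abs_le) auto
    show "?L \<in> borel_measurable (heights W \<Otimes>\<^sub>M heights W)"
      by (intro borel_measurable_times mg mS measurable_net)
    show "(\<lambda>K. pair_gen i (i + 1) (?F K) (x, y)) \<longlonglongrightarrow> ?L (x, y)" for x y
    proof -
      let ?a = "increment x y i"
      have eq: "pair_gen i (i + 1) (?F K) (x, y) =
          p (slope y i) (slope y (i + 1)) * (clip K (g x) * (clip K (real_of_int (?a + 1)) - clip K (real_of_int ?a))) +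
          q (slope y i) (slope y (i + 1)) * (clip K (g x) * (clip K (real_of_int (?a + -1)) - clip K (real_of_int ?a)))" for K
        unfolding pair_gen_def by (simp add: algebra_simps)
      have "(\<lambda>K. pair_gen i (i + 1) (?F K) (x, y)) \<longlonglongrightarrow>
          p (slope y i) (slope y (i + 1)) * (g x * real_of_int 1) + q (slope y i) (slope y (i + 1)) * (g x * real_of_int (-1))"
        unfolding eq by (intro tendsto_add tendsto_mult clip_step_tendsto clip_tendsto tendsto_const)
      thus ?thesis by (simp add: net_def algebra_simps)
    qed
    show "\<bar>pair_gen i (i + 1) (?F K) (x, y)\<bar> \<le> ?L' (x, y)" for K x y
    proof -
      have "\<bar>clip K (g x) * clip K (real_of_int (a + 1)) - clip K (g x) * clip K (real_of_int a)\<bar> \<le> \<bar>g x\<bar>" for a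
      proof -
        have "\<bar>clip K (g x)\<bar> * \<bar>clip K (real_of_int (a + 1)) - clip K (real_of_int a)\<bar> \<le> \<bar>g x\<bar> * 1"
          by (intro mult_mono clip_abs_le clip_step_le) auto
        thus ?thesis by (simp add: right_diff_distrib[symmetric] abs_mult)
      qed
      from pair_gen_bound[of "?F K" x "\<bar>g x\<bar>" 0 i "i + 1" y, OF this]
      show ?thesis by (simp add: mult.commute)
    qed
    show "integrable M (\<lambda>w. ?L' (h 0 w, h s w)) \<and> M.expectation (\<lambda>w. ?L' (h 0 w, h s w)) \<le> c" if "s \<in> {0..t}" for s
    proof -
      have s: "0 \<le> s" using that by simp
      have sq: "square_integrable M (\<lambda>w. \<bar>g (h 0 w)\<bar>)" by (rule square_integrable_abs[OF g(2)])
      have i: "integrable M (\<lambda>w. \<bar>g (h 0 w)\<bar> * total_rate i (slope (h s w)))"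
        by (rule M.square_integrable_mult_integrable[OF sq square_integrable_total_rate_h[OF s]])
      have i1: "integrable M (\<lambda>w. (total_rate i (slope (h s w)))\<^sup>2)" "integrable M (\<lambda>w. (g (h 0 w))\<^sup>2)"
        using square_integrable_total_rate_h[OF s] g(2) by (simp_all add: square_integrable_def)
      have "M.expectation (\<lambda>w. \<bar>g (h 0 w)\<bar> * total_rate i (slope (h s w)))
          \<le> M.expectation (\<lambda>w. ((g (h 0 w))\<^sup>2 + (total_rate i (slope (h s w)))\<^sup>2) / 2)"
        using half_square_sum[of "\<bar>_\<bar>"] by (intro integral_mono i) (use i1 in auto)
      also have "\<dots> = c"
        using i1 expectation_slope[OF s, of "\<lambda>\<omega>. (total_rate i \<omega>)\<^sup>2"] by (simp add: c_def)
      finally show ?thesis using i by simp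
    qed
  qed (use t in auto)
  thus "M.expectation (\<lambda>w. g (h 0 w) * rise i t w) = (LINT s:{0..t}|lborel. M.expectation (\<lambda>w. g (h 0 w) * flux i s w))"
    "set_integrable lborel {0..t} (\<lambda>s. M.expectation (\<lambda>w. g (h 0 w) * flux i s w))"
    by (auto simp: rise_def flux_def)
qed

section \<open>Positive association of the spins\<close>

lemma measurable_spin_conf [measurable]: "(\<lambda>\<omega>. real_of_int (\<omega> n)) \<in> borel_measurable conf"
  by (rule measurable_compose[OF measurable_conf_component]) simp

lemma spin_eq: "spin h n s = (\<lambda>w. (\<lambda>\<omega>. real_of_int (\<omega> n)) (slope (h s w)))"
  by (simp add: spin_def fun_eq_iff)

lemma square_integrable_spin: "0 \<le> s \<Longrightarrow> square_integrable M (spin h n s)"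
  unfolding spin_eq using square_integrable_Mu_component[OF theta]
  by (subst square_integrable_slope_iff) auto

text \<open>A finite wall is an integer and bounds the spins almost surely, so it bounds their mean
  and also the ceiling of the mean. The ceiling is thus an admissible value to which a spin may be
  reset.\<close>

lemma mean_spin_ceiling_mem: "\<lceil>Mu.expectation (\<lambda>\<omega>. real_of_int (\<omega> 0))\<rceil> \<in> spins \<omega>min \<omega>max"
proof -
  let ?b = "Mu.expectation (\<lambda>\<omega>. real_of_int (\<omega> 0))"
  have i: "integrable Stat (\<lambda>\<omega>. real_of_int (\<omega> 0))"
    by (rule Mu.square_integrable_integrable[OF square_integrable_Mu_component[OF theta]])
  have ae: "AE \<omega> in Stat. \<omega> 0 \<in> spins \<omega>min \<omega>max" by (rule AE_Mu_spins[OF theta])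
  have "\<omega>min \<le> Fin \<lceil>?b\<rceil>"
  proof (cases \<omega>min)
    case (Fin m)
    have "AE \<omega> in Stat. real_of_int m \<le> real_of_int (\<omega> 0)"
      using ae by eventually_elim (simp add: mem_spins_iff Fin)
    hence "real_of_int m \<le> ?b" by (rule Mu.integral_ge_const[OF i])
    hence "m \<le> \<lceil>?b\<rceil>" by linarith
    thus ?thesis by (simp add: Fin)
  qed (use \<omega>min_le in \<open>simp_all add: zero_extended_def\<close>)
  moreover have "Fin \<lceil>?b\<rceil> \<le> \<omega>max"
  proof (cases \<omega>max)
    case (Fin m)
    have "AE \<omega> in Stat. real_of_int (\<omega> 0) \<le> real_of_int m"
      using ae by eventually_elim (simp add: mem_spins_iff Fin)
    hence "?b \<le> real_of_int m" by (rule Mu.integral_le_const[OF i])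
    thus ?thesis by (simp add: Fin ceiling_le_iff)
  qed (use \<omega>max_ge in \<open>simp_all add: one_extended_def\<close>)
  ultimately show ?thesis by (simp add: mem_spins_iff)
qed

text \<open>With \<open>k\<close> the smallest integer above the mean \<open>b\<close>, replacing the spin at the origin by \<open>k\<close>
  changes a monotone function in the direction of \<open>k - b\<close>, and makes it independent of that spin.\<close>

lemma monotone_expectation_nonneg:
  assumes \<Gamma>: "\<Gamma> \<in> borel_measurable conf" "\<And>\<omega>. \<bar>\<Gamma> \<omega>\<bar> \<le> B"
    and mono: "\<And>\<omega> \<omega>'. \<omega> \<in> W \<Longrightarrow> \<omega>' \<in> W \<Longrightarrow> \<omega> \<le> \<omega>' \<Longrightarrow> \<Gamma> \<omega> \<le> \<Gamma> \<omega>'"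
  shows "0 \<le> Mu.expectation (\<lambda>\<omega>. \<Gamma> \<omega> * (real_of_int (\<omega> 0) - Mu.expectation (\<lambda>\<omega>. real_of_int (\<omega> 0))))"
proof -
  define b where "b = Mu.expectation (\<lambda>\<omega>. real_of_int (\<omega> 0))"
  define k where "k = \<lceil>b\<rceil>"
  let ?mu = "mu \<omega>min \<omega>max f \<theta>"
  interpret mu: prob_space ?mu by (rule prob_space_mu[OF theta])
  interpret P: pair_prob_space ?mu Stat ..
  let ?r = "\<lambda>(z, X). X(0 := z)"
  have rm: "?r \<in> ?mu \<Otimes>\<^sub>M Stat \<rightarrow>\<^sub>M conf"
  proof (rule measurable_into_conf)
    fix i
    have "snd \<in> ?mu \<Otimes>\<^sub>M Stat \<rightarrow>\<^sub>M conf"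
      using measurable_snd[of ?mu Stat] by (simp cong: measurable_cong_sets)
    hence "(\<lambda>z. snd z i) \<in> ?mu \<Otimes>\<^sub>M Stat \<rightarrow>\<^sub>M count_space UNIV"
      by (rule measurable_compose) simp
    moreover have "fst \<in> ?mu \<Otimes>\<^sub>M Stat \<rightarrow>\<^sub>M count_space UNIV"
      using measurable_fst[of ?mu Stat] by (simp add: measurable_cong_sets[OF refl, of ?mu "count_space UNIV"])
    ultimately show "(\<lambda>z. ?r z i) \<in> ?mu \<Otimes>\<^sub>M Stat \<rightarrow>\<^sub>M count_space UNIV"
      by (cases "i = 0") (simp_all add: split_beta)
  qed
  have km: "(\<lambda>X. X(0 := k)) \<in> conf \<rightarrow>\<^sub>M conf"
  proof (rule measurable_into_conf)
    show "(\<lambda>X. (X(0 := k)) i) \<in> conf \<rightarrow>\<^sub>M count_space UNIV" for i by (cases "i = 0") simp_all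
  qed
  have aeW: "AE z in ?mu \<Otimes>\<^sub>M Stat. ?r z \<in> W"
  proof (rule AE_distrD[OF rm])
    show "AE \<omega> in distr (?mu \<Otimes>\<^sub>M Stat) conf ?r. \<omega> \<in> W"
      unfolding distr_Mu_resample[OF theta] by (rule tempered_full[OF theta])
  qed
  hence "AE z in ?mu. AE X in Stat. ?r (z, X) \<in> W" by (rule P.AE_pair)
  \<comment> \<open>An exceptional value \<open>k\<close> would be contained in a null set of
    \<open>?mu\<close>, but it is an atom.\<close>
  hence "AE X in Stat. X(0 := k) \<in> W"
  proof (rule contrapos_pp)
    assume n: "\<not> (AE X in Stat. X(0 := k) \<in> W)"
    show "\<not> (AE z in ?mu. AE X in Stat. ?r (z, X) \<in> W)"
    proof
      assume "AE z in ?mu. AE X in Stat. ?r (z, X) \<in> W"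
      then obtain N where N: "{z \<in> space ?mu. \<not> (AE X in Stat. ?r (z, X) \<in> W)} \<subseteq> N" "emeasure ?mu N = 0" "N \<in> sets ?mu"
        by (rule AE_E)
      have "{k} \<subseteq> N" using N(1) n by auto
      hence "emeasure ?mu {k} \<le> emeasure ?mu N" by (intro emeasure_mono N)
      hence "emeasure ?mu {k} = 0" using N(2) by simp
      thus False using measure_mu_singleton_pos[OF theta mean_spin_ceiling_mem] by (simp add: k_def b_def)
    qed
  qed
  moreover have "{z \<in> space (?mu \<Otimes>\<^sub>M Stat). (snd z)(0 := k) \<in> W} \<in> sets (?mu \<Otimes>\<^sub>M Stat)"
  proof -
    have "snd \<in> ?mu \<Otimes>\<^sub>M Stat \<rightarrow>\<^sub>M conf"
      using measurable_snd[of ?mu Stat] by (simp cong: measurable_cong_sets)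
    from measurable_sets[OF measurable_compose[OF this km] tempered_sets]
    show ?thesis by (simp add: vimage_def Int_def conj_commute)
  qed
  ultimately have aeK: "AE z in ?mu \<Otimes>\<^sub>M Stat. (snd z)(0 := k) \<in> W"
    by (intro P.AE_pair_measure) auto
  have im: "integrable ?mu (\<lambda>z. real_of_int z - b)"
    using mu.square_integrable_integrable[OF square_integrable_mu[OF theta]] by simp
  have b: "mu.expectation (\<lambda>z. real_of_int z - b) = 0"
  proof -
    have "b = integral\<^sup>L (distr Stat ?mu (\<lambda>\<omega>. \<omega> 0)) real_of_int"
      unfolding b_def by (rule integral_distr[symmetric, OF measurable_Mu_component[OF theta]
          mu.square_integrable_measurable[OF square_integrable_mu[OF theta]]])
    hence "b = mu.expectation real_of_int" by (simp add: distr_Mu_component[OF theta])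
    thus ?thesis using mu.square_integrable_integrable[OF square_integrable_mu[OF theta]] mu.prob_space by simp
  qed
  have iK: "integrable Stat (\<lambda>X. \<Gamma> (X(0 := k)))"
    using measurable_compose[OF km \<Gamma>(1)] \<Gamma>(2)
    by (intro Mu.integrable_const_bound[where B = B]) (auto cong: measurable_cong_sets)
  have gm: "(\<lambda>\<omega>. \<Gamma> \<omega> * (real_of_int (\<omega> 0) - b)) \<in> borel_measurable conf"
    using \<Gamma>(1) by measurable
  have i0: "integrable Stat (\<lambda>\<omega>. \<Gamma> \<omega> * (real_of_int (\<omega> 0) - b))"
    using Mu.square_integrable_integrable[OF square_integrable_Mu_component[OF theta], of 0] \<Gamma>
    by (intro Bochner_Integration.integrable_bound[OF _ measurable_Stat[OF gm], of "\<lambda>\<omega>. B * (real_of_int (\<omega> 0) - b)"] AE_I2)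
       (auto simp: abs_mult intro!: mult_right_mono order_trans[OF \<Gamma>(2) abs_ge_self])
  have i1: "integrable (?mu \<Otimes>\<^sub>M Stat) (\<lambda>z. \<Gamma> (?r z) * (real_of_int (?r z 0) - b))"
    using i0 gm by (subst (asm) distr_Mu_resample[OF theta, of 0, symmetric]) (simp add: integrable_distr_eq[OF rm])
  have "Mu.expectation (\<lambda>\<omega>. \<Gamma> \<omega> * (real_of_int (\<omega> 0) - b))
      = (\<integral>\<omega>. \<Gamma> \<omega> * (real_of_int (\<omega> 0) - b) \<partial>distr (?mu \<Otimes>\<^sub>M Stat) conf ?r)"
    by (simp add: distr_Mu_resample[OF theta])
  also have "\<dots> = (\<integral>z. \<Gamma> (?r z) * (real_of_int (?r z 0) - b) \<partial>(?mu \<Otimes>\<^sub>M Stat))"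
    by (rule integral_distr[OF rm gm])
  finally have e: "Mu.expectation (\<lambda>\<omega>. \<Gamma> \<omega> * (real_of_int (\<omega> 0) - b))
      = (\<integral>z. \<Gamma> (?r z) * (real_of_int (?r z 0) - b) \<partial>(?mu \<Otimes>\<^sub>M Stat))" .
  have i2: "integrable (?mu \<Otimes>\<^sub>M Stat) (\<lambda>(z, X). (real_of_int z - b) * \<Gamma> (X(0 := k)))"
  proof (rule P.Fubini_integrable)
    have "(\<lambda>y. \<Gamma> ((snd y)(0 := k))) \<in> borel_measurable (?mu \<Otimes>\<^sub>M Stat)"
      using borel_measurable_integrable[OF iK] by (rule measurable_compose[OF measurable_snd])
    moreover have "(\<lambda>y. real_of_int (fst y) - b) \<in> borel_measurable (?mu \<Otimes>\<^sub>M Stat)"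
      using borel_measurable_integrable[OF im] by (rule measurable_compose[OF measurable_fst])
    ultimately show "(\<lambda>(z, X). (real_of_int z - b) * \<Gamma> (X(0 := k))) \<in> borel_measurable (?mu \<Otimes>\<^sub>M Stat)"
      by (simp add: split_beta')
    show "integrable ?mu (\<lambda>z. \<integral>X. norm (case (z, X) of (z, X) \<Rightarrow> (real_of_int z - b) * \<Gamma> (X(0 := k))) \<partial>Stat)"
      using im by (simp add: abs_mult)
  qed (simp add: iK)
  have "(\<integral>(z, X). (real_of_int z - b) * \<Gamma> (X(0 := k)) \<partial>(?mu \<Otimes>\<^sub>M Stat)) = (\<integral>z. \<integral>X. (real_of_int z - b) * \<Gamma> (X(0 := k)) \<partial>Stat \<partial>?mu)"
    using P.integral_fst'[OF i2] by simp
  also have "\<dots> = 0" using b by simp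
  finally have z: "(\<integral>(z, X). (real_of_int z - b) * \<Gamma> (X(0 := k)) \<partial>(?mu \<Otimes>\<^sub>M Stat)) = 0" .
  have "0 \<le> (\<integral>z. \<Gamma> (?r z) * (real_of_int (?r z 0) - b) - (case z of (z, X) \<Rightarrow> (real_of_int z - b) * \<Gamma> (X(0 := k))) \<partial>(?mu \<Otimes>\<^sub>M Stat))"
  proof (rule integral_nonneg_AE)
    show "AE z in ?mu \<Otimes>\<^sub>M Stat. 0 \<le> \<Gamma> (?r z) * (real_of_int (?r z 0) - b) - (case z of (z, X) \<Rightarrow> (real_of_int z - b) * \<Gamma> (X(0 := k)))"
      using aeW aeK
    proof eventually_elim
      case (elim y)
      obtain z X where y: "y = (z, X)" by (cases y)
      \<comment> \<open>An integer \<open>z\<close> with \<open>z \<ge> k\<close> is at least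
        \<open>b\<close>, and one with \<open>z < k\<close> is at most \<open>b\<close>; hence both
        factors always have the same sign.\<close>
      have "0 \<le> (\<Gamma> (X(0 := z)) - \<Gamma> (X(0 := k))) * (real_of_int z - b)"
      proof (cases "k \<le> z")
        case True
        hence "\<Gamma> (X(0 := k)) \<le> \<Gamma> (X(0 := z))" using elim y by (intro mono) (auto simp: le_fun_def)
        moreover have "b \<le> real_of_int z" using True by (simp add: k_def ceiling_le_iff)
        ultimately show ?thesis by simp
      next
        case False
        hence "\<Gamma> (X(0 := z)) \<le> \<Gamma> (X(0 := k))" using elim y by (intro mono) (auto simp: le_fun_def)
        moreover have "real_of_int z \<le> b" using False by (simp add: k_def) linarith
        ultimately show ?thesis by (simp add: mult_nonpos_nonpos)
      qed
      thus ?case by (simp add: y algebra_simps)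
    qed
  qed
  also have "\<dots> = (\<integral>z. \<Gamma> (?r z) * (real_of_int (?r z 0) - b) \<partial>(?mu \<Otimes>\<^sub>M Stat))"
    using z by (subst Bochner_Integration.integral_diff[OF i1 i2]) simp
  finally show ?thesis using e by (simp add: b_def)
qed

text \<open>Given the initial slopes, the mean of the clipped spin at time \<open>t\<close> is an
  increasing function of them by attractivity, and an increasing function correlates nonnegatively
  with one of the independent initial spins. Dominated convergence removes the clipping.\<close>

lemma cov_spin_nonneg:
  assumes t: "0 \<le> t"
  shows "0 \<le> cov M (spin h n t) (spin h 0 0)"
proof -
  define b where "b = Mu.expectation (\<lambda>\<omega>. real_of_int (\<omega> 0))"
  have m0: "M.expectation (spin h 0 0) = b"
    unfolding spin_eq b_def by (rule expectation_slope) auto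
  have nonneg: "0 \<le> M.expectation (\<lambda>w. clip K (spin h n t w) * (spin h 0 0 w - b))" for K
  proof -
    let ?\<psi> = "\<lambda>\<omega> :: int \<Rightarrow> int. clip K (real_of_int (\<omega> n))"
    define g where "g x = (\<integral>y. ?\<psi> (slope y) \<partial>S t x)" for x
    define \<Gamma> where "\<Gamma> \<omega> = (if \<omega> \<in> W then g (integrate \<omega>) else 0)" for \<omega>
    have \<psi>m: "?\<psi> \<in> borel_measurable conf" by measurable
    have \<psi>h: "(\<lambda>y. ?\<psi> (slope y)) \<in> borel_measurable (heights W)"
      by (rule measurable_compose[OF measurable_heights_slope \<psi>m])
    have le: "g x \<le> g x'" if "slope x \<in> W" "slope x' \<in> W" "slope x \<le> slope x'" for x x'
      unfolding g_def
    proof (rule order_preserving[OF t that \<psi>m])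
      show "bounded (range ?\<psi>)" by (rule boundedI[of _ "real K"]) (auto simp: clip_abs_le)
      show "mono ?\<psi>" 
        unfolding clip_def by (intro monoI max.mono min.mono order_refl) (simp add: le_fun_def)
    qed
    \<comment> \<open>The two starts have equal slopes, so order preservation applies in both
      directions and gives equality.\<close>
    have g\<Gamma>: "g x = \<Gamma> (slope x)" if "slope x \<in> W" for x
      using le[of x "integrate (slope x)"] le[of "integrate (slope x)" x] that
      by (simp add: \<Gamma>_def slope_integrate)
    have gm: "g \<in> borel_measurable (heights W)"
      unfolding g_def by (rule measurable_compose[OF measurable_prob_algebraD[OF kernel[OF t]] integral_measurable_subprob_algebra[OF \<psi>h]])
    have \<Gamma>m: "\<Gamma> \<in> borel_measurable conf"
      unfolding \<Gamma>_def using tempered_sets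
      by (subst measurable_restrict_space_iff[symmetric]) (auto intro: measurable_compose[OF measurable_integrate_heights gm])
    have gb: "\<bar>g x\<bar> \<le> real K" if "slope x \<in> W" for x
    proof -
      interpret K: prob_space "S t x" by (rule S_prob[OF t that])
      have "\<bar>g x\<bar> \<le> K.expectation (\<lambda>y. \<bar>?\<psi> (slope y)\<bar>)" unfolding g_def by (rule integral_abs_bound)
      also have "\<dots> \<le> real K"
        using \<psi>h clip_abs_le(1) by (intro K.integral_le_const K.integrable_const_bound[where B = "real K"] AE_I2)
          (auto simp: measurable_cong_sets[OF S_prob(2)[OF t that] refl])
      finally show ?thesis .
    qed
    have \<Gamma>b: "\<bar>\<Gamma> \<omega>\<bar> \<le> real K" for \<omega>
      unfolding \<Gamma>_def using gb[of "integrate \<omega>"] by (simp add: slope_integrate)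
    have \<Gamma>mono: "\<Gamma> \<omega> \<le> \<Gamma> \<omega>'" if "\<omega> \<in> W" "\<omega>' \<in> W" "\<omega> \<le> \<omega>'" for \<omega> \<omega>'
      using le[of "integrate \<omega>" "integrate \<omega>'"] that by (simp add: \<Gamma>_def slope_integrate)
    let ?G = "\<lambda>z. (real_of_int (slope (fst z) 0) - b) * ?\<psi> (slope (snd z))"
    have sl: "(\<lambda>x. real_of_int (slope x 0) - b) \<in> borel_measurable (heights W)"
      using measurable_compose[OF measurable_heights_slope measurable_spin_conf[of 0]] by simp
    have Gm: "?G \<in> borel_measurable (heights W \<Otimes>\<^sub>M heights W)"
      using measurable_compose[OF measurable_fst sl] measurable_compose[OF measurable_snd \<psi>h] by simp
    have sq: "square_integrable M (\<lambda>w. spin h 0 0 w - b)"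
      by (intro M.square_integrable_diff square_integrable_spin M.square_integrable_const) simp
    have sqc: "square_integrable M (\<lambda>w. clip K (spin h n t w))"
      by (rule M.square_integrable_bound[OF square_integrable_spin[OF t, of n]])
         (use M.square_integrable_measurable[OF square_integrable_spin[OF t, of n]] clip_abs_le(2) in auto)
    have Gi: "integrable M (\<lambda>w. ?G (h 0 w, h t w))"
      using M.square_integrable_mult_integrable[OF sq sqc] by (simp add: spin_def)
    have "M.expectation (\<lambda>w. clip K (spin h n t w) * (spin h 0 0 w - b)) = M.expectation (\<lambda>w. ?G (h 0 w, h t w))"
      by (simp add: spin_def mult.commute)
    also have "\<dots> = (\<integral>x. (real_of_int (slope x 0) - b) * g x \<partial>init)"
      unfolding integral_two_point(2)[OF t Gm Gi] by (simp add: g_def)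
    also have "\<dots> = (\<integral>x. \<Gamma> (slope x) * (real_of_int (slope x 0) - b) \<partial>init)"
      by (rule Bochner_Integration.integral_cong) (auto simp: g\<Gamma>)
    also have "\<dots> = (\<integral>\<omega>. \<Gamma> \<omega> * (real_of_int (\<omega> 0) - b) \<partial>distr init conf slope)"
      using \<Gamma>m by (intro integral_distr[symmetric]) (auto cong: measurable_cong_sets)
    also have "\<dots> \<ge> 0"
      unfolding distr_init_slope b_def by (rule monotone_expectation_nonneg[OF \<Gamma>m \<Gamma>b \<Gamma>mono])
    finally show ?thesis .
  qed
  have sq: "square_integrable M (\<lambda>w. spin h 0 0 w - b)"
    by (intro M.square_integrable_diff square_integrable_spin M.square_integrable_const) simp
  have mt: "spin h n t \<in> borel_measurable M" and ms: "(\<lambda>w. spin h 0 0 w - b) \<in> borel_measurable M"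
    using M.square_integrable_measurable square_integrable_spin[OF t] sq by auto
  have lim: "(\<lambda>K. M.expectation (\<lambda>w. clip K (spin h n t w) * (spin h 0 0 w - b)))
      \<longlonglongrightarrow> M.expectation (\<lambda>w. spin h n t w * (spin h 0 0 w - b))"
  proof (rule integral_dominated_convergence[where w = "\<lambda>w. \<bar>spin h n t w * (spin h 0 0 w - b)\<bar>"])
    show "integrable M (\<lambda>w. \<bar>spin h n t w * (spin h 0 0 w - b)\<bar>)"
      using M.square_integrable_mult_integrable[OF square_integrable_spin[OF t] sq] by simp
    show "AE w in M. (\<lambda>K. clip K (spin h n t w) * (spin h 0 0 w - b)) \<longlonglongrightarrow> spin h n t w * (spin h 0 0 w - b)"
      by (intro AE_I2 tendsto_mult clip_tendsto tendsto_const)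
    show "AE w in M. norm (clip K (spin h n t w) * (spin h 0 0 w - b)) \<le> \<bar>spin h n t w * (spin h 0 0 w - b)\<bar>" for K
      unfolding real_norm_def abs_mult by (intro AE_I2 mult_right_mono clip_abs_le) simp
    show "(\<lambda>w. clip K (spin h n t w) * (spin h 0 0 w - b)) \<in> borel_measurable M" for K
      by (intro borel_measurable_times ms measurable_compose[OF mt]) simp
  qed (intro borel_measurable_times mt ms)
  have "0 \<le> M.expectation (\<lambda>w. spin h n t w * (spin h 0 0 w - b))"
    by (rule LIMSEQ_le_const[OF lim]) (use nonneg in auto)
  also have "\<dots> = cov M (spin h n t) (\<lambda>w. spin h 0 0 w - b)"
    using m0 M.square_integrable_integrable[OF square_integrable_spin[of 0]]
    by (subst M.cov_eq[OF square_integrable_spin[OF t] sq]) (simp add: M.prob_space)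
  also have "\<dots> = cov M (spin h n t) (spin h 0 0)"
    using M.cov_diff_right[OF square_integrable_spin[of 0 0] M.square_integrable_const[of b] square_integrable_spin[OF t, of n]]
      M.cov_const_left[OF square_integrable_spin[OF t, of n], of b] M.cov_commute[of "\<lambda>w. b"]
    by simp
  finally show ?thesis .
qed

end

section \<open>Current and covariances\<close>

text \<open>In the covariance of two increments the product of the means is \<open>(s * c)^2\<close>
  when both means equal \<open>s * c\<close>; its derivative \<open>2 * (s * c^2)\<close> is
  subtracted under the time integral. Here \<open>c\<close> stands for the squared mean
  flux.\<close>

lemma set_integral_linear:
  fixes t c :: real
  assumes t: "0 \<le> t"
  shows "(LINT s:{0..t}|lborel. 2 * (s * c)) = t\<^sup>2 * c" "set_integrable lborel {0..t} (\<lambda>s. 2 * (s * c))"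
proof -
  have d: "DERIV (\<lambda>s. s\<^sup>2 * c) s :> 2 * (s * c)" for s
    by (auto intro!: derivative_eq_intros)
  have "isCont (\<lambda>s. 2 * (s * c)) s" for s by (intro continuous_intros)
  from integral_FTC_Icc_real[OF t, of "\<lambda>s. s\<^sup>2 * c" "\<lambda>s. 2 * (s * c)"] d this
  show "(LINT s:{0..t}|lborel. 2 * (s * c)) = t\<^sup>2 * c"
    unfolding set_lebesgue_integral_def by (simp add: mult.commute)
  show "set_integrable lborel {0..t} (\<lambda>s. 2 * (s * c))"
    by (intro borel_integrable_atLeastAtMost' continuous_intros)
qed

context stationary_dynamics
begin

lemma cov_spins_same_time:
  assumes s: "0 \<le> s"
  shows "cov M (spin h m s) (spin h n s) = (if m = n then cov M (spin h 0 0) (spin h 0 0) else 0)"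
proof -
  have e: "cov M (spin h m u) (spin h n u) = cov Stat (\<lambda>\<omega>. real_of_int (\<omega> m)) (\<lambda>\<omega>. real_of_int (\<omega> n))" if "0 \<le> u" for m n u
    unfolding spin_eq by (rule cov_slope[OF that]) auto
  show ?thesis
  proof (cases "m = n")
    case True
    have "cov (distr Stat conf (shift m)) (\<lambda>\<omega>. real_of_int (\<omega> 0)) (\<lambda>\<omega>. real_of_int (\<omega> 0))
        = cov Stat (\<lambda>\<omega>. real_of_int (shift m \<omega> 0)) (\<lambda>\<omega>. real_of_int (shift m \<omega> 0))"
      by (rule cov_distr) (auto cong: measurable_cong_sets)
    thus ?thesis using True by (simp add: e[OF s] e distr_Mu_shift[OF theta] shift_def)
  next
    case False
    thus ?thesis
      using cov_Mu_disjoint[OF theta, of "\<lambda>a b. real_of_int a" m m "\<lambda>a b. real_of_int a" n n]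
      by (simp add: e[OF s] square_integrable_Mu_component[OF theta])
  qed
qed

lemma cov_flux_same_time:
  assumes s: "0 \<le> s"
  shows "\<bar>m - n\<bar> \<ge> 2 \<Longrightarrow> cov M (flux m s) (flux n s) = 0"
    "cov M (flux n s) (flux n s) = cov Stat (net 0) (net 0)"
proof -
  have e: "cov M (flux m s) (flux n s) = cov Stat (net m) (net n)" for m n
    unfolding flux_def[abs_def] by (rule cov_slope[OF s]) auto
  have net: "net n = (\<lambda>\<omega>. (\<lambda>a b. p a b - q a b) (\<omega> n) (\<omega> (n + 1)))" for n
    by (simp add: net_def fun_eq_iff)
  show "cov M (flux m s) (flux n s) = 0" if "\<bar>m - n\<bar> \<ge> 2"
    unfolding e net
    by (rule cov_Mu_disjoint[OF theta]) (use that square_integrable_net in \<open>auto simp: net_def[abs_def]\<close>)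
  have "cov (distr Stat conf (shift n)) (net 0) (net 0) = cov Stat (\<lambda>\<omega>. net 0 (shift n \<omega>)) (\<lambda>\<omega>. net 0 (shift n \<omega>))"
    by (rule cov_distr) (auto cong: measurable_cong_sets)
  moreover have "(\<lambda>\<omega>. net 0 (shift n \<omega>)) = net n" by (simp add: net_def shift_def fun_eq_iff add.commute)
  ultimately show "cov M (flux n s) (flux n s) = cov Stat (net 0) (net 0)"
    by (simp add: e distr_Mu_shift[OF theta])
qed

text \<open>A flux involves two neighbouring spins, so at a fixed time the fluxes have correlation
  range 2 and the Bessel argument applies.\<close>

lemma cov_flux_tendsto_0:
  assumes s: "0 \<le> s" and Y: "square_integrable M Y" and e: "inj (e :: nat \<Rightarrow> int)"
  shows "(\<lambda>N. cov M Y (flux (e N) s)) \<longlonglongrightarrow> 0"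
proof (rule M.cov_finite_range_tendsto_0[where X = "\<lambda>n. flux n s" and L = 2 and C = "cov Stat (net 0) (net 0)", OF _ Y _ _ e])
  show "square_integrable M (flux n s)" for n by (rule square_integrable_flux[OF s])
  show "cov M (flux m s) (flux n s) = 0" if "2 \<le> \<bar>m - n\<bar>" for m n by (rule cov_flux_same_time(1)[OF s that])
  show "cov M (flux n s) (flux n s) \<le> cov Stat (net 0) (net 0)" for n by (rule eq_refl[OF cov_flux_same_time(2)[OF s]])
qed

lemma cov_spin_tendsto_0:
  assumes s: "0 \<le> s" and Y: "square_integrable M Y" and e: "inj (e :: nat \<Rightarrow> int)"
  shows "(\<lambda>N. cov M Y (spin h (e N) s)) \<longlonglongrightarrow> 0"
proof (rule M.cov_finite_range_tendsto_0[where X = "\<lambda>n. spin h n s" and L = 1 and C = "cov M (spin h 0 0) (spin h 0 0)", OF _ Y _ _ e])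
  show "square_integrable M (spin h n s)" for n by (rule square_integrable_spin[OF s])
  show "cov M (spin h m s) (spin h n s) = 0" if "1 \<le> \<bar>m - n\<bar>" for m n
    using that cov_spins_same_time[OF s, of m n] by auto
  show "cov M (spin h n s) (spin h n s) \<le> cov M (spin h 0 0) (spin h 0 0)" for n
    using cov_spins_same_time[OF s, of n n] by simp
qed

lemma cov_shift:
  fixes X Y :: "(int \<Rightarrow> int) \<times> (int \<Rightarrow> int) \<Rightarrow> real"
  assumes s: "0 \<le> s" and X: "X \<in> borel_measurable (conf \<Otimes>\<^sub>M conf)" and Y: "Y \<in> borel_measurable (conf \<Otimes>\<^sub>M conf)"
  shows "cov M (\<lambda>w. X (shift k (slope (h 0 w)), shift k (increment (h 0 w) (h s w))))
      (\<lambda>w. Y (shift k (slope (h 0 w)), shift k (increment (h 0 w) (h s w))))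
    = cov M (\<lambda>w. X (slope (h 0 w), increment (h 0 w) (h s w))) (\<lambda>w. Y (slope (h 0 w), increment (h 0 w) (h s w)))"
proof -
  let ?\<Phi> = "\<lambda>w. (slope (h 0 w), increment (h 0 w) (h s w))" and ?\<tau> = "\<lambda>(a, b). (shift k a, shift k b)"
  let ?P = "distr M (conf \<Otimes>\<^sub>M conf) ?\<Phi>"
  note \<Phi> = measurable_slope_increment_h[OF s]
  have X\<tau>: "(\<lambda>z. X (?\<tau> z)) \<in> borel_measurable (conf \<Otimes>\<^sub>M conf)" and Y\<tau>: "(\<lambda>z. Y (?\<tau> z)) \<in> borel_measurable (conf \<Otimes>\<^sub>M conf)"
    using measurable_compose[OF measurable_shift_pair] X Y by auto
  have "cov M (\<lambda>w. X (?\<Phi> w)) (\<lambda>w. Y (?\<Phi> w)) = cov ?P X Y" by (rule cov_distr[OF \<Phi> X Y, symmetric])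
  also have "\<dots> = cov (distr ?P (conf \<Otimes>\<^sub>M conf) ?\<tau>) X Y" unfolding shift_invariance[OF s] ..
  also have "\<dots> = cov ?P (\<lambda>z. X (?\<tau> z)) (\<lambda>z. Y (?\<tau> z))"
    by (rule cov_distr[OF _ X Y]) (use measurable_shift_pair in \<open>simp cong: measurable_cong_sets\<close>)
  also have "\<dots> = cov M (\<lambda>w. X (?\<tau> (?\<Phi> w))) (\<lambda>w. Y (?\<tau> (?\<Phi> w)))" by (rule cov_distr[OF \<Phi> X\<tau> Y\<tau>])
  finally show ?thesis by simp
qed

lemma cov_rise_net_shift:
  assumes s: "0 \<le> s"
  shows "cov M (rise (i + k) s) (flux (j + k) s) = cov M (rise i s) (flux j s)"
proof -
  have "cov M (\<lambda>w. real_of_int (snd (shift k (slope (h 0 w)), shift k (increment (h 0 w) (h s w))) i))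
      (\<lambda>w. net j (final_slope (shift k (slope (h 0 w)), shift k (increment (h 0 w) (h s w)))))
    = cov M (\<lambda>w. real_of_int (snd (slope (h 0 w), increment (h 0 w) (h s w)) i))
      (\<lambda>w. net j (final_slope (slope (h 0 w), increment (h 0 w) (h s w))))"
    by (rule cov_shift[OF s, of "\<lambda>z. real_of_int (snd z i)" "\<lambda>z. net j (final_slope z)"])
       (auto intro: measurable_compose[OF measurable_snd measurable_spin_conf] measurable_compose[OF measurable_final_slope measurable_net])
  moreover have "net j (shift k \<omega>) = net (j + k) \<omega>" for \<omega> by (simp add: net_def shift_def ac_simps)
  ultimately show ?thesis
    by (simp add: rise_def[abs_def] flux_def[abs_def]) (simp add: shift_def)
qed

lemma cov_rise_spin_shift:
  assumes s: "0 \<le> s"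
  shows "cov M (rise (i + k) s) (spin h (j + k) s) = cov M (rise i s) (spin h j s)"
proof -
  have "cov M (\<lambda>w. real_of_int (snd (shift k (slope (h 0 w)), shift k (increment (h 0 w) (h s w))) i))
      (\<lambda>w. real_of_int (final_slope (shift k (slope (h 0 w)), shift k (increment (h 0 w) (h s w))) j))
    = cov M (\<lambda>w. real_of_int (snd (slope (h 0 w), increment (h 0 w) (h s w)) i))
      (\<lambda>w. real_of_int (final_slope (slope (h 0 w), increment (h 0 w) (h s w)) j))"
    by (rule cov_shift[OF s, of "\<lambda>z. real_of_int (snd z i)" "\<lambda>z. real_of_int (final_slope z j)"])
       (auto intro: measurable_compose[OF measurable_snd measurable_spin_conf] measurable_compose[OF measurable_final_slope measurable_spin_conf])
  thus ?thesis by (simp add: rise_def[abs_def] spin_def[abs_def]) (simp add: shift_def)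
qed

lemma cov_spin_spin_shift:
  assumes s: "0 \<le> s"
  shows "cov M (spin h (i + k) s) (spin h (j + k) 0) = cov M (spin h i s) (spin h j 0)"
proof -
  have "cov M (\<lambda>w. real_of_int (final_slope (shift k (slope (h 0 w)), shift k (increment (h 0 w) (h s w))) i))
      (\<lambda>w. real_of_int (fst (shift k (slope (h 0 w)), shift k (increment (h 0 w) (h s w))) j))
    = cov M (\<lambda>w. real_of_int (final_slope (slope (h 0 w), increment (h 0 w) (h s w)) i))
      (\<lambda>w. real_of_int (fst (slope (h 0 w), increment (h 0 w) (h s w)) j))"
    by (rule cov_shift[OF s, of "\<lambda>z. real_of_int (final_slope z i)" "\<lambda>z. real_of_int (fst z j)"])
       (auto intro: measurable_compose[OF measurable_fst measurable_spin_conf] measurable_compose[OF measurable_final_slope measurable_spin_conf])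
  thus ?thesis by (simp add: spin_def[abs_def]) (simp add: shift_def)
qed

section \<open>Asymptotic decorrelation of the currents\<close>

definition profile :: "int \<Rightarrow> int \<Rightarrow> real \<Rightarrow> 'a \<Rightarrow> real" where
  "profile x k s w = real_of_int (h s w (x + k) - h s w k)"

text \<open>The \<open>A_k\<close> of the overview; the current is the case \<open>k = 0\<close>. It
  splits into the increment at \<open>k\<close> and a \<open>profile\<close>, which is a signed sum
  of \<open>\<bar>x\<bar>\<close> spins at one time and can be treated spin by spin.\<close>

definition drift :: "int \<Rightarrow> int \<Rightarrow> real \<Rightarrow> 'a \<Rightarrow> real" where
  "drift x k s w = real_of_int (h s w (x + k) - h 0 w k)"

lemma drift_eq: "drift x k s = (\<lambda>w. rise k s w + profile x k s w)"
  by (simp add: drift_def rise_def increment_def profile_def fun_eq_iff)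

lemma profile_pos: "profile (int N) k s = (\<lambda>w. - (\<Sum>i=1..int N. spin h (i + k) s w))"
proof
  fix w
  have "profile (int N) k s w = - real_of_int (h s w k - h s w (k + int N))" by (simp add: profile_def add.commute)
  thus "profile (int N) k s w = - (\<Sum>i=1..int N. spin h (i + k) s w)"
    unfolding height_difference by (simp add: spin_def)
qed

lemma profile_neg: "profile (- int N) k s = (\<lambda>w. \<Sum>i=1..int N. spin h (i - int N + k) s w)"
proof
  fix w
  have "profile (- int N) k s w = real_of_int (h s w (k - int N) - h s w (k - int N + int N))" by (simp add: profile_def)
  thus "profile (- int N) k s w = (\<Sum>i=1..int N. spin h (i - int N + k) s w)"
    unfolding height_difference by (simp add: spin_def algebra_simps)
qed

lemma square_integrable_profile:
  assumes "0 \<le> s" shows "square_integrable M (profile x k s)"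
proof (cases x rule: int_cases2)
  case (nonneg N)
  thus ?thesis using assms by (auto simp: profile_pos intro!: M.square_integrable_minus M.square_integrable_sum square_integrable_spin)
next
  case (nonpos N)
  thus ?thesis using assms by (auto simp: profile_neg intro!: M.square_integrable_sum square_integrable_spin)
qed

lemma square_integrable_drift: "0 \<le> s \<Longrightarrow> square_integrable M (drift x k s)"
  unfolding drift_eq by (intro M.square_integrable_add square_integrable_rise square_integrable_profile)

lemma cov_profile_tendsto_0:
  assumes s: "0 \<le> s" and Y: "square_integrable M Y"
  shows "(\<lambda>N. cov M Y (profile x (int N) s)) \<longlonglongrightarrow> 0"
proof (cases x rule: int_cases2)
  case (nonneg n)
  have "cov M Y (profile x (int N) s) = - (\<Sum>i=1..int n. cov M Y (spin h (i + int N) s))" for N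
    unfolding nonneg profile_pos using Y s
    by (simp add: M.cov_commute[of Y] M.cov_minus_left M.cov_sum_left M.square_integrable_sum square_integrable_spin)
  moreover have "(\<lambda>N. - (\<Sum>i=1..int n. cov M Y (spin h (i + int N) s))) \<longlonglongrightarrow> - (\<Sum>i=1..int n. 0)"
    by (intro tendsto_minus tendsto_sum cov_spin_tendsto_0 s Y) (simp add: inj_def)
  ultimately show ?thesis by simp
next
  case (nonpos n)
  have "cov M Y (profile x (int N) s) = (\<Sum>i=1..int n. cov M Y (spin h (i - int n + int N) s))" for N
    unfolding nonpos profile_neg using Y s
    by (simp add: M.cov_commute[of Y] M.cov_sum_left square_integrable_spin)
  moreover have "(\<lambda>N. (\<Sum>i=1..int n. cov M Y (spin h (i - int n + int N) s))) \<longlonglongrightarrow> (\<Sum>i=1..int n. 0)"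
    by (intro tendsto_sum cov_spin_tendsto_0 s Y) (simp add: inj_def)
  ultimately show ?thesis by simp
qed

text \<open>Translation by \<open>N\<close> moves the distance from the increment to the spins. The
  increment is then a fixed square-integrable variable tested against spins that move away.\<close>

lemma cov_profile_rise_tendsto_0:
  assumes s: "0 \<le> s"
  shows "(\<lambda>N. cov M (rise (int N) s) (profile x 0 s)) \<longlonglongrightarrow> 0"
proof -
  have sh: "cov M (rise (int N) s) (spin h i s) = cov M (rise 0 s) (spin h (i - int N) s)" for i N
    using cov_rise_spin_shift[OF s, of 0 "int N" "i - int N"] by simp
  have inj: "inj (\<lambda>N. i - int N)" for i by (simp add: inj_def)
  note lim = cov_spin_tendsto_0[OF s square_integrable_rise[OF s] inj]
  show ?thesis
  proof (cases x rule: int_cases2)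
    case (nonneg n)
    have "cov M (rise (int N) s) (profile x 0 s) = - (\<Sum>i=1..int n. cov M (rise 0 s) (spin h (i - int N) s))" for N
      unfolding nonneg profile_pos sh[symmetric] using s
      by (simp add: M.cov_commute[of "rise (int N) s"] M.cov_minus_left M.cov_sum_left M.square_integrable_sum square_integrable_spin square_integrable_rise)
    moreover have "(\<lambda>N. - (\<Sum>i=1..int n. cov M (rise 0 s) (spin h (i - int N) s))) \<longlonglongrightarrow> - (\<Sum>i=1..int n. 0)"
      by (intro tendsto_minus tendsto_sum lim)
    ultimately show ?thesis by simp
  next
    case (nonpos n)
    have "cov M (rise (int N) s) (profile x 0 s) = (\<Sum>i=1..int n. cov M (rise 0 s) (spin h (i - int n - int N) s))" for N
      unfolding nonpos profile_neg sh[symmetric] using s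
      by (simp add: M.cov_commute[of "rise (int N) s"] M.cov_sum_left square_integrable_spin square_integrable_rise)
    moreover have "(\<lambda>N. (\<Sum>i=1..int n. cov M (rise 0 s) (spin h (i - int n - int N) s))) \<longlonglongrightarrow> (\<Sum>i=1..int n. 0)"
      by (intro tendsto_sum lim)
    ultimately show ?thesis by simp
  qed
qed

abbreviation \<rho> :: real where "\<rho> \<equiv> Mu.expectation (net 0)"

lemma expectation_flux: "0 \<le> s \<Longrightarrow> M.expectation (flux i s) = \<rho>"
proof -
  assume s: "0 \<le> s"
  have "M.expectation (flux i s) = Mu.expectation (net i)"
    unfolding flux_def[abs_def] by (rule expectation_slope[OF s]) auto
  also have "net i = (\<lambda>\<omega>. net 0 (shift i \<omega>))" by (simp add: net_def shift_def fun_eq_iff add.commute)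
  also have "Mu.expectation (\<lambda>\<omega>. net 0 (shift i \<omega>)) = integral\<^sup>L (distr Stat conf (shift i)) (net 0)"
    by (rule integral_distr[symmetric]) (auto cong: measurable_cong_sets)
  finally show ?thesis by (simp add: distr_Mu_shift[OF theta])
qed

lemma expectation_rise:
  assumes t: "0 \<le> t"
  shows "M.expectation (rise i t) = t * \<rho>"
proof -
  have "M.expectation (rise i t) = (LINT s:{0..t}|lborel. M.expectation (flux i s))"
    using expectation_initial_rise(1)[OF t, of "\<lambda>_. 1" i] by simp
  also have "\<dots> = (LINT s:{0..t}|lborel. \<rho>)"
    unfolding set_lebesgue_integral_def
    by (rule Bochner_Integration.integral_cong) (auto simp: expectation_flux indicator_def)
  also have "\<dots> = t * \<rho>" using t by (simp add: set_lebesgue_integral_def)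
  finally show ?thesis .
qed

lemma cov_initial_rise:
  assumes t: "0 \<le> t" and g: "g \<in> borel_measurable (heights W)" "square_integrable M (\<lambda>w. g (h 0 w))"
  shows "cov M (\<lambda>w. g (h 0 w)) (rise i t) = (LINT s:{0..t}|lborel. cov M (\<lambda>w. g (h 0 w)) (flux i s))"
    "set_integrable lborel {0..t} (\<lambda>s. cov M (\<lambda>w. g (h 0 w)) (flux i s))"
proof -
  let ?m = "M.expectation (\<lambda>w. g (h 0 w))"
  have c: "indicator {0..t} s *\<^sub>R cov M (\<lambda>w. g (h 0 w)) (flux i s)
      = indicator {0..t} s *\<^sub>R (M.expectation (\<lambda>w. g (h 0 w) * flux i s w) - ?m * \<rho>)" for s
    by (cases "s \<in> {0..t}") (auto simp: M.cov_eq[OF g(2) square_integrable_flux] expectation_flux)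
  have i: "set_integrable lborel {0..t} (\<lambda>s. M.expectation (\<lambda>w. g (h 0 w) * flux i s w))"
    by (rule expectation_initial_rise(2)[OF t g])
  have k: "set_integrable lborel {0..t} (\<lambda>s. ?m * \<rho>)" using t by (simp add: set_integrable_def)
  show "set_integrable lborel {0..t} (\<lambda>s. cov M (\<lambda>w. g (h 0 w)) (flux i s))"
    using set_integral_diff(1)[OF i k] unfolding set_integrable_def c .
  have "cov M (\<lambda>w. g (h 0 w)) (rise i t) = (LINT s:{0..t}|lborel. M.expectation (\<lambda>w. g (h 0 w) * flux i s w)) - (LINT s:{0..t}|lborel. ?m * \<rho>)"
    using t by (simp add: M.cov_eq[OF g(2) square_integrable_rise[OF t]] expectation_initial_rise(1)[OF t g] expectation_rise
        set_lebesgue_integral_def)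
  also have "\<dots> = (LINT s:{0..t}|lborel. M.expectation (\<lambda>w. g (h 0 w) * flux i s w) - ?m * \<rho>)"
    by (rule set_integral_diff(2)[OF i k, symmetric])
  finally show "cov M (\<lambda>w. g (h 0 w)) (rise i t) = (LINT s:{0..t}|lborel. cov M (\<lambda>w. g (h 0 w)) (flux i s))"
    unfolding set_lebesgue_integral_def c .
qed

lemma cov_rise_rise:
  assumes ij: "i \<noteq> j" and t: "0 < t"
  shows "cov M (rise i t) (rise j t) = (LINT s:{0..t}|lborel. cov M (rise j s) (flux i s) + cov M (rise i s) (flux j s))"
    "set_integrable lborel {0..t} (\<lambda>s. cov M (rise j s) (flux i s) + cov M (rise i s) (flux j s))"
proof -
  have t0: "0 \<le> t" using t by simp
  have c: "indicator {0..t} s *\<^sub>R (cov M (rise j s) (flux i s) + cov M (rise i s) (flux j s))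
      = indicator {0..t} s *\<^sub>R (M.expectation (\<lambda>w. flux i s w * rise j s w) + M.expectation (\<lambda>w. flux j s w * rise i s w) - 2 * (s * \<rho>\<^sup>2))" for s
    by (cases "s \<in> {0..t}")
       (auto simp: M.cov_eq square_integrable_rise square_integrable_flux expectation_flux expectation_rise power2_eq_square mult.commute)
  note i = expectation_rise_rise(2)[OF ij t] and k = set_integral_linear(2)[OF t0, of "\<rho>\<^sup>2"]
  show "set_integrable lborel {0..t} (\<lambda>s. cov M (rise j s) (flux i s) + cov M (rise i s) (flux j s))"
    using set_integral_diff(1)[OF i k] unfolding set_integrable_def c .
  have "cov M (rise i t) (rise j t) = (LINT s:{0..t}|lborel. M.expectation (\<lambda>w. flux i s w * rise j s w) + M.expectation (\<lambda>w. flux j s w * rise i s w))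
      - (LINT s:{0..t}|lborel. 2 * (s * \<rho>\<^sup>2))"
    unfolding M.cov_eq[OF square_integrable_rise[OF t0] square_integrable_rise[OF t0]] expectation_rise[OF t0]
      expectation_rise_rise(1)[OF ij t] set_integral_linear(1)[OF t0] by (simp add: power2_eq_square)
  also have "\<dots> = (LINT s:{0..t}|lborel. M.expectation (\<lambda>w. flux i s w * rise j s w) + M.expectation (\<lambda>w. flux j s w * rise i s w) - 2 * (s * \<rho>\<^sup>2))"
    by (rule set_integral_diff(2)[OF i k, symmetric])
  finally show "cov M (rise i t) (rise j t) = (LINT s:{0..t}|lborel. cov M (rise j s) (flux i s) + cov M (rise i s) (flux j s))"
    unfolding set_lebesgue_integral_def c .
qed

text \<open>The dominating constant for limits taken under time integrals. It is uniform in the site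
  because all fluxes have the same variance, and in time by the second-moment bound for
  increments.\<close>

lemma cov_rise_flux_bound:
  assumes t: "0 < t"
  shows "\<exists>C. \<forall>s\<in>{0..t}. \<forall>i. \<bar>cov M (rise 0 s) (flux i s)\<bar> \<le> C"
proof -
  obtain C where C: "\<And>s. s \<in> {0..t} \<Longrightarrow> M.expectation (\<lambda>w. (rise 0 s w)\<^sup>2) \<le> C"
    using square_integrable_rise_bound[OF t, of 0] by blast
  have "\<bar>cov M (rise 0 s) (flux i s)\<bar> \<le> (C + cov Stat (net 0) (net 0)) / 2" if s: "s \<in> {0..t}" for s i
  proof -
    have s0: "0 \<le> s" using s by simp
    have "cov M (rise 0 s) (rise 0 s) = M.expectation (\<lambda>w. (rise 0 s w)\<^sup>2) - (M.expectation (rise 0 s))\<^sup>2"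
      using square_integrable_rise[OF s0] by (simp add: M.cov_eq power2_eq_square)
    also have "\<dots> \<le> C" using C[OF s] zero_le_power2[of "M.expectation (rise 0 s)"] by linarith
    finally have "cov M (rise 0 s) (rise 0 s) \<le> C" .
    moreover have "\<bar>cov M (rise 0 s) (flux i s)\<bar> \<le> (cov M (rise 0 s) (rise 0 s) + cov M (flux i s) (flux i s)) / 2"
      by (rule M.cov_abs_le[OF square_integrable_rise[OF s0] square_integrable_flux[OF s0]])
    ultimately show ?thesis by (simp add: cov_flux_same_time(2)[OF s0])
  qed
  thus ?thesis by blast
qed

text \<open>The Bessel argument needs a fixed variable tested against moving fluxes; this exchanges
  a moving increment for a moving flux.\<close>

lemma cov_rise_flux_reflect: "0 \<le> s \<Longrightarrow> cov M (rise i s) (flux 0 s) = cov M (rise 0 s) (flux (- i) s)"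
  using cov_rise_net_shift[of s 0 i "- i"] by simp

text \<open>The injective sequence \<open>e\<close> allows the second site to escape in either
  direction; it must avoid 0 because the product formula requires distinct sites.\<close>

lemma cov_rise_rise_tendsto_0:
  assumes t: "0 < t" and e: "inj (e :: nat \<Rightarrow> int)" and e0: "\<And>N. e N \<noteq> 0"
  shows "(\<lambda>N. cov M (rise 0 t) (rise (e N) t)) \<longlonglongrightarrow> 0"
proof -
  obtain C where C: "\<And>s i. s \<in> {0..t} \<Longrightarrow> \<bar>cov M (rise 0 s) (flux i s)\<bar> \<le> C"
    using cov_rise_flux_bound[OF t] by blast
  let ?g = "\<lambda>N s. indicator {0..t} s *\<^sub>R (cov M (rise (e N) s) (flux 0 s) + cov M (rise 0 s) (flux (e N) s))"
  have g: "?g N s = indicator {0..t} s *\<^sub>R (cov M (rise 0 s) (flux (- e N) s) + cov M (rise 0 s) (flux (e N) s))" for N s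
    by (cases "s \<in> {0..t}") (auto simp: cov_rise_flux_reflect)
  have einj: "inj (\<lambda>N. - e N)" using e by (simp add: inj_def)
  have "(\<lambda>N. \<integral>s. ?g N s \<partial>lborel) \<longlonglongrightarrow> integral\<^sup>L lborel (\<lambda>s :: real. 0)"
  proof (rule integral_dominated_convergence[where w = "\<lambda>s. indicator {0..t} s * (2 * C)"])
    show "?g N \<in> borel_measurable lborel" for N
      using cov_rise_rise(2)[OF e0[symmetric] t, of N] unfolding set_integrable_def by (rule borel_measurable_integrable)
    show "integrable lborel (\<lambda>s. indicator {0..t} s * (2 * C))"
      using t by (intro integrable_mult_left integrable_real_indicator) auto
    show "AE s in lborel. (\<lambda>N. ?g N s) \<longlonglongrightarrow> 0"
    proof (rule AE_I2)
      fix s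
      show "(\<lambda>N. ?g N s) \<longlonglongrightarrow> 0"
      proof (cases "s \<in> {0..t}")
        case True
        hence s: "0 \<le> s" by simp
        have "(\<lambda>N. cov M (rise 0 s) (flux (- e N) s) + cov M (rise 0 s) (flux (e N) s)) \<longlonglongrightarrow> 0 + 0"
          by (intro tendsto_add cov_flux_tendsto_0 s square_integrable_rise e einj)
        thus ?thesis unfolding g using True by simp
      qed simp
    qed
    show "AE s in lborel. norm (?g N s) \<le> indicator {0..t} s * (2 * C)" for N
    proof (rule AE_I2)
      fix s
      show "norm (?g N s) \<le> indicator {0..t} s * (2 * C)"
        unfolding g using C[of s "- e N"] C[of s "e N"] by (cases "s \<in> {0..t}") auto
    qed
  qed simp
  moreover have "cov M (rise 0 t) (rise (e N) t) = (\<integral>s. ?g N s \<partial>lborel)" for N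
    using cov_rise_rise(1)[OF e0[symmetric] t, of N] by (simp add: set_lebesgue_integral_def)
  ultimately show ?thesis by simp
qed

lemma cov_drift_tendsto_0:
  assumes t: "0 < t"
  shows "(\<lambda>N. cov M (drift x 0 t) (drift x (int N) t)) \<longlonglongrightarrow> 0"
proof -
  have t0: "0 \<le> t" using t by simp
  note sq = square_integrable_rise[OF t0] square_integrable_profile[OF t0]
  \<comment> \<open>The index starts at 1 since at \<open>N = 0\<close> both increments belong to
    the same site.\<close>
  have "(\<lambda>N. cov M (rise 0 t) (rise (int (Suc N)) t)) \<longlonglongrightarrow> 0"
    by (rule cov_rise_rise_tendsto_0[OF t]) (auto simp: inj_def)
  hence "(\<lambda>N. cov M (rise 0 t) (rise (int N) t)) \<longlonglongrightarrow> 0" by (rule LIMSEQ_imp_Suc)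
  moreover have "(\<lambda>N. cov M (rise 0 t) (profile x (int N) t)) \<longlonglongrightarrow> 0"
    by (rule cov_profile_tendsto_0[OF t0 sq(1)])
  moreover have "(\<lambda>N. cov M (rise (int N) t) (profile x 0 t)) \<longlonglongrightarrow> 0"
    by (rule cov_profile_rise_tendsto_0[OF t0])
  moreover have "(\<lambda>N. cov M (profile x 0 t) (profile x (int N) t)) \<longlonglongrightarrow> 0"
    by (rule cov_profile_tendsto_0[OF t0 sq(2)])
  ultimately have "(\<lambda>N. cov M (rise 0 t) (rise (int N) t) + cov M (rise 0 t) (profile x (int N) t)
      + (cov M (rise (int N) t) (profile x 0 t) + cov M (profile x 0 t) (profile x (int N) t))) \<longlonglongrightarrow> 0 + 0 + (0 + 0)"
    by (intro tendsto_add)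
  moreover have "cov M (drift x 0 t) (drift x (int N) t) = cov M (rise 0 t) (rise (int N) t) + cov M (rise 0 t) (profile x (int N) t)
      + (cov M (rise (int N) t) (profile x 0 t) + cov M (profile x 0 t) (profile x (int N) t))" for N
    unfolding drift_eq
    by (simp add: M.cov_add_left M.cov_add_right sq M.square_integrable_add M.cov_commute[of "profile x 0 t" "rise (int N) t"])
  ultimately show ?thesis by simp
qed

text \<open>\<open>drift x k t\<close> is the increment at \<open>k\<close> plus the height
  difference between \<open>x + k\<close> and \<open>k\<close> at time \<open>t\<close>. Both are
  functions of the pair of initial slopes and increments shifted by \<open>k\<close>, the latter
  through \<open>integrate\<close>, so the absolute height does not enter.\<close>

lemma cov_drift_shift:
  assumes t: "0 \<le> t"
  shows "cov M (drift x k t) (drift x k t) = cov M (drift x 0 t) (drift x 0 t)"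
proof -
  let ?X = "\<lambda>z. real_of_int (snd z 0) + real_of_int (integrate (final_slope z) x)"
  have X: "?X \<in> borel_measurable (conf \<Otimes>\<^sub>M conf)"
    by (intro borel_measurable_add measurable_compose[OF measurable_snd measurable_spin_conf]
        measurable_compose[OF measurable_compose[OF measurable_final_slope measurable_integrate] measurable_spin_conf])
  have "drift x k t = (\<lambda>w. ?X (shift k (slope (h 0 w)), shift k (increment (h 0 w) (h t w))))" for k
  proof
    fix w
    have "shift k (h t w) x = integrate (slope (shift k (h t w))) x + shift k (h t w) 0"
      using fun_cong[OF eq_integrate_slope[of "shift k (h t w)"], of x] .
    hence e: "h t w (x + k) = integrate (shift k (slope (h t w))) x + h t w k"
      unfolding slope_shift by (simp add: shift_def)
    have "drift x k t w = real_of_int (increment (h 0 w) (h t w) k) + real_of_int (integrate (shift k (slope (h t w))) x)"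
      unfolding drift_def e by (simp add: increment_def)
    thus "drift x k t w = ?X (shift k (slope (h 0 w)), shift k (increment (h 0 w) (h t w)))"
      by (simp only: final_slope_shift final_slope_increment snd_conv) (simp add: shift_def)
  qed
  from this[of k] this[of 0] cov_shift[OF t X X, of k] cov_shift[OF t X X, of 0]
  show ?thesis by (simp only:)
qed

section \<open>The variance of the current as a sum of covariances\<close>

lemma variance_spin_sum:
  assumes s: "0 \<le> s" and g: "inj g"
  shows "cov M (\<lambda>w. \<Sum>i=1..int N. spin h (g i) s w) (\<lambda>w. \<Sum>i=1..int N. spin h (g i) s w)
    = real N * cov M (spin h 0 0) (spin h 0 0)"
proof -
  have e: "cov M (spin h (g i) s) (spin h (g j) s) = (if i = j then cov M (spin h 0 0) (spin h 0 0) else 0)" for i j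
    unfolding cov_spins_same_time[OF s] inj_eq[OF g] ..
  have "cov M (\<lambda>w. \<Sum>i=1..int N. spin h (g i) s w) (\<lambda>w. \<Sum>i=1..int N. spin h (g i) s w)
      = (\<Sum>i=1..int N. \<Sum>j=1..int N. cov M (spin h (g i) s) (spin h (g j) s))"
    using s by (simp add: M.cov_sum_left M.cov_sum_right square_integrable_spin M.square_integrable_sum)
  thus ?thesis unfolding e by simp
qed

definition spin_cov :: "real \<Rightarrow> int \<Rightarrow> real" where
  "spin_cov t n = cov M (spin h n t) (spin h 0 0)"

lemma variance_drift_has_sum:
  assumes t: "0 < t"
  shows "((\<lambda>n. real_of_int \<bar>x - n\<bar> * spin_cov t n) has_sum cov M (drift x 0 t) (drift x 0 t)) UNIV"
proof -
  have t0: "0 \<le> t" using t by simp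
  let ?v = "cov M (spin h 0 0) (spin h 0 0)" and ?V = "cov M (drift x 0 t) (drift x 0 t)"
  have eq: "?V - cov M (drift x 0 t) (drift x (int N) t)
      = real N * ?v - (\<Sum>i=1..int N. \<Sum>j=1..int N. spin_cov t (x + (i - j)))" for N
  proof -
    have square: "cov M (\<lambda>w. P w - Q w) (\<lambda>w. P w - Q w) = cov M P P + cov M Q Q - 2 * cov M P Q"
      if "square_integrable M P" "square_integrable M Q" for P Q
      using that by (simp add: M.cov_diff_left M.cov_diff_right M.square_integrable_diff M.cov_commute[of Q P])
    let ?P = "\<lambda>w. \<Sum>i=1..int N. spin h (i + x) t w" and ?Q = "\<lambda>w. \<Sum>i=1..int N. spin h (i + 0) 0 w"
    have P: "square_integrable M ?P" and Q: "square_integrable M ?Q"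
      by (intro M.square_integrable_sum square_integrable_spin t0 order_refl)+
    have diff: "(\<lambda>w. drift x 0 t w - drift x (int N) t w) = (\<lambda>w. ?P w - ?Q w)"
    proof
      fix w
      have "drift x 0 t w - drift x (int N) t w
          = real_of_int (h t w x - h t w (x + int N)) - real_of_int (h 0 w 0 - h 0 w (0 + int N))"
        by (simp add: drift_def)
      thus "drift x 0 t w - drift x (int N) t w = ?P w - ?Q w"
        unfolding height_difference by (simp add: spin_def)
    qed
    have same: "cov M (\<lambda>w. \<Sum>i=1..int N. spin h (i + a) s w) (\<lambda>w. \<Sum>i=1..int N. spin h (i + a) s w) = real N * ?v"
      if "0 \<le> s" for a s
      by (rule variance_spin_sum[OF that]) (simp add: inj_def)
    have PQ: "cov M ?P ?Q = (\<Sum>i=1..int N. \<Sum>j=1..int N. spin_cov t (x + (i - j)))"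
    proof -
      have "cov M (spin h (i + x) t) (spin h (j + 0) 0) = spin_cov t (x + (i - j))" for i j
        using cov_spin_spin_shift[OF t0, of "x + (i - j)" j 0] by (simp add: spin_cov_def ac_simps)
      thus ?thesis
        by (simp add: M.cov_sum_left M.cov_sum_right square_integrable_spin M.square_integrable_sum t0)
    qed
    have "2 * ?V - 2 * cov M (drift x 0 t) (drift x (int N) t)
        = cov M (\<lambda>w. drift x 0 t w - drift x (int N) t w) (\<lambda>w. drift x 0 t w - drift x (int N) t w)"
      unfolding square[OF square_integrable_drift[OF t0] square_integrable_drift[OF t0]] cov_drift_shift[OF t0, of x "int N"]
      by simp
    also have "\<dots> = 2 * (real N * ?v) - 2 * cov M ?P ?Q"
      unfolding diff square[OF P Q] same[OF t0] same[OF order_refl] by simp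
    finally show ?thesis unfolding PQ by simp
  qed
  have "(\<lambda>N. ?V - cov M (drift x 0 t) (drift x (int N) t)) \<longlonglongrightarrow> ?V - 0"
    by (intro tendsto_diff tendsto_const cov_drift_tendsto_0 t)
  hence "((\<lambda>n. real_of_int \<bar>n\<bar> * spin_cov t (x + n)) has_sum ?V) UNIV"
    unfolding eq by (intro has_sum_first_moment[where v = ?v]) (simp_all add: spin_cov_def cov_spin_nonneg t0)
  \<comment> \<open>The moment lemma centres its sum at 0 and was applied to the covariances
    translated by \<open>x\<close>; the reindexing undoes the translation.\<close>
  moreover have "bij_betw (\<lambda>n. n - x) (UNIV :: int set) UNIV"
    by (rule bij_betwI[where g = "\<lambda>n. n + x"]) auto
  ultimately have "((\<lambda>n. real_of_int \<bar>n - x\<bar> * spin_cov t (x + (n - x))) has_sum ?V) UNIV"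
    by (subst has_sum_reindex_bij_betw[where g = "\<lambda>n. n - x" and f = "\<lambda>n. real_of_int \<bar>n\<bar> * spin_cov t (x + n)"])
  thus ?thesis by (simp add: abs_minus_commute)
qed

section \<open>The first moment of the covariances\<close>

definition window :: "nat \<Rightarrow> 'a \<Rightarrow> real" where
  "window y w = real_of_int (h 0 w (- int y) - h 0 w (int y))"

lemma square_integrable_window: "square_integrable M (window y)"
proof -
  have "window y = (\<lambda>w. profile (- int y) 0 0 w - profile (int y) 0 0 w)"
    by (simp add: window_def profile_def fun_eq_iff)
  thus ?thesis by (simp add: M.square_integrable_diff square_integrable_profile)
qed

text \<open>\<open>window y\<close> telescopes to the sum of the \<open>2 * y\<close> initial spins
  at sites \<open>1 - y\<close> to \<open>y\<close>. The total spin in this range is conserved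
  except for what passes its two ends, and the increments there record exactly that.\<close>

lemma window_eq:
  "window y = (\<lambda>w. (\<Sum>i=1..int (2 * y). spin h (i - int y) s w) - (rise (- int y) s w - rise (int y) s w))"
proof
  fix w
  have "h s w (- int y) - h s w (int y) = (\<Sum>i=1..int (2 * y). slope (h s w) (i - int y))"
    using height_difference[of "h s w" "- int y" "2 * y"] by simp
  hence "real_of_int (h s w (- int y)) - real_of_int (h s w (int y)) = (\<Sum>i=1..int (2 * y). spin h (i - int y) s w)"
    by (simp only: spin_def of_int_diff[symmetric] of_int_sum[symmetric])
  thus "window y w = (\<Sum>i=1..int (2 * y). spin h (i - int y) s w) - (rise (- int y) s w - rise (int y) s w)"
    by (simp add: window_def rise_def increment_def)
qed

abbreviation \<kappa> :: real where
  "\<kappa> \<equiv> cov Stat (net 0) (\<lambda>\<omega>. real_of_int (\<omega> 0 + \<omega> 1))"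

lemma cov_flux_spins:
  assumes s: "0 \<le> s" and y: "1 \<le> y"
  shows "cov M (flux 0 s) (\<lambda>w. \<Sum>i=1..int (2 * y). spin h (i - int y) s w) = \<kappa>"
proof -
  have e: "cov M (flux 0 s) (spin h i s) = cov Stat (net 0) (\<lambda>\<omega>. real_of_int (\<omega> i))" for i
    unfolding flux_def[abs_def] spin_eq by (rule cov_slope[OF s]) auto
  have z: "cov Stat (net 0) (\<lambda>\<omega>. real_of_int (\<omega> i)) = 0" if "i \<noteq> 0" "i \<noteq> 1" for i
    using cov_Mu_disjoint[OF theta, of "\<lambda>a b. p a b - q a b" 0 1 "\<lambda>a b. real_of_int a" i i] that
      square_integrable_net[of 0] square_integrable_Mu_component[OF theta, of i]
    by (simp add: net_def[abs_def])
  have "cov M (flux 0 s) (\<lambda>w. \<Sum>i=1..int (2 * y). spin h (i - int y) s w)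
      = (\<Sum>i=1..int (2 * y). cov Stat (net 0) (\<lambda>\<omega>. real_of_int (\<omega> (i - int y))))"
    using s by (simp add: M.cov_sum_right square_integrable_spin square_integrable_flux e)
  \<comment> \<open>These indices stand for sites 0 and 1, the only ones on which the flux at 0
    depends; \<open>y \<ge> 1\<close> ensures that both lie in the range of summation.\<close>
  also have "\<dots> = (\<Sum>i\<in>{int y, int y + 1}. cov Stat (net 0) (\<lambda>\<omega>. real_of_int (\<omega> (i - int y))))"
    by (rule sum.mono_neutral_right) (use y z in auto)
  also have "\<dots> = cov Stat (net 0) (\<lambda>\<omega>. real_of_int (\<omega> 0)) + cov Stat (net 0) (\<lambda>\<omega>. real_of_int (\<omega> 1))"
    by simp
  also have "\<dots> = \<kappa>"
    using Mu.cov_add_right[OF square_integrable_Mu_component[OF theta, of 0] square_integrable_Mu_component[OF theta, of 1] square_integrable_net[of 0]]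
    by simp
  finally show ?thesis .
qed

text \<open>Evaluating the window at time \<open>s\<close> isolates the constant
  \<open>\<kappa>\<close>. What is left are boundary terms, which reflection brings into a form
  where the flux moves away from a fixed increment.\<close>

lemma cov_window_flux:
  assumes s: "0 \<le> s" and y: "1 \<le> y"
  shows "cov M (window y) (flux 0 s) = \<kappa> - (cov M (rise 0 s) (flux (int y) s) - cov M (rise 0 s) (flux (- int y) s))"
proof -
  have "cov M (flux 0 s) (window y) = \<kappa> - (cov M (flux 0 s) (rise (- int y) s) - cov M (flux 0 s) (rise (int y) s))"
    unfolding window_eq[of y s] cov_flux_spins[OF s y, symmetric]
    by (simp add: M.cov_diff_right s M.square_integrable_diff M.square_integrable_sum square_integrable_spin
        square_integrable_flux square_integrable_rise)
  thus ?thesis by (simp add: M.cov_commute[of "flux 0 s"] cov_rise_flux_reflect[OF s])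
qed

lemma cov_window_rise_tendsto:
  assumes t: "0 < t"
  shows "(\<lambda>y. cov M (window y) (rise 0 t)) \<longlonglongrightarrow> t * \<kappa>"
proof -
  have t0: "0 \<le> t" using t by simp
  obtain B where B: "\<And>s i. s \<in> {0..t} \<Longrightarrow> \<bar>cov M (rise 0 s) (flux i s)\<bar> \<le> B"
    using cov_rise_flux_bound[OF t] by blast
  let ?c = "\<lambda>x :: int \<Rightarrow> int. \<lambda>y. real_of_int (x (- int y) - x (int y))"
  have win: "window y = (\<lambda>w. ?c (h 0 w) y)" for y by (simp add: window_def fun_eq_iff)
  have m: "(\<lambda>x. ?c x y) \<in> borel_measurable (heights W)" for y
    by (rule measurable_int_binary[OF measurable_heights_component measurable_heights_component]) simp
  note cov = cov_initial_rise[OF t0 m square_integrable_window[unfolded win], folded win]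
  \<comment> \<open>The window of size 0 is skipped, since it does not contain the sites 0 and
    1.\<close>
  let ?g = "\<lambda>y s. indicator {0..t} s *\<^sub>R cov M (window (Suc y)) (flux 0 s)"
  have g: "?g y s = indicator {0..t} s *\<^sub>R (\<kappa> - (cov M (rise 0 s) (flux (int (Suc y)) s) - cov M (rise 0 s) (flux (- int (Suc y)) s)))" for y s
    by (cases "s \<in> {0..t}") (simp_all add: cov_window_flux del: of_nat_Suc)
  have "(\<lambda>y. \<integral>s. ?g y s \<partial>lborel) \<longlonglongrightarrow> (\<integral>s. indicator {0..t} s *\<^sub>R \<kappa> \<partial>lborel)"
  proof (rule integral_dominated_convergence[where w = "\<lambda>s. indicator {0..t} s * (\<bar>\<kappa>\<bar> + 2 * B)"])
    show "?g y \<in> borel_measurable lborel" for y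
      using cov(2) unfolding set_integrable_def by (rule borel_measurable_integrable)
    show "integrable lborel (\<lambda>s. indicator {0..t} s * (\<bar>\<kappa>\<bar> + 2 * B))"
      using t by (intro integrable_mult_left integrable_real_indicator) auto
    show "AE s in lborel. (\<lambda>y. ?g y s) \<longlonglongrightarrow> indicator {0..t} s *\<^sub>R \<kappa>"
    proof (rule AE_I2)
      fix s
      show "(\<lambda>y. ?g y s) \<longlonglongrightarrow> indicator {0..t} s *\<^sub>R \<kappa>"
      proof (cases "s \<in> {0..t}")
        case True
        hence s: "0 \<le> s" by simp
        have "(\<lambda>y. \<kappa> - (cov M (rise 0 s) (flux (int (Suc y)) s) - cov M (rise 0 s) (flux (- int (Suc y)) s))) \<longlonglongrightarrow> \<kappa> - (0 - 0)"
          by (intro tendsto_diff tendsto_const cov_flux_tendsto_0 s square_integrable_rise) (auto simp: inj_def)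
        thus ?thesis unfolding g using True by simp
      qed simp
    qed
    show "AE s in lborel. norm (?g y s) \<le> indicator {0..t} s * (\<bar>\<kappa>\<bar> + 2 * B)" for y
    proof (rule AE_I2)
      fix s
      have "\<bar>\<kappa> - (a - b)\<bar> \<le> \<bar>\<kappa>\<bar> + 2 * B" if "\<bar>a\<bar> \<le> B" "\<bar>b\<bar> \<le> B" for a b
        using that by linarith
      thus "norm (?g y s) \<le> indicator {0..t} s * (\<bar>\<kappa>\<bar> + 2 * B)"
        unfolding g using B[of s "int (Suc y)"] B[of s "- int (Suc y)"] by (cases "s \<in> {0..t}") (auto simp del: of_nat_Suc)
    qed
  qed simp
  moreover have "(\<integral>s. indicator {0..t} s *\<^sub>R \<kappa> \<partial>lborel) = t * \<kappa>" using t by simp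
  moreover have "cov M (window (Suc y)) (rise 0 t) = (\<integral>s. ?g y s \<partial>lborel)" for y
    using cov(1)[of "Suc y"] by (simp only: set_lebesgue_integral_def)
  ultimately have "(\<lambda>y. cov M (window (Suc y)) (rise 0 t)) \<longlonglongrightarrow> t * \<kappa>" using t0 by simp
  thus ?thesis by (rule LIMSEQ_imp_Suc)
qed

text \<open>In both variances the increment contributes the same amount, and so do the profiles,
  each being up to sign a sum of \<open>y\<close> independent spins. Only the mixed covariances
  survive, and the two profiles differ by the window plus the increments at its ends.\<close>

lemma variance_drift_difference:
  assumes t: "0 \<le> t"
  shows "(cov M (drift (- int y) 0 t) (drift (- int y) 0 t) - cov M (drift (int y) 0 t) (drift (int y) 0 t)) / 2
    = cov M (window y) (rise 0 t) + cov M (rise 0 t) (rise (- int y) t) - cov M (rise 0 t) (rise (int y) t)"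
proof -
  let ?v = "cov M (spin h 0 0) (spin h 0 0)"
  note sq = square_integrable_rise[OF t] square_integrable_profile[OF t]
  have v: "cov M (profile (int y) 0 t) (profile (int y) 0 t) = real y * ?v"
  proof -
    let ?P = "\<lambda>w. \<Sum>i=1..int y. spin h (i + 0) t w"
    have P: "square_integrable M ?P" by (intro M.square_integrable_sum square_integrable_spin t)
    have "cov M (\<lambda>w. - ?P w) (\<lambda>w. - ?P w) = cov M ?P ?P"
      using M.cov_minus_left[OF P M.square_integrable_minus[OF P]] M.cov_minus_left[OF P P]
        M.cov_commute[of ?P "\<lambda>w. - ?P w"] by linarith
    also have "\<dots> = real y * ?v" by (rule variance_spin_sum[OF t]) (simp add: inj_def)
    finally show ?thesis unfolding profile_pos .
  qed
  have v': "cov M (profile (- int y) 0 t) (profile (- int y) 0 t) = real y * ?v"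
    unfolding profile_neg by (rule variance_spin_sum[OF t]) (simp add: inj_def)
  have e: "cov M (drift x 0 t) (drift x 0 t)
      = cov M (rise 0 t) (rise 0 t) + 2 * cov M (rise 0 t) (profile x 0 t) + cov M (profile x 0 t) (profile x 0 t)" for x
    unfolding drift_eq
    by (simp add: M.cov_add_left M.cov_add_right sq M.square_integrable_add M.cov_commute[of "profile x 0 t" "rise 0 t"])
  have w: "window y = (\<lambda>w. (profile (- int y) 0 t w - profile (int y) 0 t w) - (rise (- int y) t w - rise (int y) t w))"
    by (simp add: window_def profile_def rise_def increment_def fun_eq_iff)
  have "cov M (rise 0 t) (window y) = cov M (rise 0 t) (profile (- int y) 0 t) - cov M (rise 0 t) (profile (int y) 0 t)
      - (cov M (rise 0 t) (rise (- int y) t) - cov M (rise 0 t) (rise (int y) t))"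
    unfolding w by (simp add: M.cov_diff_right sq M.square_integrable_diff)
  thus ?thesis unfolding e v v' by (simp add: M.cov_commute[of "window y"])
qed

text \<open>Subtracting the variance formulas for \<open>x = -y\<close> and \<open>x = y\<close> and
  halving gives \<open>n\<close> clamped to \<open>[-y, y]\<close> as coefficient; the formula for
  \<open>x = 0\<close> supplies the absolute summability needed to remove the clamp.\<close>

lemma first_moment_has_sum:
  assumes t: "0 < t"
  shows "((\<lambda>n. real_of_int n * spin_cov t n) has_sum t * \<kappa>) UNIV"
proof (rule truncated_first_moment_limit)
  have t0: "0 \<le> t" using t by simp
  let ?d = "\<lambda>y. cov M (window y) (rise 0 t) + cov M (rise 0 t) (rise (- int y) t) - cov M (rise 0 t) (rise (int y) t)"
  show "0 \<le> spin_cov t n" for n unfolding spin_cov_def by (rule cov_spin_nonneg[OF t0])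
  show "(\<lambda>n. real_of_int \<bar>n\<bar> * spin_cov t n) summable_on UNIV"
    using variance_drift_has_sum[OF t, of 0] by (auto simp: summable_on_def)
  show "((\<lambda>n. (real_of_int \<bar>n + int y\<bar> - real_of_int \<bar>n - int y\<bar>) / 2 * spin_cov t n) has_sum ?d y) UNIV" for y
  proof -
    let ?V = "\<lambda>x. cov M (drift x 0 t) (drift x 0 t)"
    have "((\<lambda>n. real_of_int \<bar>- int y - n\<bar> * spin_cov t n + - (real_of_int \<bar>int y - n\<bar> * spin_cov t n)) has_sum (?V (- int y) + - ?V (int y))) UNIV"
      by (intro has_sum_add has_sum_uminusI variance_drift_has_sum t)
    hence hs: "((\<lambda>n. (1 / 2) * (real_of_int \<bar>- int y - n\<bar> * spin_cov t n + - (real_of_int \<bar>int y - n\<bar> * spin_cov t n)))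
        has_sum ((1 / 2) * (?V (- int y) + - ?V (int y)))) UNIV"
      by (rule has_sum_cmult_right)
    have e: "(1 / 2) * (real_of_int \<bar>- int y - n\<bar> * spin_cov t n + - (real_of_int \<bar>int y - n\<bar> * spin_cov t n))
        = (real_of_int \<bar>n + int y\<bar> - real_of_int \<bar>n - int y\<bar>) / 2 * spin_cov t n" for n
    proof -
      have "\<bar>- int y - n\<bar> = \<bar>n + int y\<bar>" "\<bar>int y - n\<bar> = \<bar>n - int y\<bar>" by auto
      thus ?thesis by (simp only: diff_divide_distrib left_diff_distrib) (simp add: algebra_simps)
    qed
    have d: "(1 / 2) * (?V (- int y) + - ?V (int y)) = ?d y"
      unfolding variance_drift_difference[OF t0, symmetric] by simp
    show ?thesis using hs unfolding e d .
  qed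
  have "(\<lambda>y. cov M (rise 0 t) (rise (- int (Suc y)) t)) \<longlonglongrightarrow> 0" "(\<lambda>y. cov M (rise 0 t) (rise (int (Suc y)) t)) \<longlonglongrightarrow> 0"
    by (rule cov_rise_rise_tendsto_0[OF t]; auto simp: inj_def)+
  hence "(\<lambda>y. cov M (rise 0 t) (rise (- int y) t)) \<longlonglongrightarrow> 0" "(\<lambda>y. cov M (rise 0 t) (rise (int y) t)) \<longlonglongrightarrow> 0"
    by (blast intro: LIMSEQ_imp_Suc)+
  hence "?d \<longlonglongrightarrow> t * \<kappa> + 0 - 0"
    by (intro tendsto_diff tendsto_add cov_window_rise_tendsto t)
  thus "?d \<longlonglongrightarrow> t * \<kappa>" by simp
qed

end

text \<open>Square integrability of the current is part of the conclusion, because the variance of a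
  function that is not square integrable could be a mere default value. For real terms
  \<open>has_sum\<close> means unconditional and hence absolute convergence.\<close>

theorem theorem2p1:
  fixes \<omega>min \<omega>max :: "int extended"
    and p q :: "int \<Rightarrow> int \<Rightarrow> real"
    and f :: "int \<Rightarrow> real"
    and W :: "(int \<Rightarrow> int) set"
    and S :: "real \<Rightarrow> (int \<Rightarrow> int) \<Rightarrow> (int \<Rightarrow> int) measure"
    and M :: "'a measure"
    and h :: "real \<Rightarrow> 'a \<Rightarrow> int \<Rightarrow> int"
    and \<theta> V t :: real
  assumes "deposition_dynamics \<omega>min \<omega>max p q f W S"
    and "\<theta> \<in> theta_range \<omega>min \<omega>max f"
    and "markov_process M (heights W) S h"
    and "distr M conf (\<lambda>w. slope (h 0 w)) = Mu \<omega>min \<omega>max f \<theta>"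
    and "t > 0"
  shows "integrable M (\<lambda>w. (current h V t w)\<^sup>2) \<and>
    ((\<lambda>n::int. real_of_int \<bar>to_zero (V * t) - n\<bar> * cov M (spin h n t) (spin h 0 0))
       has_sum prob_space.variance M (current h V t)) UNIV \<and>
    ((\<lambda>n::int. real_of_int n * cov M (spin h n t) (spin h 0 0))
       has_sum t * cov (Mu \<omega>min \<omega>max f \<theta>)
                    (\<lambda>\<omega>. p (\<omega> 0) (\<omega> 1) - q (\<omega> 0) (\<omega> 1))
                    (\<lambda>\<omega>. real_of_int (\<omega> 0 + \<omega> 1))) UNIV"
proof -
  interpret stationary_dynamics \<omega>min \<omega>max p q f W S M h \<theta>
    using assms(1-4) by (intro stationary_dynamics.intro stationary_dynamics_axioms.intro)
  have c: "current h V t = drift (to_zero (V * t)) 0 t"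
    by (simp add: current_def drift_def fun_eq_iff)
  have n: "(\<lambda>\<omega>. p (\<omega> 0) (\<omega> 1) - q (\<omega> 0) (\<omega> 1)) = net 0"
    by (simp add: net_def fun_eq_iff)
  have "integrable M (\<lambda>w. (current h V t w)\<^sup>2)"
    using square_integrable_drift[of t "to_zero (V * t)" 0] assms(5) unfolding c square_integrable_def by simp
  moreover have "((\<lambda>n::int. real_of_int \<bar>to_zero (V * t) - n\<bar> * cov M (spin h n t) (spin h 0 0))
       has_sum M.variance (current h V t)) UNIV"
    using variance_drift_has_sum[OF assms(5), of "to_zero (V * t)"] unfolding c spin_cov_def M.cov_self .
  moreover have "((\<lambda>n::int. real_of_int n * cov M (spin h n t) (spin h 0 0))
       has_sum t * cov (Mu \<omega>min \<omega>max f \<theta>) (\<lambda>\<omega>. p (\<omega> 0) (\<omega> 1) - q (\<omega> 0) (\<omega> 1)) (\<lambda>\<omega>. real_of_int (\<omega> 0 + \<omega> 1))) UNIV"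
    using first_moment_has_sum[OF assms(5)] unfolding n spin_cov_def .
  ultimately show ?thesis by blast
qed

end
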